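(* Let $n\ge2$ and $d\ge m\ge2$ be integers. If $\widetilde\rho_m:\mathbb P(\widetilde{\mathcal F}^m_d)\to\mathbb P(\operatorname{Sym}^dV^\vee)$ is generically finite onto its image $\mathbb B^m_d$, then $$\dim\mathbb B^m_d=\binom{d+2n-2}{2n-1}+\binom{d-m+2n-2}{2n-2}+\binom{m+2n-3}{m}+2n-3.$$
   Context: We work over $\mathbb C$; $(V,\omega)$ is a complex symplectic vector space of dimension $2n$ and $\mathbb P^{2n-1}=\mathbb P(V)$. For a hyperplane $H=V(\ell)$, the polar point is $\sigma(H)=[v_\ell]\in H$, where $\ell(u)=\omega(v_\ell,u)$ for all $u\in V$. For a vector bundle $E$ on a base $B$, $\pi:\mathbb P(E)\to B$ parametrizes one-dimensional subspaces of the fibers, with tautological line subbundle $\mathcal O_{\mathbb P(E)}(-1)=\mathcal O_E(-1)\subset\pi^*E$; $\operatorname{Sym}^kE=0$ for $k<0$; pullbacks of bundles are not written. Let $\check{\mathbb P}^{2n-1}$ be the space of hyperplanes of $\mathbb P(V)$ and $\mathcal F=V^\vee\otimes\mathcal O_{\check{\mathbb P}^{2n-1}}$. The tautological sequence $0\to\mathcal O_{\check{\mathbb P}^{2n-1}}(-1)\to\mathcal F\to\mathcal Q\to0$ defines $\mathcal Q$ (its fiber at $H$ is the space of linear forms on $H$). The bundle $\mathbb P(\mathcal Q^\vee)$ parametrizes pairs $(H,p)$ with $p\in H$; on it $0\to\mathcal G\to\mathcal Q\to\mathcal O_{\mathcal Q^\vee}(1)\to0$ defines $\mathcal G$, whose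 fiber at $(H,p)$ is the space of linear forms on $H$ vanishing at $p$. Let $s_\sigma:\check{\mathbb P}^{2n-1}\to\mathbb P(\mathcal Q^\vee)$, $H\mapsto(H,\sigma(H))$, and $\mathcal G_\sigma=s_\sigma^*\mathcal G$. Set $\mathbb Y_m=\mathbb P(\operatorname{Sym}^m\mathcal G_\sigma)$: its points are pairs $(H,[q])$ with $H$ a hyperplane and $q\ne0$ a degree-$m$ form on $H$ that is a polynomial in the linear forms on $H$ vanishing at $\sigma(H)$ (the equation of a possibly nonreduced cone in $H$ whose vertex contains $\sigma(H)$). Over $\mathbb Y_m$, multiplication gives an inclusion $\mathcal O_{\operatorname{Sym}^m\mathcal G_\sigma}(-1)\otimes\operatorname{Sym}^{d-m}\mathcal Q\hookrightarrow\operatorname{Sym}^d\mathcal Q$, and $\widetilde{\mathcal F}^m_d\subset\operatorname{Sym}^d\mathcal F$ is the inverse image of this subbundle under $\operatorname{Sym}^d\mathcal F\to\operatorname{Sym}^d\mathcal Q$. Thus the fiber of $\widetilde{\mathcal F}^m_d$ over $(H,[q])$ consists of the degree-$d$ forms on $V$ whose restriction to $H$ is a multiple of $q$. The involutive cone incidence $\widetilde\rho_m:\mathbb P(\widetilde{\mathcal F}^m_d)\to\mathbb P(\operatorname{Sym}^dV^\vee)$ is the map induced by $\widetilde{\mathcal F}^m_d\subset\operatorname{Sym}^dV^\vee\otimes\mathcal O$, and $\mathbb B^m_d$ is its image. *)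

theory Defs
  imports "HOL-Analysis.Analysis" "HOL-Library.Function_Algebras"
begin

section \<open>Forms on complex vector spaces\<close>

text \<open>
  A complex vector space is given by its scalar multiplication \<open>s\<close> on an additive group, and
  \<open>W\<close> ranges over its subspaces. Forms on \<open>W\<close> are identified with the polynomial functions
  they define, which loses nothing over the infinite field of complex numbers; a function on \<open>W\<close>
  is represented by its extension by zero to the whole type. Spaces of functions are themselves
  vector spaces with scalar multiplication \<open>fscale\<close>, so that the constructions below
  apply to them as well.
\<close>

definition fscale :: "complex \<Rightarrow> ('a \<Rightarrow> complex) \<Rightarrow> 'a \<Rightarrow> complex" where
  "fscale c f = (\<lambda>x. c * f x)"

definition restr :: "'a set \<Rightarrow> ('a \<Rightarrow> complex) \<Rightarrow> 'a \<Rightarrow> complex" where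
  "restr W f = (\<lambda>x. if x \<in> W then f x else 0)"

definition linear_forms ::
    "(complex \<Rightarrow> 'a::ab_group_add \<Rightarrow> 'a) \<Rightarrow> 'a set \<Rightarrow> ('a \<Rightarrow> complex) set" where
  "linear_forms s W = {l. (\<forall>x\<in>W. \<forall>y\<in>W. l (x + y) = l x + l y)
                        \<and> (\<forall>c. \<forall>x\<in>W. l (s c x) = c * l x)
                        \<and> (\<forall>x. x \<notin> W \<longrightarrow> l x = 0)}"

text \<open>
  For a space \<open>L\<close> of linear forms on \<open>W\<close>, \<open>sym_power W k L\<close> is the \<open>k\<close>-th
  symmetric power of \<open>L\<close>, seen inside the functions on \<open>W\<close>: the span of the \<open>k\<close>-fold
  products of elements of \<open>L\<close>.
\<close>

definition sym_power ::
    "'a set \<Rightarrow> nat \<Rightarrow> ('a \<Rightarrow> complex) set \<Rightarrow> ('a \<Rightarrow> complex) set" where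
  "sym_power W k L =
     module.span fscale {restr W (\<lambda>x. \<Prod>i<k. l i x) |l. \<forall>i<k. l i \<in> L}"

definition forms ::
    "(complex \<Rightarrow> 'a::ab_group_add \<Rightarrow> 'a) \<Rightarrow> 'a set \<Rightarrow> nat \<Rightarrow> ('a \<Rightarrow> complex) set" where
  "forms s W k = sym_power W k (linear_forms s W)"


section \<open>Projective spaces and the Zariski topology\<close>

definition proj :: "(complex \<Rightarrow> 'a::ab_group_add \<Rightarrow> 'a) \<Rightarrow> 'a set \<Rightarrow> 'a set set" where
  "proj s W = {module.span s {x} |x. x \<in> W \<and> x \<noteq> 0}"

definition zero_locus ::
    "(complex \<Rightarrow> 'a::ab_group_add \<Rightarrow> 'a) \<Rightarrow> 'a set \<Rightarrow> ('a \<Rightarrow> complex) set \<Rightarrow> 'a set set" where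
  "zero_locus s W S = {p \<in> proj s W. \<forall>F\<in>S. \<forall>x\<in>p. F x = 0}"

definition zariski :: "(complex \<Rightarrow> 'a::ab_group_add \<Rightarrow> 'a) \<Rightarrow> 'a set \<Rightarrow> 'a set topology" where
  "zariski s W =
     topology (\<lambda>U. \<exists>S. S \<subseteq> (\<Union>k. forms s W k) \<and> U = proj s W - zero_locus s W S)"

definition irreducible_closed :: "'a topology \<Rightarrow> 'a set \<Rightarrow> bool" where
  "irreducible_closed T Z \<longleftrightarrow> closedin T Z \<and> Z \<noteq> {} \<and>
     (\<forall>A B. closedin T A \<and> closedin T B \<and> Z = A \<union> B \<longrightarrow> Z = A \<or> Z = B)"

definition krull_dim :: "'a topology \<Rightarrow> enat" where
  "krull_dim T = Sup {enat k |k. \<exists>Z :: nat \<Rightarrow> 'a set.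
     (\<forall>i\<le>k. irreducible_closed T (Z i)) \<and> (\<forall>i<k. Z i \<subset> Z (Suc i))}"

text \<open>
  \<open>generically_finite_onto X f T\<close>: the map \<open>f\<close> has finite fibres over a dense open
  subset of its image, whose topology is \<open>T\<close>.
\<close>

definition generically_finite_onto :: "'x set \<Rightarrow> ('x \<Rightarrow> 'y) \<Rightarrow> 'y topology \<Rightarrow> bool" where
  "generically_finite_onto X f T \<longleftrightarrow> topspace T = f ` X \<and>
     (\<exists>U. openin T U \<and> T closure_of U = topspace T \<and> (\<forall>y\<in>U. finite {x \<in> X. f x = y}))"


section \<open>Symplectic spaces and the involutive cone incidence\<close>

definition symplectic_form ::
    "(complex \<Rightarrow> 'v::ab_group_add \<Rightarrow> 'v) \<Rightarrow> ('v \<Rightarrow> 'v \<Rightarrow> complex) \<Rightarrow> bool" where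
  "symplectic_form s \<omega> \<longleftrightarrow>
     (\<forall>v. Vector_Spaces.linear s (*) (\<lambda>u. \<omega> v u)) \<and>
     (\<forall>u. Vector_Spaces.linear s (*) (\<lambda>v. \<omega> v u)) \<and>
     (\<forall>v. \<omega> v v = 0) \<and>
     (\<forall>v. (\<forall>u. \<omega> v u = 0) \<longrightarrow> v = 0)"

text \<open>A hyperplane of the projective space of \<open>V\<close> is represented by its affine cone in \<open>V\<close>.\<close>

definition hyperplanes :: "(complex \<Rightarrow> 'v::ab_group_add \<Rightarrow> 'v) \<Rightarrow> 'v set set" where
  "hyperplanes s = {{u. l u = 0} |l. l \<in> linear_forms s UNIV \<and> l \<noteq> 0}"

definition polar_point ::
    "(complex \<Rightarrow> 'v::ab_group_add \<Rightarrow> 'v) \<Rightarrow> ('v \<Rightarrow> 'v \<Rightarrow> complex) \<Rightarrow> 'v set \<Rightarrow> 'v set" where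
  "polar_point s \<omega> H = (THE p. \<exists>l v. l \<in> linear_forms s UNIV \<and> l \<noteq> 0 \<and>
     H = {u. l u = 0} \<and> (\<forall>u. l u = \<omega> v u) \<and> p = module.span s {v})"

text \<open>The fibre of \<open>\<G>\<^sub>\<sigma>\<close> at \<open>H\<close>.\<close>

definition G_fibre ::
    "(complex \<Rightarrow> 'v::ab_group_add \<Rightarrow> 'v) \<Rightarrow> ('v \<Rightarrow> 'v \<Rightarrow> complex) \<Rightarrow> 'v set
      \<Rightarrow> ('v \<Rightarrow> complex) set" where
  "G_fibre s \<omega> H = {l \<in> linear_forms s H. \<forall>x\<in>polar_point s \<omega> H. l x = 0}"

definition Y_space ::
    "(complex \<Rightarrow> 'v::ab_group_add \<Rightarrow> 'v) \<Rightarrow> ('v \<Rightarrow> 'v \<Rightarrow> complex) \<Rightarrow> nat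
      \<Rightarrow> ('v set \<times> ('v \<Rightarrow> complex) set) set" where
  "Y_space s \<omega> m =
     {(H, p). H \<in> hyperplanes s \<and> p \<in> proj fscale (sym_power H m (G_fibre s \<omega> H))}"

text \<open>
  The fibre of \<open>\<F>\<^sub>d\<^sup>m\<close> (with tilde) over \<open>(H, p)\<close>, where \<open>p\<close> is the
  line spanned by \<open>q\<close>. It is only meaningful for \<open>m \<le> d\<close>.
\<close>

definition F_fibre ::
    "(complex \<Rightarrow> 'v::ab_group_add \<Rightarrow> 'v) \<Rightarrow> nat \<Rightarrow> nat \<Rightarrow> 'v set \<Rightarrow> ('v \<Rightarrow> complex) set
      \<Rightarrow> ('v \<Rightarrow> complex) set" where
  "F_fibre s d m H p =
     {f \<in> forms s UNIV d. \<exists>q\<in>p. \<exists>g\<in>forms s H (d - m). restr H f = (\<lambda>x. q x * g x)}"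

definition cone_incidence ::
    "(complex \<Rightarrow> 'v::ab_group_add \<Rightarrow> 'v) \<Rightarrow> ('v \<Rightarrow> 'v \<Rightarrow> complex) \<Rightarrow> nat \<Rightarrow> nat
      \<Rightarrow> (('v set \<times> ('v \<Rightarrow> complex) set) \<times> ('v \<Rightarrow> complex) set) set" where
  "cone_incidence s \<omega> d m =
     {((H, p), r). (H, p) \<in> Y_space s \<omega> m \<and> r \<in> proj fscale (F_fibre s d m H p)}"

text \<open>
  Since \<open>cone_incidence\<close> lies in the product of \<open>Y_space\<close> with the projective space of
  degree \<open>d\<close> forms on \<open>V\<close>, the incidence map is the second projection.
\<close>

definition rho ::
    "('v set \<times> ('v \<Rightarrow> complex) set) \<times> ('v \<Rightarrow> complex) set \<Rightarrow> ('v \<Rightarrow> complex) set" where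
  "rho z = snd z"

definition B_locus ::
    "(complex \<Rightarrow> 'v::ab_group_add \<Rightarrow> 'v) \<Rightarrow> ('v \<Rightarrow> 'v \<Rightarrow> complex) \<Rightarrow> nat \<Rightarrow> nat
      \<Rightarrow> ('v \<Rightarrow> complex) set set" where
  "B_locus s \<omega> d m = rho ` cone_incidence s \<omega> d m"

definition B_variety ::
    "(complex \<Rightarrow> 'v::ab_group_add \<Rightarrow> 'v) \<Rightarrow> ('v \<Rightarrow> 'v \<Rightarrow> complex) \<Rightarrow> nat \<Rightarrow> nat
      \<Rightarrow> ('v \<Rightarrow> complex) set topology" where
  "B_variety s \<omega> d m =
     subtopology (zariski fscale (forms s UNIV d)) (B_locus s \<omega> d m)"


section \<open>The description operators above are well-defined\<close>

lemma vector_space_fscale: "vector_space (fscale :: complex \<Rightarrow> ('a \<Rightarrow> complex) \<Rightarrow> _)"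
  by unfold_locales (auto simp: fscale_def fun_eq_iff algebra_simps)

interpretation fsc: vector_space "fscale :: complex \<Rightarrow> ('a \<Rightarrow> complex) \<Rightarrow> _"
  by (rule vector_space_fscale)

lemma polar_point_eq:
  assumes "vector_space s" and om: "symplectic_form s \<omega>"
    and l: "l \<in> linear_forms s UNIV" "l \<noteq> 0" and v: "\<And>u. l u = \<omega> v u"
  shows "polar_point s \<omega> {u. l u = 0} = module.span s {v}"
proof -
  interpret vector_space s by fact
  have lin2: "Vector_Spaces.linear s (*) (\<lambda>v. \<omega> v u)" for u
    using om by (simp add: symplectic_form_def)
  have addom: "\<omega> (a + b) u = \<omega> a u + \<omega> b u" for a b u
    using lin2[of u] by (simp add: Vector_Spaces.linear_iff)
  have scom: "\<omega> (s c a) u = c * \<omega> a u" for a c u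
    using lin2[of u] by (simp add: Vector_Spaces.linear_iff)
  have nd: "a = 0" if "\<And>u. \<omega> a u = 0" for a
    using om that by (auto simp: symplectic_form_def)
  have uniq: "span {v'} = span {v}"
    if l': "l' \<in> linear_forms s UNIV" "l' \<noteq> 0" "{u. l u = 0} = {u. l' u = 0}"
      "\<forall>u. l' u = \<omega> v' u" for l' v'
  proof -
    obtain e where e: "l e \<noteq> 0" using l(2) by (auto simp: fun_eq_iff)
    have e': "l' e \<noteq> 0" using e l'(3) by auto
    define c where "c = l' e / l e"
    have c0: "c \<noteq> 0" using e e' by (simp add: c_def)
    have propn: "l' u = c * l u" for u
    proof -
      have *: "k (u + s (- (l u / l e)) e) = k u - (l u / l e) * k e"
        if "k \<in> linear_forms s UNIV" for k
        using that by (simp add: linear_forms_def del: scale_minus_left)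
      have "l (u + s (- (l u / l e)) e) = 0" using *[OF l(1)] e by simp
      then have "l' (u + s (- (l u / l e)) e) = 0" using l'(3) by auto
      then have "l' u = (l u / l e) * l' e" using *[OF l'(1)] by simp
      then show ?thesis by (simp add: c_def)
    qed
    have "v' + s (- c) v = 0"
    proof (rule nd)
      fix u
      have "\<omega> (v' + s (- c) v) u = \<omega> v' u - c * \<omega> v u"
        by (simp only: addom scom) simp
      then show "\<omega> (v' + s (- c) v) u = 0" using propn[of u] l'(4) v by simp
    qed
    then have "v' = s c v" by (simp add: add_eq_0_iff)
    then show ?thesis using c0 by (simp add: span_image_scale[of "{v}" "\<lambda>_. c", simplified])
  qed
  show ?thesis unfolding polar_point_def
  proof (rule the_equality)
    show "\<exists>la va. la \<in> linear_forms s UNIV \<and> la \<noteq> 0 \<and> {u. l u = 0} = {u. la u = 0} \<and>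
      (\<forall>u. la u = \<omega> va u) \<and> span {v} = span {va}"
      using l v by blast
  qed (use uniq in blast)
qed

lemma sym_power_mult:
  assumes "F \<in> sym_power W j L" "G \<in> sym_power W k L"
  shows "(\<lambda>x. F x * G x) \<in> sym_power W (j + k) L"
proof -
  let ?S = "\<lambda>k. {restr W (\<lambda>x. \<Prod>i<k. l i x) |l. \<forall>i<k. l i \<in> L}"
  have gen: "(\<lambda>x. a x * b x) \<in> ?S (j + k)" if ab: "a \<in> ?S j" "b \<in> ?S k" for a b
  proof -
    obtain f g where f: "a = restr W (\<lambda>x. \<Prod>i<j. f i x)" "\<forall>i<j. f i \<in> L"
      and g: "b = restr W (\<lambda>x. \<Prod>i<k. g i x)" "\<forall>i<k. g i \<in> L"
      using ab by blast
    define h where "h i = (if i < j then f i else g (i - j))" for i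
    have "(\<Prod>i<j + k. h i x) = (\<Prod>i<j. f i x) * (\<Prod>i<k. g i x)" for x
    proof -
      have "(\<Prod>i<j + k. h i x) = (\<Prod>i<j. h i x) * (\<Prod>i=j..<j + k. h i x)"
        by (metis atLeast0LessThan le_add1 prod.atLeastLessThan_concat zero_le)
      also have "(\<Prod>i=j..<j + k. h i x) = (\<Prod>i<k. h (i + j) x)"
        using prod.shift_bounds_nat_ivl[of "\<lambda>i. h i x" 0 j k]
        by (simp add: atLeast0LessThan add.commute)
      finally show ?thesis by (simp add: h_def)
    qed
    then have "(\<lambda>x. a x * b x) = restr W (\<lambda>x. \<Prod>i<j + k. h i x)"
      using f g by (auto simp: restr_def)
    moreover have "\<forall>i<j + k. h i \<in> L" using f g by (auto simp: h_def)
    ultimately show ?thesis by blast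
  qed
  have one: "(\<lambda>x. F x * b x) \<in> fsc.span (?S (j + k))" if b: "b \<in> ?S k" for b
  proof -
    have "F \<in> fsc.span (?S j)" using assms(1) by (simp add: sym_power_def)
    then show ?thesis
    proof (induction rule: fsc.span_induct_alt)
      case base
      then show ?case using fsc.span_zero by (simp add: zero_fun_def)
    next
      case (step c a f)
      have "(\<lambda>x. (fscale c a + f) x * b x) = fscale c (\<lambda>x. a x * b x) + (\<lambda>x. f x * b x)"
        by (auto simp: fscale_def algebra_simps)
      moreover have "(\<lambda>x. a x * b x) \<in> fsc.span (?S (j + k))"
        by (rule fsc.span_base[OF gen[OF step(1) b]])
      ultimately show ?case using step by (simp add: fsc.span_add fsc.span_scale)
    qed
  qed
  have "G \<in> fsc.span (?S k)" using assms(2) by (simp add: sym_power_def)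
  then have "(\<lambda>x. F x * G x) \<in> fsc.span (?S (j + k))"
  proof (induction rule: fsc.span_induct_alt)
    case base
    then show ?case using fsc.span_zero by (simp add: zero_fun_def)
  next
    case (step c b f)
    have "(\<lambda>x. F x * (fscale c b + f) x) = fscale c (\<lambda>x. F x * b x) + (\<lambda>x. F x * f x)"
      by (auto simp: fscale_def algebra_simps)
    then show ?case using step one[OF step(1)] by (simp add: fsc.span_add fsc.span_scale)
  qed
  then show ?thesis by (simp add: sym_power_def)
qed

lemma forms_scale:
  assumes "vector_space s" "module.subspace s W" "F \<in> forms s W k" "x \<in> W"
  shows "F (s c x) = c ^ k * F x"
proof -
  interpret vector_space s by fact
  have cx: "s c x \<in> W" using assms(2,4) by (simp add: subspace_scale)
  have "F \<in> fsc.span {restr W (\<lambda>x. \<Prod>i<k. l i x) |l. \<forall>i<k. l i \<in> linear_forms s W}"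
    using assms(3) by (simp add: forms_def sym_power_def)
  then show ?thesis
  proof (induction rule: fsc.span_induct_alt)
    case (step a b f)
    then obtain l where l: "b = restr W (\<lambda>x. \<Prod>i<k. l i x)" "\<forall>i<k. l i \<in> linear_forms s W"
      by blast
    have "(\<Prod>i<k. l i (s c x)) = (\<Prod>i<k. c * l i x)"
      using l(2) assms(4) by (intro prod.cong) (auto simp: linear_forms_def)
    then have "b (s c x) = c ^ k * b x"
      using l(1) cx assms(4) by (simp add: restr_def prod.distrib)
    then show ?case using step.IH by (simp add: fscale_def algebra_simps)
  qed simp
qed

lemma closedin_zariski:
  assumes "vector_space s" "module.subspace s W"
  shows "closedin (zariski s W) C \<longleftrightarrow>
           (\<exists>S. S \<subseteq> (\<Union>k. forms s W k) \<and> C = zero_locus s W S)"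
    and "topspace (zariski s W) = proj s W"
proof -
  interpret vector_space s by fact
  let ?A = "\<Union>k. forms s W k"
  let ?op = "\<lambda>U. \<exists>S. S \<subseteq> ?A \<and> U = proj s W - zero_locus s W S"
  have inter: "?op (U \<inter> U')" if UU: "?op U" "?op U'" for U U'
  proof -
    obtain S T where S: "S \<subseteq> ?A" "U = proj s W - zero_locus s W S"
      and T: "T \<subseteq> ?A" "U' = proj s W - zero_locus s W T"
      using UU by blast
    let ?R = "{(\<lambda>x. F x * G x) |F G. F \<in> S \<and> G \<in> T}"
    have "(\<lambda>x. F x * G x) \<in> ?A" if FG: "F \<in> S" "G \<in> T" for F G
    proof -
      obtain j k where "F \<in> forms s W j" "G \<in> forms s W k" using FG S T by blast
      then show ?thesis using sym_power_mult[of F W j _ G k] by (auto simp: forms_def)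
    qed
    then have "?R \<subseteq> ?A" by blast
    moreover have "p \<in> zero_locus s W S \<union> zero_locus s W T"
      if p: "p \<in> zero_locus s W ?R" for p
    proof (rule ccontr)
      assume neg: "\<not> ?thesis"
      obtain z where z: "z \<in> W" "p = span {z}" "p \<in> proj s W"
        using p by (auto simp: zero_locus_def proj_def)
      obtain F G x y where F: "F \<in> S" "x \<in> p" "F x \<noteq> 0" and G: "G \<in> T" "y \<in> p" "G y \<noteq> 0"
        using neg z(3) by (auto simp: zero_locus_def)
      obtain a b where ab: "x = s a z" "y = s b z" using F G z by (auto simp: span_singleton)
      obtain j k where jk: "F \<in> forms s W j" "G \<in> forms s W k" using F G S T by blast
      have "F z \<noteq> 0" "G z \<noteq> 0"
        using F(3) G(3) ab forms_scale[OF assms jk(1) z(1), of a]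
          forms_scale[OF assms jk(2) z(1), of b] by auto
      moreover have "z \<in> p" by (simp add: z span_base)
      moreover have "(\<lambda>x. F x * G x) \<in> ?R" using F(1) G(1) by blast
      ultimately show False using p by (fastforce simp: zero_locus_def)
    qed
    moreover have "zero_locus s W S \<union> zero_locus s W T \<subseteq> zero_locus s W ?R"
      by (auto simp: zero_locus_def)
    ultimately show ?thesis using S T by (intro exI[of _ ?R]) blast
  qed
  have union: "?op (\<Union>K)" if K: "\<forall>U\<in>K. ?op U" for K
  proof -
    obtain g where g: "\<forall>U\<in>K. g U \<subseteq> ?A \<and> U = proj s W - zero_locus s W (g U)"
      using bchoice[OF K] by blast
    have "\<Union>K = proj s W - zero_locus s W (\<Union>(g ` K))"
    proof (rule set_eqI)
      fix p
      show "p \<in> \<Union>K \<longleftrightarrow> p \<in> proj s W - zero_locus s W (\<Union>(g ` K))"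
      proof
        assume "p \<in> \<Union>K"
        then obtain U where U: "U \<in> K" "p \<in> U" by blast
        then have "p \<in> proj s W - zero_locus s W (g U)" using g by blast
        then show "p \<in> proj s W - zero_locus s W (\<Union>(g ` K))"
          using U(1) by (fastforce simp: zero_locus_def)
      next
        assume p: "p \<in> proj s W - zero_locus s W (\<Union>(g ` K))"
        then obtain U where U: "U \<in> K" "p \<in> proj s W - zero_locus s W (g U)"
          by (auto simp: zero_locus_def)
        then have "p \<in> U" using g by blast
        then show "p \<in> \<Union>K" using U(1) by blast
      qed
    qed
    moreover have "\<Union>(g ` K) \<subseteq> ?A" using g by blast
    ultimately show ?thesis by blast
  qed
  have "istopology ?op"
    unfolding istopology_def using inter union by blast
  then have op: "openin (zariski s W) U \<longleftrightarrow> ?op U" for U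
    by (simp add: zariski_def topology_inverse')
  have full: "?op (proj s W)"
  proof -
    have one: "restr W (\<lambda>x. 1) \<in> forms s W 0"
      unfolding forms_def sym_power_def by (rule fsc.span_base) (auto simp: restr_def)
    have "p \<notin> zero_locus s W {restr W (\<lambda>x. 1)}" for p
    proof
      assume p: "p \<in> zero_locus s W {restr W (\<lambda>x. 1)}"
      then obtain z where "z \<in> W" "p = span {z}" by (auto simp: zero_locus_def proj_def)
      moreover from this have "z \<in> p" by (simp add: span_base)
      ultimately show False using p by (auto simp: zero_locus_def restr_def)
    qed
    then show ?thesis using one by (intro exI[of _ "{restr W (\<lambda>x. 1)}"]) auto
  qed
  show top: "topspace (zariski s W) = proj s W"
    using full op unfolding topspace_def by blast
  have sub: "zero_locus s W S \<subseteq> proj s W" for S by (auto simp: zero_locus_def)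
  show "closedin (zariski s W) C \<longleftrightarrow> (\<exists>S. S \<subseteq> ?A \<and> C = zero_locus s W S)"
  proof
    assume "closedin (zariski s W) C"
    then obtain S where "S \<subseteq> ?A" "proj s W - C = proj s W - zero_locus s W S" "C \<subseteq> proj s W"
      by (auto simp: closedin_def top op)
    then show "\<exists>S. S \<subseteq> ?A \<and> C = zero_locus s W S" using sub by (metis double_diff subset_refl)
  next
    assume "\<exists>S. S \<subseteq> ?A \<and> C = zero_locus s W S"
    then show "closedin (zariski s W) C" using sub by (auto simp: closedin_def top op)
  qed
qed

end

theory Submission
  imports Defs
begin

text \<open>
  A form in the fibre over \<open>(H, [q])\<close>, with \<open>H\<close> the kernel of \<open>\<omega>(v, _)\<close>, is
  \<open>\<omega>(v, _) g + q h\<close>, so \<open>\<B>\<^sup>m\<^sub>d\<close> is covered by finitely many polynomial charts whose number of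
  parameters is the dimension of the incidence variety. Upper bound: along a chain of \<open>r + 1\<close>
  irreducible closed sets one finds about \<open>K\<^sup>r\<close> independent forms of degree \<open>O(K)\<close>, while the
  pullbacks to a chart with \<open>D\<close> parameters live in a space of dimension \<open>O(K\<^sup>D)\<close>. Lower bound: the
  derivative of one chart is injective at \<open>x\<^sub>0 x\<^sub>1\<^sup>d\<^sup>-\<^sup>1 + x\<^sub>2\<^sup>m x\<^sub>1\<^sup>d\<^sup>-\<^sup>m\<close>, so the closures of the
  images of a flag of coordinate subspaces through this point form a strict chain.
\<close>

section \<open>Monomials, polynomial functions and polynomial maps\<close>

text \<open>The dimension is measured by chains in a mere subset of projective space, so both bounds
  are obtained by counting homogeneous forms. If \<open>(K + 1)^r\<close> is at most a constant
  times \<open>(e K \<delta> + 1)^D\<close> for every \<open>K\<close>, then \<open>r\<close> is at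
  most \<open>D\<close>; several charts only enlarge the constant. Forms can be added only in equal
  degree, so families are padded with powers of a linear form that is not identically zero on the
  sets at hand. Strictness in the lower bound comes from a similar count: sufficiently many padded
  monomials in \<open>c + 1\<close> dual coordinates become dependent when pulled back to
  \<open>c\<close> parameters. The dimension is three less than the number of coefficients, because
  of three scalings: of \<open>v\<close>, of \<open>q\<close> against \<open>h\<close>, and of the
  whole form. Each chart sets three coefficients to 1. The delicate point of injectivity is the
  motion of \<open>v\<close>, which moves the hyperplane and the vertex of the cone together. For
  \<open>m = 2\<close> both motions contribute to the monomial \<open>x2 x1^(d-1)\<close>, and only
  the alternation of \<open>\<omega>\<close> shows that they cannot cancel.\<close>

lemma fscale_apply: "fscale c f x = c * f x"
  by (simp add: fscale_def)

lemma sum_fun_apply: "(\<Sum>i\<in>I. f i) x = (\<Sum>i\<in>I. f i x :: complex)"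
  by (induction I rule: infinite_finite_induct) auto

lemma span_times:
  assumes "F \<in> fsc.span S" "G \<in> fsc.span T"
    and ab: "\<And>a b. a \<in> S \<Longrightarrow> b \<in> T \<Longrightarrow> a * b \<in> fsc.span U"
  shows "F * G \<in> fsc.span U"
proof -
  have one: "a * G \<in> fsc.span U" if "a \<in> S" for a
    using assms(2)
  proof (induction rule: fsc.span_induct_alt)
    case base
    then show ?case using fsc.span_zero by (simp add: times_fun_def zero_fun_def)
  next
    case (step c b f)
    have e: "a * (fscale c b + f) = fscale c (a * b) + a * f"
      by (auto simp: algebra_simps fscale_apply)
    show ?case
      unfolding e by (rule fsc.span_add[OF fsc.span_scale[OF ab[OF that step(1)]] step(2)])
  qed
  show ?thesis
    using assms(1)
  proof (induction rule: fsc.span_induct_alt)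
    case base
    then show ?case using fsc.span_zero by (simp add: times_fun_def zero_fun_def)
  next
    case (step c a f)
    have e: "(fscale c a + f) * G = fscale c (a * G) + f * G"
      by (auto simp: algebra_simps fscale_apply)
    show ?case
      unfolding e by (rule fsc.span_add[OF fsc.span_scale[OF one[OF step(1)]] step(2)])
  qed
qed

text \<open>Multisets are exponent vectors: their sum gives the product of monomials and
  \<open>size\<close> is the degree. The variables may be any functions, so one notation serves
  coordinates, the forms \<open>y\<close> and the points of a parameter space.\<close>

definition mmon :: "('i \<Rightarrow> 'a \<Rightarrow> complex) \<Rightarrow> 'i multiset \<Rightarrow> 'a \<Rightarrow> complex" where
  "mmon f M = (\<lambda>x. \<Prod>i\<in>#M. f i x)"

lemma mmon_simps [simp]:
  "mmon f {#} = 1" "mmon f (add_mset i M) = f i * mmon f M" "mmon f (M + N) = mmon f M * mmon f N"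
  by (auto simp: mmon_def)

lemma mmon_replicate: "mmon f (replicate_mset k i) x = f i x ^ k"
  by (induction k) auto

lemma mmon_cong: "(\<And>i. i \<in># M \<Longrightarrow> f i x = g i y) \<Longrightarrow> mmon f M x = mmon g M y"
  by (induction M) auto

text \<open>A nonzero polynomial over an infinite field is a nonzero function. Induction on the set
  of variables: with the others fixed, the sum is a polynomial in the single value
  \<open>t i\<close> that vanishes everywhere, so its coefficients, which involve fewer variables,
  vanish.\<close>

lemma mmon_coeff_zero:
  fixes c :: "'i multiset \<Rightarrow> complex"
  assumes "finite A" and "\<And>t. (\<Sum>M\<in>A. c M * mmon (\<lambda>i t. t i) M t) = 0" and "M \<in> A"
  shows "c M = 0"
proof -
  have "\<forall>A c. finite A \<longrightarrow> (\<forall>M\<in>A. set_mset M \<subseteq> I) \<longrightarrow>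
      (\<forall>t. (\<Sum>M\<in>A. c M * mmon (\<lambda>i t. t i) M t) = 0) \<longrightarrow> (\<forall>M\<in>A. c M = (0::complex))"
    if "finite I" for I :: "'i set"
    using that
  proof (induction I)
    case empty
    show ?case
    proof (intro allI impI ballI)
      fix A and c :: "'i multiset \<Rightarrow> complex" and M
      assume A: "finite A" "\<forall>M\<in>A. set_mset M \<subseteq> {}"
        "\<forall>t. (\<Sum>M\<in>A. c M * mmon (\<lambda>i t. t i) M t) = 0" "M \<in> A"
      then have "A = {{#}}" by auto
      then show "c M = 0" using A by auto
    qed
  next
    case (insert i I)
    show ?case
    proof (intro allI impI ballI)
      fix A and c :: "'i multiset \<Rightarrow> complex" and M
      assume A: "finite A" "\<forall>M\<in>A. set_mset M \<subseteq> insert i I"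
        "\<forall>t. (\<Sum>M\<in>A. c M * mmon (\<lambda>i t. t i) M t) = 0" "M \<in> A"
      define fl where "fl M = filter_mset (\<lambda>j. j \<noteq> i) M" for M :: "'i multiset"
      have fl: "M = fl M + replicate_mset (count M i) i" for M
        by (auto simp: fl_def multiset_eq_iff)
      let ?x = "\<lambda>i t. t i :: complex"
      define k where "k = count M i"
      let ?A = "{N \<in> A. count N i = k}"
      have key: "(\<Sum>N\<in>?A. c N * mmon ?x (fl N) t) = 0" for t
      proof -
        define p where "p = (\<Sum>N\<in>A. Polynomial.monom (c N * mmon ?x (fl N) t) (count N i))"
        have "poly p z = 0" for z
        proof -
          have e: "c N * mmon ?x (fl N) t * z ^ count N i = c N * mmon ?x N (t(i := z))" for N
          proof -
            have "mmon ?x (fl N) t = mmon ?x (fl N) (t(i := z))"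
              by (intro mmon_cong) (auto simp: fl_def)
            then show ?thesis
              by (subst (4) fl) (simp add: mmon_replicate)
          qed
          have "poly p z = (\<Sum>N\<in>A. c N * mmon ?x N (t(i := z)))"
            unfolding p_def poly_sum poly_monom e ..
          then show ?thesis using A(3) by simp
        qed
        then have "p = 0" using poly_all_0_iff_0[of p] by blast
        then have "coeff p k = 0" by simp
        then show ?thesis
          using A(1) by (simp add: p_def coeff_sum sum.inter_filter)
      qed
      have inj: "inj_on fl ?A"
      proof (rule inj_onI)
        fix M N assume "M \<in> ?A" "N \<in> ?A" "fl M = fl N"
        then show "M = N" using fl[of M] fl[of N] by simp
      qed
      let ?c = "\<lambda>N. c (N + replicate_mset k i)"
      have cf: "?c (fl N) = c N" if "N \<in> ?A" for N
        using fl[of N] that by simp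
      have "(\<Sum>N\<in>fl ` ?A. ?c N * mmon ?x N t) = 0" for t
        using key[of t] inj cf by (simp add: sum.reindex)
      moreover have "\<forall>N\<in>fl ` ?A. set_mset N \<subseteq> I" using A(2) by (auto simp: fl_def)
      moreover have "finite (fl ` ?A)" using A(1) by simp
      ultimately have "\<forall>N\<in>fl ` ?A. ?c N = 0"
        using insert.IH[rule_format, of "fl ` ?A" ?c] by blast
      then show "c M = 0" using cf[of M] A(4) by (auto simp: k_def)
    qed
  qed
  moreover have "finite (\<Union>(set_mset ` A))" "\<forall>M\<in>A. set_mset M \<subseteq> \<Union>(set_mset ` A)"
    using assms(1) by auto
  ultimately show ?thesis
    using assms by meson
qed

text \<open>Dimension count for indexed families, where members may repeat: a repeated member
  already gives the relation with coefficients 1 and -1.\<close>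

lemma family_dependent:
  fixes g :: "'b \<Rightarrow> 'a \<Rightarrow> complex"
  assumes "finite I" "finite T" "\<And>b. b \<in> I \<Longrightarrow> g b \<in> fsc.span T" "card T < card I"
  shows "\<exists>c. (\<exists>b\<in>I. c b \<noteq> 0) \<and> (\<forall>x. (\<Sum>b\<in>I. c b * g b x) = 0)"
proof (cases "inj_on g I")
  case True
  have "\<not> fsc.independent (g ` I)"
  proof
    assume "fsc.independent (g ` I)"
    then have "card (g ` I) \<le> card T"
      using fsc.independent_span_bound[OF assms(2)] assms(3) by blast
    then show False using assms(4) by (simp add: card_image True)
  qed
  then obtain u w where u: "w \<in> g ` I" "u w \<noteq> 0" "(\<Sum>v\<in>g ` I. fscale (u v) v) = 0"
    using assms(1) by (auto simp: fsc.dependent_finite)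
  have "(\<Sum>b\<in>I. u (g b) * g b x) = 0" for x
    using fun_cong[OF u(3), of x] True by (simp add: sum.reindex sum_fun_apply fscale_apply)
  then show ?thesis using u(1,2) by (intro exI[of _ "\<lambda>b. u (g b)"]) auto
next
  case False
  then obtain a b where ab: "a \<in> I" "b \<in> I" "a \<noteq> b" "g a = g b" by (auto simp: inj_on_def)
  let ?c = "\<lambda>i. if i = a then 1 else if i = b then -1 else (0::complex)"
  have "(\<Sum>i\<in>I. ?c i * g i x) = 0" for x
  proof -
    have "(\<Sum>i\<in>I. ?c i * g i x) = (\<Sum>i\<in>{a,b}. ?c i * g i x)"
      using ab assms(1) by (intro sum.mono_neutral_right) auto
    then show ?thesis using ab by simp
  qed
  then show ?thesis using ab by (intro exI[of _ ?c]) auto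
qed

section \<open>Counting monomials, and polynomial functions of bounded degree\<close>

definition bounded_multisets :: "'i set \<Rightarrow> nat \<Rightarrow> 'i multiset set" where
  "bounded_multisets J K = {M. set_mset M \<subseteq> J \<and> (\<forall>j. count M j \<le> K)}"

text \<open>A multiset with exponents at most \<open>K\<close> is a function from \<open>J\<close>
  to \<open>{..K}\<close>. Bounding each exponent, and not the degree, makes the number of monomials
  an exact power.\<close>

lemma
  assumes "finite J"
  shows finite_bounded_multisets: "finite (bounded_multisets J K)"
    and card_bounded_multisets: "card (bounded_multisets J K) = (K + 1) ^ card J"
proof -
  have "bij_betw (\<lambda>M. restrict (count M) J) (bounded_multisets J K) (PiE J (\<lambda>_. {..K}))"
  proof (rule bij_betw_byWitness)
    let ?g = "\<lambda>f. Abs_multiset (\<lambda>j. if j \<in> J then f j else 0)"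
    have cnt: "count (?g f) = (\<lambda>j. if j \<in> J then f j else 0)" for f :: "_ \<Rightarrow> nat"
      by (intro count_Abs_multiset finite_subset[OF _ assms]) auto
    show "\<forall>M\<in>bounded_multisets J K. ?g (restrict (count M) J) = M"
      by (auto simp: multiset_eq_iff cnt bounded_multisets_def count_eq_zero_iff)
    show "\<forall>f\<in>PiE J (\<lambda>_. {..K}). restrict (count (?g f)) J = f"
      by (fastforce simp: cnt fun_eq_iff PiE_def extensional_def)
    show "(\<lambda>M. restrict (count M) J) ` bounded_multisets J K \<subseteq> PiE J (\<lambda>_. {..K})"
      by (auto simp: bounded_multisets_def)
    have "set_mset (?g f) \<subseteq> J" for f
      by (auto simp: set_mset_def cnt split: if_splits)
    then show "?g ` PiE J (\<lambda>_. {..K}) \<subseteq> bounded_multisets J K"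
      by (auto simp: bounded_multisets_def cnt PiE_def Pi_def)
  qed
  moreover have "finite (PiE J (\<lambda>_. {..K}))" using assms by (simp add: finite_PiE)
  moreover have "card (PiE J (\<lambda>_. {..K})) = (K + 1) ^ card J" using assms by (simp add: card_PiE)
  ultimately show "finite (bounded_multisets J K)" "card (bounded_multisets J K) = (K + 1) ^ card J"
    using bij_betw_finite bij_betw_same_card by metis+
qed

lemma size_bounded_multisets: "finite J \<Longrightarrow> M \<in> bounded_multisets J K \<Longrightarrow> size M \<le> card J * K"
  unfolding bounded_multisets_def size_multiset_overloaded_eq
  by (clarsimp) (meson card_mono le_trans mult_le_mono1 sum_bounded_above[of "set_mset M" "count M" K, simplified])

definition polys :: "'j set \<Rightarrow> nat \<Rightarrow> (('j \<Rightarrow> complex) \<Rightarrow> complex) set" where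
  "polys J N = fsc.span {mmon (\<lambda>j t. t j) M |M. set_mset M \<subseteq> J \<and> size M \<le> N}"

text \<open>Each exponent of a monomial of degree at most \<open>N\<close> is at most
  \<open>N\<close>. The bound is crude, but only its exponent \<open>card J\<close> matters.\<close>

lemma polys_finite_span:
  assumes "finite J"
  shows "\<exists>T. finite T \<and> card T \<le> (N + 1) ^ card J \<and> polys J N \<subseteq> fsc.span T"
proof (intro exI conjI)
  let ?T = "mmon (\<lambda>j t. t j) ` bounded_multisets J N :: (('a \<Rightarrow> complex) \<Rightarrow> complex) set"
  show "finite ?T" using finite_bounded_multisets[OF assms] by simp
  show "card ?T \<le> (N + 1) ^ card J"
    using card_bounded_multisets[OF assms, of N] card_image_le[OF finite_bounded_multisets[OF assms]] by metis
  have "count M j \<le> size M" for M :: "'a multiset" and j by (rule count_le_size)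
  then show "polys J N \<subseteq> fsc.span ?T"
    unfolding polys_def by (intro fsc.span_mono) (auto simp: bounded_multisets_def intro: le_trans)
qed

lemma polys_mono: "N \<le> N' \<Longrightarrow> polys J N \<subseteq> polys J N'"
  unfolding polys_def by (intro fsc.span_mono) auto

lemma polys_const: "(\<lambda>t. c) \<in> polys J N"
proof -
  have "mmon (\<lambda>j t. t j) {#} \<in> polys J N" unfolding polys_def by (rule fsc.span_base) fastforce
  then have "fscale c (mmon (\<lambda>j t. t j) {#}) \<in> polys J N" unfolding polys_def by (rule fsc.span_scale)
  then show ?thesis by (simp add: fscale_def)
qed

lemma polys_var: "j \<in> J \<Longrightarrow> 1 \<le> N \<Longrightarrow> (\<lambda>t. t j) \<in> polys J N"
  unfolding polys_def by (rule fsc.span_base) (auto intro!: exI[of _ "{#j#}"] simp: mmon_def)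

lemma polys_add: "p \<in> polys J N \<Longrightarrow> q \<in> polys J N \<Longrightarrow> p + q \<in> polys J N"
  unfolding polys_def by (rule fsc.span_add)

lemma polys_scale: "p \<in> polys J N \<Longrightarrow> fscale c p \<in> polys J N"
  unfolding polys_def by (rule fsc.span_scale)

lemma polys_mult: "p \<in> polys J N \<Longrightarrow> q \<in> polys J M \<Longrightarrow> p * q \<in> polys J (N + M)"
  unfolding polys_def
proof (erule span_times, assumption)
  fix a b :: "('a \<Rightarrow> complex) \<Rightarrow> complex"
  assume "a \<in> {mmon (\<lambda>j t. t j) M |M. set_mset M \<subseteq> J \<and> size M \<le> N}"
    "b \<in> {mmon (\<lambda>j t. t j) Ma |Ma. set_mset Ma \<subseteq> J \<and> size Ma \<le> M}"
  then obtain A B where "a = mmon (\<lambda>j t. t j) A" "set_mset A \<subseteq> J" "size A \<le> N"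
    "b = mmon (\<lambda>j t. t j) B" "set_mset B \<subseteq> J" "size B \<le> M" by blast
  then show "a * b \<in> fsc.span {mmon (\<lambda>j t. t j) Ma |Ma. set_mset Ma \<subseteq> J \<and> size Ma \<le> N + M}"
    by (intro fsc.span_base) (auto intro!: exI[of _ "A + B"])
qed

lemma polys_prod: "(\<And>i. i < k \<Longrightarrow> p i \<in> polys J N) \<Longrightarrow> (\<lambda>t. \<Prod>i<k. p i t) \<in> polys J (k * N)"
proof (induction k)
  case 0
  then show ?case using polys_const by simp
next
  case (Suc k)
  have "(\<lambda>t. \<Prod>i<k. p i t) * p k \<in> polys J (k * N + N)" using Suc by (intro polys_mult) auto
  then show ?case by (simp add: times_fun_def add.commute)
qed

text \<open>Reduces many variables to one, where roots are finite in number and derivatives are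
  explicit.\<close>

lemma polys_line:
  assumes "p \<in> polys J N"
  shows "\<exists>P. \<forall>e. p (\<lambda>j. t j + e * u j) = poly P e"
  using assms unfolding polys_def
proof (induction rule: fsc.span_induct_alt)
  case base
  then show ?case by (intro exI[of _ 0]) simp
next
  case (step c a f)
  have "\<exists>P. \<forall>e. mmon (\<lambda>j t. t j) M (\<lambda>j. t j + e * u j) = poly P e" for M
  proof (induction M)
    case empty
    show ?case by (intro exI[of _ 1]) simp
  next
    case (add x M)
    then obtain P where "\<forall>e. mmon (\<lambda>j t. t j) M (\<lambda>j. t j + e * u j) = poly P e" ..
    then show ?case by (intro exI[of _ "[:t x, u x:] * P"]) (simp add: algebra_simps)
  qed
  then obtain Q where "\<forall>e. a (\<lambda>j. t j + e * u j) = poly Q e" using step(1) by blast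
  moreover obtain P where "\<forall>e. f (\<lambda>j. t j + e * u j) = poly P e" using step by blast
  ultimately show ?case by (intro exI[of _ "smult c Q + P"]) (simp add: fscale_apply)
qed

text \<open>Polynomial maps of degree at most \<open>N\<close> from the parameters to
  \<open>W\<close>, as finite sums of vectors with polynomial coefficients. They are stored
  uncurried, as scalar functions, so that spans under \<open>fscale\<close> apply to them as
  well.\<close>

definition pmaps ::
  "'j set \<Rightarrow> nat \<Rightarrow> ('a \<Rightarrow> complex) set \<Rightarrow> (('j \<Rightarrow> complex) \<times> 'a \<Rightarrow> complex) set" where
  "pmaps J N W = fsc.span {(\<lambda>(t, x). p t * w x) |p w. p \<in> polys J N \<and> w \<in> W}"

lemma pmaps_base: "p \<in> polys J N \<Longrightarrow> w \<in> W \<Longrightarrow> (\<lambda>(t, x). p t * w x) \<in> pmaps J N W"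
  unfolding pmaps_def by (rule fsc.span_base) blast

lemma pmaps_mono: "N \<le> N' \<Longrightarrow> pmaps J N W \<subseteq> pmaps J N' W"
  unfolding pmaps_def using polys_mono by (intro fsc.span_mono) blast

lemma pmaps_add: "p \<in> pmaps J N W \<Longrightarrow> q \<in> pmaps J N W \<Longrightarrow> p + q \<in> pmaps J N W"
  unfolding pmaps_def by (rule fsc.span_add)

lemma pmaps_sum: "(\<And>i. i \<in> I \<Longrightarrow> p i \<in> pmaps J N W) \<Longrightarrow> (\<Sum>i\<in>I. p i) \<in> pmaps J N W"
  unfolding pmaps_def by (rule fsc.span_sum)

lemma pmaps_mult:
  assumes "P \<in> pmaps J N W" "Q \<in> pmaps J M X" and WX: "\<And>w x. w \<in> W \<Longrightarrow> x \<in> X \<Longrightarrow> w * x \<in> Y"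
  shows "P * Q \<in> pmaps J (N + M) Y"
proof -
  have "a * b \<in> pmaps J (N + M) Y"
    if "a \<in> {(\<lambda>(t, x). p t * w x) |p w. p \<in> polys J N \<and> w \<in> W}"
      "b \<in> {(\<lambda>(t, x). p t * w x) |p w. p \<in> polys J M \<and> w \<in> X}" for a b
  proof -
    from that obtain p w q x where *: "a = (\<lambda>(t, x). p t * w x)" "p \<in> polys J N" "w \<in> W"
      "b = (\<lambda>(t, y). q t * x y)" "q \<in> polys J M" "x \<in> X" by blast
    then have "a * b = (\<lambda>(t, y). (p * q) t * (w * x) y)" by auto
    moreover have "(\<lambda>(t, y). (p * q) t * (w * x) y) \<in> pmaps J (N + M) Y"
      using * by (intro pmaps_base polys_mult WX)
    ultimately show ?thesis by metis
  qed
  then show ?thesis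
    using assms(1,2) unfolding pmaps_def by (rule span_times[rotated 2])
qed

lemma pmaps_fibre:
  assumes "fsc.subspace W" "P \<in> pmaps J N W"
  shows "(\<lambda>x. P (t, x)) \<in> W"
  using assms(2) unfolding pmaps_def
proof (induction rule: fsc.span_induct_alt)
  case base
  then show ?case using fsc.subspace_0[OF assms(1)] by (simp add: zero_fun_def)
next
  case (step c a f)
  then obtain p w where a: "a = (\<lambda>(t, x). p t * w x)" "w \<in> W" by blast
  have "(\<lambda>x. (fscale c a + f) (t, x)) = fscale (c * p t) w + (\<lambda>x. f (t, x))"
    by (auto simp: a fscale_apply)
  then show ?case using assms(1) a step by (auto intro!: fsc.subspace_add fsc.subspace_scale)
qed

lemma linear_forms_comb:
  assumes "fsc.subspace W" "l \<in> linear_forms fscale W" "w \<in> W" "v \<in> W"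
  shows "l (fscale c w + v) = c * l w + l v"
  using assms by (simp add: linear_forms_def fsc.subspace_scale)

lemma pmaps_linear:
  assumes W: "fsc.subspace W" and P: "P \<in> pmaps J N W" and l: "l \<in> linear_forms fscale W"
  shows "(\<lambda>t. l (\<lambda>x. P (t, x))) \<in> polys J N"
proof -
  \<comment> \<open>\<open>l\<close> is additive only on \<open>W\<close>, so the induction carries
    along that the partial sum stays in \<open>pmaps\<close> and hence takes values in
    \<open>W\<close>.\<close>
  have "P \<in> pmaps J N W \<and> (\<lambda>t. l (\<lambda>x. P (t, x))) \<in> polys J N"
    using P[unfolded pmaps_def]
  proof (induction rule: fsc.span_induct_alt)
    case base
    have "l 0 = 0" using linear_forms_comb[OF W l fsc.subspace_0[OF W] fsc.subspace_0[OF W], of 1] by simp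
    then show ?case
      using polys_const[of 0 J N] fsc.span_zero[of "{(\<lambda>(t, x). p t * w x) |p w. p \<in> polys J N \<and> w \<in> W}"]
      by (simp add: zero_fun_def pmaps_def)
  next
    case (step c a f)
    then obtain p w where a: "a = (\<lambda>(t, x). p t * w x)" "w \<in> W" "p \<in> polys J N" by blast
    have f: "f \<in> pmaps J N W" using step by blast
    have a': "fscale c a + f \<in> pmaps J N W"
      using f step(1) unfolding pmaps_def by (blast intro: fsc.span_add fsc.span_scale fsc.span_base)
    have "(\<lambda>x. (fscale c a + f) (t, x)) = fscale (c * p t) w + (\<lambda>x. f (t, x))" for t
      by (auto simp: a fscale_apply)
    then have "(\<lambda>t. l (\<lambda>x. (fscale c a + f) (t, x))) = fscale (c * l w) p + (\<lambda>t. l (\<lambda>x. f (t, x)))"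
      using linear_forms_comb[OF W l a(2) pmaps_fibre[OF W f]] by (auto simp: fscale_apply)
    moreover have "fscale (c * l w) p + (\<lambda>t. l (\<lambda>x. f (t, x))) \<in> polys J N"
      using a step by (intro polys_add polys_scale) auto
    ultimately show ?case using a' by metis
  qed
  then show ?thesis ..
qed

lemma polys_mmon:
  assumes "\<And>j. j \<in># M \<Longrightarrow> p j \<in> polys J N"
  shows "mmon p M \<in> polys J (size M * N)"
  using assms
proof (induction M)
  case empty
  then show ?case using polys_const[of 1] by (simp add: one_fun_def)
next
  case (add j M)
  have "p j * mmon p M \<in> polys J (N + size M * N)" using add by (intro polys_mult) auto
  then show ?case unfolding mmon_simps size_add_mset mult_Suc .
qed

text \<open>An affine substitution keeps the degree bound. It serves to set coordinates to constants
  and to move the base point to the origin.\<close>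

lemma polys_subst:
  assumes "p \<in> polys J N" "\<And>j. j \<in> J \<Longrightarrow> (\<lambda>t. \<sigma> t j) \<in> polys J' 1"
  shows "(\<lambda>t. p (\<sigma> t)) \<in> polys J' N"
  using assms(1) unfolding polys_def[of J N]
proof (induction rule: fsc.span_induct_alt)
  case base
  then show ?case using polys_const[of 0] by simp
next
  case (step c a f)
  then obtain M where M: "a = mmon (\<lambda>j t. t j) M" "set_mset M \<subseteq> J" "size M \<le> N" by blast
  have "mmon (\<lambda>j t. \<sigma> t j) M \<in> polys J' (size M * 1)"
    using M assms(2) by (intro polys_mmon) auto
  then have "mmon (\<lambda>j t. \<sigma> t j) M \<in> polys J' N"
    using M(3) polys_mono[of "size M" N J'] by auto
  then have "fscale c (mmon (\<lambda>j t. \<sigma> t j) M) + (\<lambda>t. f (\<sigma> t)) \<in> polys J' N"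
    using step by (intro polys_add polys_scale)
  moreover have "(\<lambda>t. (fscale c a + f) (\<sigma> t)) =
      fscale c (mmon (\<lambda>j t. \<sigma> t j) M) + (\<lambda>t. f (\<sigma> t))"
    by (auto simp: M(1) fscale_apply mmon_def)
  ultimately show ?case by (rule back_subst[where P = "\<lambda>f. f \<in> polys J' N", OF _ sym])
qed

lemma pmaps_subst:
  assumes "P \<in> pmaps J N W" "\<And>j. j \<in> J \<Longrightarrow> (\<lambda>t. \<sigma> t j) \<in> polys J' 1"
  shows "(\<lambda>(t, x). P (\<sigma> t, x)) \<in> pmaps J' N W"
  using assms(1) unfolding pmaps_def[of J N]
proof (induction rule: fsc.span_induct_alt)
  case base
  have "0 \<in> pmaps J' N W" unfolding pmaps_def by (rule fsc.span_zero)
  then show ?case by (simp add: zero_fun_def case_prod_beta)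
next
  case (step c a f)
  then obtain p w where a: "a = (\<lambda>(t, x). p t * w x)" "p \<in> polys J N" "w \<in> W" by blast
  have "(\<lambda>(t, x). fscale c (\<lambda>t. p (\<sigma> t)) t * w x) + (\<lambda>(t, x). f (\<sigma> t, x)) \<in> pmaps J' N W"
    using step a polys_subst[OF a(2) assms(2)] by (intro pmaps_add pmaps_base polys_scale)
  moreover have "(\<lambda>(t, x). (fscale c a + f) (\<sigma> t, x)) =
      (\<lambda>(t, x). fscale c (\<lambda>t. p (\<sigma> t)) t * w x) + (\<lambda>(t, x). f (\<sigma> t, x))"
    by (auto simp: a(1) fscale_apply)
  ultimately show ?case by (rule back_subst[where P = "\<lambda>f. f \<in> pmaps J' N W", OF _ sym])
qed

text \<open>Each of the \<open>k\<close> linear factors pulls back to degree at most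
  \<open>N\<close>. The linear growth of this bound in \<open>k\<close> drives both dimension
  counts.\<close>

lemma forms_comp:
  assumes W: "fsc.subspace W" and P: "P \<in> pmaps J N W" and F: "F \<in> forms fscale W k"
  shows "(\<lambda>t. F (\<lambda>x. P (t, x))) \<in> polys J (k * N)"
  using F unfolding forms_def sym_power_def
proof (induction rule: fsc.span_induct_alt)
  case base
  then show ?case using polys_const[of 0] by simp
next
  case (step c a f)
  then obtain l where l: "a = restr W (\<lambda>x. \<Prod>i<k. l i x)" "\<forall>i<k. l i \<in> linear_forms fscale W"
    by blast
  have "(\<lambda>t. \<Prod>i<k. l i (\<lambda>x. P (t, x))) \<in> polys J (k * N)"
    using l(2) by (intro polys_prod pmaps_linear[OF W P]) auto
  then have "fscale c (\<lambda>t. \<Prod>i<k. l i (\<lambda>x. P (t, x))) + (\<lambda>t. f (\<lambda>x. P (t, x))) \<in> polys J (k * N)"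
    using step by (intro polys_add polys_scale)
  moreover have "(\<lambda>t. (fscale c a + f) (\<lambda>x. P (t, x))) =
      fscale c (\<lambda>t. \<Prod>i<k. l i (\<lambda>x. P (t, x))) + (\<lambda>t. f (\<lambda>x. P (t, x)))"
    using pmaps_fibre[OF W P] by (auto simp: l(1) fscale_apply restr_def)
  ultimately show ?case by (rule back_subst[where P = "\<lambda>f. f \<in> polys J (k * N)", OF _ sym])
qed

lemma linear_forms_0: "fsc.subspace W \<Longrightarrow> l \<in> linear_forms fscale W \<Longrightarrow> l 0 = 0"
  using linear_forms_comb[of W l 0 0 0] fsc.subspace_0[of W]
  by (simp add: linear_forms_def) (metis fsc.scale_zero_left mult_zero_left)

text \<open>A polynomial map is a finite sum of fixed vectors of \<open>W\<close> with polynomial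
  coefficients. Its derivative is therefore again in \<open>W\<close> and commutes with every linear
  form, for purely algebraic reasons.\<close>

lemma pmaps_deriv:
  assumes W: "fsc.subspace W" and P: "P \<in> pmaps J N W"
  shows "\<exists>T\<in>W. (\<forall>x. ((\<lambda>e. P (\<lambda>j. t j + e * u j, x)) has_field_derivative T x) (at 0)) \<and>
    (\<forall>l\<in>linear_forms fscale W.
      ((\<lambda>e. l (\<lambda>x. P (\<lambda>j. t j + e * u j, x))) has_field_derivative l T) (at 0))"
proof -
  let ?L = "\<lambda>e j. t j + e * u j"
  let ?Q = "\<lambda>P. \<exists>T\<in>W. (\<forall>x. ((\<lambda>e. P (?L e, x)) has_field_derivative T x) (at 0)) \<and>
    (\<forall>l\<in>linear_forms fscale W. ((\<lambda>e. l (\<lambda>x. P (?L e, x))) has_field_derivative l T) (at 0))"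
  have "P \<in> pmaps J N W \<and> ?Q P"
    using P[unfolded pmaps_def]
  proof (induction rule: fsc.span_induct_alt)
    case base
    have "l (\<lambda>x. 0) = 0" if "l \<in> linear_forms fscale W" for l
      using linear_forms_0[OF W that] unfolding zero_fun_def .
    then have "((\<lambda>e. l (\<lambda>x. 0)) has_field_derivative l (\<lambda>x. 0)) (at 0)"
      if "l \<in> linear_forms fscale W" for l
      using that by (metis DERIV_const)
    moreover have "(\<lambda>x. 0) \<in> W" using fsc.subspace_0[OF W] by (simp add: zero_fun_def)
    ultimately have "?Q 0"
      by (intro bexI[of _ "\<lambda>x. 0"]) (auto simp: zero_fun_def)
    moreover have "0 \<in> pmaps J N W" unfolding pmaps_def by (rule fsc.span_zero)
    ultimately show ?case by blast
  next
    case (step c a f)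
    then obtain p w where a: "a = (\<lambda>(t, x). p t * w x)" "p \<in> polys J N" "w \<in> W" by blast
    obtain T where T: "T \<in> W" "\<And>x. ((\<lambda>e. f (?L e, x)) has_field_derivative T x) (at 0)"
      "\<And>l. l \<in> linear_forms fscale W \<Longrightarrow>
        ((\<lambda>e. l (\<lambda>x. f (?L e, x))) has_field_derivative l T) (at 0)"
      using step by blast
    have f: "f \<in> pmaps J N W" using step by blast
    obtain R where R: "\<And>e. p (?L e) = poly R e" using polys_line[OF a(2), of t u] by blast
    let ?d = "poly (pderiv R) 0"
    have "fscale c a + f \<in> pmaps J N W"
      using f step(1) unfolding pmaps_def by (blast intro: fsc.span_add fsc.span_scale fsc.span_base)
    moreover have "fscale (c * ?d) w + T \<in> W"
      using W a(3) T(1) by (intro fsc.subspace_add fsc.subspace_scale)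
    moreover have "((\<lambda>e. (fscale c a + f) (?L e, x)) has_field_derivative (fscale (c * ?d) w + T) x) (at 0)"
      for x
    proof -
      have "((\<lambda>e. c * (poly R e * w x) + f (?L e, x)) has_field_derivative
        c * (?d * w x) + T x) (at 0)"
        by (intro DERIV_add DERIV_cmult DERIV_cmult_right poly_DERIV T)
      then show ?thesis by (simp add: a(1) fscale_apply R algebra_simps)
    qed
    moreover have "((\<lambda>e. l (\<lambda>x. (fscale c a + f) (?L e, x))) has_field_derivative
        l (fscale (c * ?d) w + T)) (at 0)" if l: "l \<in> linear_forms fscale W" for l
    proof -
      have "((\<lambda>e. c * poly R e * l w + l (\<lambda>x. f (?L e, x))) has_field_derivative
        c * ?d * l w + l T) (at 0)"
        by (intro DERIV_add DERIV_cmult DERIV_cmult_right poly_DERIV T l)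
      moreover have "l (\<lambda>x. (fscale c a + f) (?L e, x)) = c * poly R e * l w + l (\<lambda>x. f (?L e, x))" for e
      proof -
        have "(\<lambda>x. (fscale c a + f) (?L e, x)) = fscale (c * poly R e) w + (\<lambda>x. f (?L e, x))"
          by (auto simp: a(1) fscale_apply R)
        then show ?thesis
          using linear_forms_comb[OF W l a(3) pmaps_fibre[OF W f]] by simp
      qed
      moreover have "l (fscale (c * ?d) w + T) = c * ?d * l w + l T"
        using linear_forms_comb[OF W l a(3) T(1)] by simp
      ultimately show ?thesis by simp
    qed
    ultimately show ?case by blast
  qed
  then show ?thesis ..
qed

section \<open>Homogeneous forms: products, powers and monomials\<close>

lemma subspace_sym_power: "fsc.subspace (sym_power W k L)"
  unfolding sym_power_def by (rule fsc.subspace_span)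

lemma subspace_forms: "fsc.subspace (forms s W k)"
  unfolding forms_def by (rule subspace_sym_power)

lemma forms_mult:
  "F \<in> forms s W j \<Longrightarrow> G \<in> forms s W k \<Longrightarrow> (\<lambda>x. F x * G x) \<in> forms s W (j + k)"
  unfolding forms_def by (rule sym_power_mult)

lemma forms_power_mult:
  "F \<in> forms s W j \<Longrightarrow> G \<in> forms s W k \<Longrightarrow> (\<lambda>x. F x ^ n * G x) \<in> forms s W (n * j + k)"
proof (induction n)
  case (Suc n)
  have "(\<lambda>x. F x * (F x ^ n * G x)) \<in> forms s W (j + (n * j + k))"
    using Suc by (rule_tac forms_mult) auto
  then show ?case by (simp add: mult.assoc add.assoc)
qed simp

lemma forms_sum:
  assumes "\<And>i. i \<in> I \<Longrightarrow> f i \<in> forms s W k"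
  shows "(\<lambda>x. \<Sum>i\<in>I. c i * f i x) \<in> forms s W k"
proof -
  have "(\<Sum>i\<in>I. fscale (c i) (f i)) \<in> forms s W k"
    using assms subspace_forms by (intro fsc.subspace_sum fsc.subspace_scale)
  moreover have "(\<Sum>i\<in>I. fscale (c i) (f i)) = (\<lambda>x. \<Sum>i\<in>I. c i * f i x)"
    by (auto simp: sum_fun_apply fscale_apply)
  ultimately show ?thesis by simp
qed

lemma forms_one: "restr W (\<lambda>_. 1) \<in> forms s W 0"
  unfolding forms_def sym_power_def by (rule fsc.span_base) auto

lemma restr_UNIV [simp]: "restr UNIV f = f"
  by (auto simp: restr_def)

lemma sym_power_1: "l \<in> L \<Longrightarrow> restr W l \<in> sym_power W 1 L"
  unfolding sym_power_def by (rule fsc.span_base) (auto intro!: exI[of _ "\<lambda>_. l"])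

lemma sym_power_mmon:
  assumes "\<And>j. j \<in># M \<Longrightarrow> restr W (l j) \<in> L"
  shows "restr W (mmon l M) \<in> sym_power W (size M) L"
  using assms
proof (induction M)
  case empty
  have "restr W (\<lambda>_. 1) \<in> sym_power W 0 L"
    unfolding sym_power_def by (rule fsc.span_base) auto
  then show ?case by (simp add: one_fun_def)
next
  case (add j M)
  then have "(\<lambda>x. restr W (restr W (l j)) x * restr W (mmon l M) x) \<in> sym_power W (1 + size M) L"
    by (intro sym_power_mult sym_power_1) auto
  moreover have "(\<lambda>x. restr W (restr W (l j)) x * restr W (mmon l M) x) = restr W (mmon l (add_mset j M))"
    by (auto simp: restr_def)
  ultimately show ?case by (simp only: size_add_mset plus_1_eq_Suc)
qed

lemma linear_forms_restr: "l \<in> linear_forms s W \<Longrightarrow> restr W l = l"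
  by (auto simp: restr_def linear_forms_def)

lemma forms_linear: "l \<in> linear_forms s W \<Longrightarrow> l \<in> forms s W 1"
  using sym_power_1[of l "linear_forms s W" W] by (simp add: forms_def linear_forms_restr)

lemma forms_mmon:
  assumes "\<And>j. j \<in># M \<Longrightarrow> l j \<in> linear_forms s W"
  shows "restr W (mmon l M) \<in> forms s W (size M)"
  unfolding forms_def
proof (rule sym_power_mmon)
  fix j assume "j \<in># M"
  then show "restr W (l j) \<in> linear_forms s W"
    using assms[of j] linear_forms_restr[of "l j" s W] by simp
qed

section \<open>Chains of irreducible closed sets\<close>

text \<open>\<open>B\<close> is an arbitrary set of points, as the image of the incidence is at hand
  only as a set; its topology is induced from the ambient projective space.\<close>

locale projective_subset = vector_space s for s :: "complex \<Rightarrow> 'a::ab_group_add \<Rightarrow> 'a" +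
  fixes W :: "'a set" and B :: "'a set set"
  assumes subspace_W: "subspace W" and B_proj: "B \<subseteq> proj s W"
begin

abbreviation "T \<equiv> subtopology (zariski s W) B"

lemma closedin_T:
  "closedin T C \<longleftrightarrow> (\<exists>S. S \<subseteq> (\<Union>k. forms s W k) \<and> C = zero_locus s W S \<inter> B)"
  unfolding closedin_subtopology closedin_zariski(1)[OF vector_space_axioms subspace_W] by blast

lemma form_vanish_iff:
  assumes "F \<in> forms s W k" "z \<in> W"
  shows "(\<forall>x\<in>span {z}. F x = 0) \<longleftrightarrow> F z = 0"
proof
  assume "F z = 0"
  then show "\<forall>x\<in>span {z}. F x = 0"
    using forms_scale[OF vector_space_axioms subspace_W assms] by (auto simp: span_singleton)
qed (simp add: span_base)

lemma B_E:
  assumes "p \<in> B"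
  obtains z where "z \<in> W" "z \<noteq> 0" "p = span {z}"
  using assms B_proj by (auto simp: proj_def)

lemma closedin_form:
  assumes "closedin T Z" "F \<in> forms s W k"
  shows "closedin T {p \<in> Z. \<forall>x\<in>p. F x = 0}"
proof -
  obtain S where S: "S \<subseteq> (\<Union>k. forms s W k)" "Z = zero_locus s W S \<inter> B"
    using assms(1) closedin_T by blast
  have "{p \<in> Z. \<forall>x\<in>p. F x = 0} = zero_locus s W (insert F S) \<inter> B"
    by (auto simp: S(2) zero_locus_def)
  then show ?thesis using S(1) assms(2) unfolding closedin_T by (intro exI[of _ "insert F S"]) auto
qed

text \<open>Irreducibility makes the homogeneous ideal of \<open>Z\<close> prime: by homogeneity
  \<open>Z\<close> is the union of its closed parts where \<open>F\<close> and \<open>G\<close>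
  vanish, and \<open>x0\<close> excludes that \<open>F\<close> vanishes on all of it.\<close>

lemma irreducible_prime:
  assumes Z: "irreducible_closed T Z" and F: "F \<in> forms s W j" and G: "G \<in> forms s W k"
    and FG: "\<And>x. x \<in> \<Union>Z \<Longrightarrow> F x * G x = 0" and nF: "x0 \<in> \<Union>Z" "F x0 \<noteq> 0"
    and x: "x \<in> \<Union>Z"
  shows "G x = 0"
proof -
  let ?A = "{p \<in> Z. \<forall>x\<in>p. F x = 0}" and ?B = "{p \<in> Z. \<forall>x\<in>p. G x = 0}"
  have cl: "closedin T Z" using Z by (simp add: irreducible_closed_def)
  then have ZB: "Z \<subseteq> B" unfolding closedin_T by blast
  have "p \<in> ?A \<union> ?B" if p: "p \<in> Z" for p
  proof -
    obtain z where z: "z \<in> W" "p = span {z}" using p ZB B_E by blast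
    then have "F z * G z = 0" using FG[of z] p span_base[of z "{z}"] by auto
    then have "(\<forall>x\<in>p. F x = 0) \<or> (\<forall>x\<in>p. G x = 0)"
      unfolding z(2) form_vanish_iff[OF F z(1)] form_vanish_iff[OF G z(1)] by simp
    then show ?thesis using p by blast
  qed
  then have "Z = ?A \<union> ?B" by auto
  then have "Z = ?A \<or> Z = ?B"
    using Z closedin_form[OF cl F] closedin_form[OF cl G] unfolding irreducible_closed_def by blast
  then show ?thesis using nF x by blast
qed

lemma irreducible_prime_power:
  assumes Z: "irreducible_closed T Z" and F: "F \<in> forms s W j" and G: "G \<in> forms s W k"
    and FG: "\<And>x. x \<in> \<Union>Z \<Longrightarrow> F x ^ n * G x = 0" and nF: "x0 \<in> \<Union>Z" "F x0 \<noteq> 0"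
    and x: "x \<in> \<Union>Z"
  shows "G x = 0"
  using FG x
proof (induction n arbitrary: x)
  case (Suc n)
  have "F y ^ n * G y = 0" if "y \<in> \<Union>Z" for y
    by (rule irreducible_prime[OF Z F forms_power_mult[OF F G] _ nF that])
      (use Suc.prems(1) in \<open>simp add: mult.assoc\<close>)
  then show ?case using Suc by blast
qed simp

lemma closed_separation:
  assumes Z: "closedin T Z" and Z': "Z' \<subseteq> B" "\<not> Z' \<subseteq> Z"
  obtains k F x where "F \<in> forms s W k" "\<And>x. x \<in> \<Union>Z \<Longrightarrow> F x = 0" "x \<in> \<Union>Z'" "F x \<noteq> 0"
proof -
  obtain S where S: "S \<subseteq> (\<Union>k. forms s W k)" "Z = zero_locus s W S \<inter> B"
    using Z closedin_T by blast
  obtain p where p: "p \<in> Z'" "p \<notin> Z" using Z' by blast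
  then have "p \<in> proj s W" "p \<notin> zero_locus s W S" using S Z' B_proj by auto
  then obtain F x where "F \<in> S" "x \<in> p" "F x \<noteq> 0" by (auto simp: zero_locus_def)
  moreover obtain k where "F \<in> forms s W k" using \<open>F \<in> S\<close> S(1) by blast
  moreover have "F y = 0" if "y \<in> \<Union>Z" for y
    using that \<open>F \<in> S\<close> by (auto simp: S(2) zero_locus_def)
  ultimately show thesis using that p(1) by blast
qed

text \<open>Along a strict chain of irreducible closed sets the forms that separate consecutive members
  are algebraically independent on the last one; hence there are many independent forms of a given
  degree.\<close>

lemma chain_family:
  fixes Z :: "nat \<Rightarrow> 'a set set"
  assumes F0: "F0 \<in> forms s W 1" "x0 \<in> \<Union>(Z 0)" "x0 \<in> W" "F0 x0 \<noteq> 0"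
    and irr: "\<And>i. i \<le> r \<Longrightarrow> irreducible_closed T (Z i)"
    and strict: "\<And>i. i < r \<Longrightarrow> Z i \<subset> Z (Suc i)"
  shows "\<exists>c. \<forall>K. \<exists>fam. (\<forall>b. set b \<subseteq> {..K} \<and> length b = r \<longrightarrow> fam b \<in> forms s W (c * K)) \<and>
    (\<forall>u. (\<forall>x\<in>\<Union>(Z r). (\<Sum>b | set b \<subseteq> {..K} \<and> length b = r. u b * fam b x) = 0) \<longrightarrow>
       (\<forall>b. set b \<subseteq> {..K} \<and> length b = r \<longrightarrow> u b = 0))"
  using irr strict
proof (induction r)
  case 0
  have "{b. set b \<subseteq> {..K} \<and> length b = 0} = {[]}" for K by auto
  then have I: "{b. set b \<subseteq> {..K} \<and> length b = 0} = {[]}" for K :: nat by blast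
  have u: "u [] = 0"
    if "\<forall>x\<in>\<Union>(Z 0). (\<Sum>b\<in>{[]::nat list}. u b * restr W (\<lambda>_. 1) x) = 0" for u
    using bspec[OF that F0(2)] F0(3) by (simp add: restr_def)
  show ?case
    unfolding I
  proof (intro exI[of _ "0::nat"] allI exI[of _ "\<lambda>_. restr W (\<lambda>_. 1)"] conjI impI)
    show "restr W (\<lambda>_. 1) \<in> forms s W (0 * K)" for K using forms_one by simp
    show "u b = 0"
      if "\<forall>x\<in>\<Union>(Z 0). (\<Sum>b\<in>{[]}. u b * restr W (\<lambda>_. 1) x) = 0"
        "set b \<subseteq> {..K} \<and> length b = 0" for K u and b :: "nat list"
      using u[OF that(1)] that(2) by simp
  qed
next
  case (Suc r)
  let ?I = "\<lambda>K r. {b. set b \<subseteq> {..K::nat} \<and> length b = r}"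
  let ?Q = "\<lambda>r c K. \<exists>fam. (\<forall>b. set b \<subseteq> {..K} \<and> length b = r \<longrightarrow> fam b \<in> forms s W (c * K)) \<and>
    (\<forall>u. (\<forall>x\<in>\<Union>(Z r). (\<Sum>b | set b \<subseteq> {..K} \<and> length b = r. u b * fam b x) = 0) \<longrightarrow>
       (\<forall>b. set b \<subseteq> {..K} \<and> length b = r \<longrightarrow> u b = 0))"
  have "\<exists>c. \<forall>K. ?Q r c K" by (rule Suc.IH) (use Suc.prems in auto)
  then obtain c where IH: "?Q r c K" for K by blast
  note Suc_prems = Suc.prems
  have irrS: "irreducible_closed T (Z (Suc r))" and irrr: "irreducible_closed T (Z r)"
    using Suc.prems(1) by auto
  have cl: "closedin T (Z r)" "Z (Suc r) \<subseteq> B"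
    using irrr irrS closedin_subset[of T "Z (Suc r)"] unfolding irreducible_closed_def by auto
  have "Z r \<subset> Z (Suc r)" using Suc.prems(2) by simp
  then have "\<not> Z (Suc r) \<subseteq> Z r" by blast
  from closed_separation[OF cl this] obtain e F y where F: "F \<in> forms s W e" "\<And>x. x \<in> \<Union>(Z r) \<Longrightarrow> F x = 0"
    "y \<in> \<Union>(Z (Suc r))" "F y \<noteq> 0"
    by metis
  have "Z 0 \<subseteq> Z i" if "i \<le> r" for i
    using that
  proof (induction i)
    case (Suc i)
    then have "Z i \<subset> Z (Suc i)" using Suc_prems(2)[of i] by simp
    then show ?case using Suc by auto
  qed simp
  then have x0: "x0 \<in> \<Union>(Z r)" using F0(2) by blast
  show ?case
  proof (intro exI[of _ "c + e"] allI)
    fix K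
    from IH[of K] obtain fam where
      "\<forall>b. set b \<subseteq> {..K} \<and> length b = r \<longrightarrow> fam b \<in> forms s W (c * K)"
      "\<forall>u. (\<forall>x\<in>\<Union>(Z r). (\<Sum>b\<in>?I K r. u b * fam b x) = 0) \<longrightarrow>
         (\<forall>b. set b \<subseteq> {..K} \<and> length b = r \<longrightarrow> u b = 0)"
      by (elim exE conjE)
    then have fam: "\<And>b. b \<in> ?I K r \<Longrightarrow> fam b \<in> forms s W (c * K)"
      "\<And>u b. (\<forall>x\<in>\<Union>(Z r). (\<Sum>b\<in>?I K r. u b * fam b x) = 0) \<Longrightarrow> b \<in> ?I K r \<Longrightarrow> u b = 0"
      by simp_all
    \<comment> \<open>Powers of \<open>F\<close> supply the new index. The power of
      \<open>F0\<close> pads \<open>F^k\<close> to degree \<open>e * K\<close>, so that all members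
      have degree \<open>(c + e) * K\<close>; \<open>F0\<close> is nonzero at \<open>x0\<close>,
      hence not identically zero on any member of the chain.\<close>
    define fam' where "fam' b = (\<lambda>x. F x ^ hd b * (F0 x ^ (e * (K - hd b)) * fam (tl b) x))" for b
    have I: "?I K (Suc r) = (\<lambda>(k, b). k # b) ` ({..K} \<times> ?I K r)"
    proof (rule set_eqI)
      fix b
      show "b \<in> ?I K (Suc r) \<longleftrightarrow> b \<in> (\<lambda>(k, b). k # b) ` ({..K} \<times> ?I K r)"
        by (cases b) (auto simp: image_iff)
    qed
    have fam'_form: "fam' b \<in> forms s W ((c + e) * K)" if bI: "b \<in> ?I K (Suc r)" for b
    proof -
      obtain k b' where b: "b = k # b'" "k \<le> K" "b' \<in> ?I K r"
        using bI unfolding I by auto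
      have "fam' b \<in> forms s W (k * e + (e * (K - k) * 1 + c * K))"
        unfolding fam'_def b(1) list.sel
        using F(1) F0(1) fam(1)[OF b(3)] by (intro forms_power_mult)
      moreover have "k * e + (e * (K - k) * 1 + c * K) = (c + e) * K"
        using le_Suc_ex[OF b(2)] by (auto simp: algebra_simps)
      ultimately show ?thesis by (simp only:)
    qed
    \<comment> \<open>Induction on the exponent of \<open>F\<close>: once the terms below
      \<open>k\<close> vanish, \<open>F^k\<close> can be cancelled on \<open>Z (Suc r)\<close>.
      Restriction to \<open>Z r\<close>, where \<open>F\<close> is zero, leaves only the term
      \<open>i = k\<close>; there the power of \<open>F0\<close> is cancelled and the independence
      on \<open>Z r\<close> applies.\<close>
    have indep: "u (k # b) = 0"
      if u: "\<forall>x\<in>\<Union>(Z (Suc r)). (\<Sum>b\<in>?I K (Suc r). u b * fam' b x) = 0"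
        and k: "k \<le> K" and b: "b \<in> ?I K r" for u k b
      using k b
    proof (induction k arbitrary: b rule: less_induct)
      case (less k)
      let ?G = "\<lambda>k x. \<Sum>b\<in>?I K r. u (k # b) * fam b x"
      let ?R = "\<lambda>x. \<Sum>i\<in>{k..K}. 1 * (F x ^ (i - k) * (F0 x ^ (e * (K - i)) * ?G i x))"
      have Gf: "?G i \<in> forms s W (c * K)" for i
        using fam(1) by (intro forms_sum) auto
      have R: "?R \<in> forms s W (e * (K - k) + c * K)"
      proof (rule forms_sum)
        fix i assume i: "i \<in> {k..K}"
        have "(\<lambda>x. F x ^ (i - k) * (F0 x ^ (e * (K - i)) * ?G i x)) \<in>
            forms s W ((i - k) * e + (e * (K - i) * 1 + c * K))"
          by (intro forms_power_mult F(1) F0(1) Gf)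
        moreover have "(i - k) * e + (e * (K - i) * 1 + c * K) = e * (K - k) + c * K"
        proof -
          from i have "k \<le> i" "i \<le> K" by auto
          then obtain p q where "i = k + p" "K = i + q" by (metis le_Suc_ex)
          then show ?thesis by (simp add: algebra_simps)
        qed
        ultimately show "(\<lambda>x. F x ^ (i - k) * (F0 x ^ (e * (K - i)) * ?G i x)) \<in>
            forms s W (e * (K - k) + c * K)" by (simp only:)
      qed
      have FR: "F x ^ k * ?R x = 0" if x: "x \<in> \<Union>(Z (Suc r))" for x
      proof -
        have "0 = (\<Sum>b\<in>?I K (Suc r). u b * fam' b x)" using bspec[OF u x] by (rule sym)
        also have "\<dots> = (\<Sum>(i, b)\<in>{..K} \<times> ?I K r. u (i # b) * fam' (i # b) x)"
          unfolding I by (subst sum.reindex) (auto simp: inj_on_def case_prod_beta)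
        also have "\<dots> = (\<Sum>i\<le>K. \<Sum>b\<in>?I K r. u (i # b) * fam' (i # b) x)"
          by (simp add: sum.cartesian_product)
        also have "\<dots> = (\<Sum>i\<in>{k..K}. \<Sum>b\<in>?I K r. u (i # b) * fam' (i # b) x)"
          using less.IH by (intro sum.mono_neutral_right) (auto intro!: sum.neutral)
        also have "\<dots> = (\<Sum>i\<in>{k..K}. F x ^ k * (F x ^ (i - k) * (F0 x ^ (e * (K - i)) * ?G i x)))"
        proof (intro sum.cong refl)
          fix i assume "i \<in> {k..K}"
          then have "F x ^ i = F x ^ k * F x ^ (i - k)" by (simp flip: power_add)
          then show "(\<Sum>b\<in>?I K r. u (i # b) * fam' (i # b) x) =
              F x ^ k * (F x ^ (i - k) * (F0 x ^ (e * (K - i)) * ?G i x))"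
            by (simp add: fam'_def sum_distrib_left mult_ac)
        qed
        finally show ?thesis by (simp add: sum_distrib_left)
      qed
      have R0: "?R x = 0" if "x \<in> \<Union>(Z (Suc r))" for x
        by (rule irreducible_prime_power[OF irrS F(1) R FR F(3,4) that])
      have FG: "F0 x ^ (e * (K - k)) * ?G k x = 0" if x: "x \<in> \<Union>(Z r)" for x
      proof -
        have "0 = ?R x" by (rule R0[symmetric]) (use x \<open>Z r \<subset> Z (Suc r)\<close> in blast)
        also have "?R x = (\<Sum>i\<in>{k}. 1 * (F x ^ (i - k) * (F0 x ^ (e * (K - i)) * ?G i x)))"
          using F(2)[OF x] less.prems(1) by (intro sum.mono_neutral_right) auto
        finally show ?thesis by simp
      qed
      have "?G k x = 0" if "x \<in> \<Union>(Z r)" for x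
        by (rule irreducible_prime_power[OF irrr F0(1) Gf FG x0 F0(4) that])
      then have "\<forall>x\<in>\<Union>(Z r). ?G k x = 0" ..
      from fam(2)[OF this less.prems(2)] show "u (k # b) = 0" .
    qed
    show "\<exists>fam. (\<forall>b. set b \<subseteq> {..K} \<and> length b = Suc r \<longrightarrow> fam b \<in> forms s W ((c + e) * K)) \<and>
      (\<forall>u. (\<forall>x\<in>\<Union>(Z (Suc r)). (\<Sum>b\<in>?I K (Suc r). u b * fam b x) = 0) \<longrightarrow>
         (\<forall>b. set b \<subseteq> {..K} \<and> length b = Suc r \<longrightarrow> u b = 0))"
    proof (intro exI[of _ fam'] conjI allI impI)
      fix u b
      assume u: "\<forall>x\<in>\<Union>(Z (Suc r)). (\<Sum>b\<in>?I K (Suc r). u b * fam' b x) = 0"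
        and b: "set b \<subseteq> {..K} \<and> length b = Suc r"
      from b have "b \<in> ?I K (Suc r)" by simp
      then obtain k b' where "b = k # b'" "k \<le> K" "b' \<in> ?I K r" unfolding I by auto
      then show "u b = 0" using indep[OF u] by metis
    qed (rule fam'_form, simp)
  qed
qed

end

section \<open>Upper bound for the Krull dimension from finitely many polynomial charts\<close>

lemma span_embed:
  fixes c :: 'c and q :: "'b \<Rightarrow> complex"
  assumes "q \<in> fsc.span S"
  shows "(\<lambda>(c', t). if c' = c then q t else 0) \<in> fsc.span ((\<lambda>q (c', t). if c' = c then q t else 0) ` S)"
  using assms
proof (induction rule: fsc.span_induct_alt)
  case base
  have "(\<lambda>(c', t). if c' = c then 0 t else 0) = (0 :: 'c \<times> 'b \<Rightarrow> complex)"
    by (auto simp: fun_eq_iff)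
  then show ?case by (simp only: fsc.span_zero)
next
  case (step k a f)
  let ?e = "\<lambda>q (c', t). if c' = c then q t else 0 :: complex"
  have "?e a \<in> fsc.span (?e ` S)" by (intro fsc.span_base imageI step(1))
  from fsc.span_add[OF fsc.span_scale[OF this, of k] step(2)]
  have "fscale k (?e a) + ?e f \<in> fsc.span (?e ` S)" .
  moreover have "fscale k (?e a) + ?e f = ?e (fscale k a + f)"
    by (auto simp: fscale_apply fun_eq_iff)
  ultimately show ?case by (simp only:)
qed

text \<open>The vectors of \<open>W\<close> are functions, so evaluations are linear forms, and any
  nonzero vector is detected by one of them.\<close>

lemma eval_form:
  assumes W: "fsc.subspace W"
  shows "restr W (\<lambda>w. w v) \<in> linear_forms fscale W"
  using fsc.subspace_add[OF W] fsc.subspace_scale[OF W]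
  by (simp add: linear_forms_def restr_def fscale_apply)

text \<open>A relation between pullbacks that holds on every chart holds on \<open>B\<close>,
  because the charts cover \<open>B\<close> up to scalars. Hence at most
  \<open>card C * (e * K * \<delta> + 1) ^ D\<close> forms of degree \<open>e * K\<close> can be
  independent on a subset of \<open>B\<close>, against the \<open>(K + 1) ^ r\<close> given by a
  chain.\<close>

lemma krull_dim_le:
  fixes P :: "'c \<Rightarrow> ('j \<Rightarrow> complex) \<times> 'v \<Rightarrow> complex"
  assumes "projective_subset fscale W B" and C: "finite C"
    and J: "\<And>c. c \<in> C \<Longrightarrow> finite (J c)" "\<And>c. c \<in> C \<Longrightarrow> card (J c) \<le> D"
    and P: "\<And>c. c \<in> C \<Longrightarrow> P c \<in> pmaps (J c) \<delta> W"
    and cover: "\<And>p. p \<in> B \<Longrightarrow> \<exists>c\<in>C. \<exists>t. p = fsc.span {\<lambda>x. P c (t, x)}"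
  shows "krull_dim (subtopology (zariski fscale W) B) \<le> enat D"
proof -
  interpret projective_subset fscale W B by fact
  have "r \<le> D"
    if irr: "\<forall>i\<le>r. irreducible_closed T (Z i)" and strict: "\<forall>i<r. Z i \<subset> Z (Suc i)" for r Z
  proof -
    have ZB: "Z i \<subseteq> B" if "i \<le> r" for i
      using irr that closedin_subset[of T "Z i"] unfolding irreducible_closed_def by auto
    obtain p where p: "p \<in> Z 0" using irr unfolding irreducible_closed_def by blast
    then obtain z where z: "z \<in> W" "z \<noteq> 0" "p = fsc.span {z}" using ZB[of 0] B_E by blast
    then obtain v where v: "z v \<noteq> 0" by (auto simp: fun_eq_iff)
    have F0: "restr W (\<lambda>w. w v) \<in> forms fscale W 1" "z \<in> \<Union>(Z 0)" "restr W (\<lambda>w. w v) z \<noteq> 0"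
      using forms_linear[OF eval_form[OF subspace_W]] p z v fsc.span_base[of z "{z}"]
      by (auto simp: restr_def)
    have "\<exists>e. \<forall>K. \<exists>fam. (\<forall>b. set b \<subseteq> {..K} \<and> length b = r \<longrightarrow> fam b \<in> forms fscale W (e * K)) \<and>
      (\<forall>u. (\<forall>x\<in>\<Union>(Z r). (\<Sum>b | set b \<subseteq> {..K} \<and> length b = r. u b * fam b x) = 0) \<longrightarrow>
         (\<forall>b. set b \<subseteq> {..K} \<and> length b = r \<longrightarrow> u b = 0))"
      by (rule chain_family[where Z = Z, OF F0(1,2) z(1) F0(3)]) (use irr strict in auto)
    then obtain e where e: "\<exists>fam. (\<forall>b. set b \<subseteq> {..K} \<and> length b = r \<longrightarrow> fam b \<in> forms fscale W (e * K)) \<and>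
      (\<forall>u. (\<forall>x\<in>\<Union>(Z r). (\<Sum>b | set b \<subseteq> {..K} \<and> length b = r. u b * fam b x) = 0) \<longrightarrow>
         (\<forall>b. set b \<subseteq> {..K} \<and> length b = r \<longrightarrow> u b = 0))" for K
      by (elim exE) (rule that, elim allE)
    have bound: "(K + 1) ^ r \<le> card C * (e * K * \<delta> + 1) ^ D" for K
    proof (rule ccontr)
      assume neg: "\<not> ?thesis"
      let ?I = "{b. set b \<subseteq> {..K} \<and> length b = r}"
      have I: "finite ?I" "card ?I = (K + 1) ^ r"
        using finite_lists_length_eq[of "{..K}" r] card_lists_length_eq[of "{..K}" r] by auto
      from e[of K] obtain fam where fam0:
        "\<forall>b. set b \<subseteq> {..K} \<and> length b = r \<longrightarrow> fam b \<in> forms fscale W (e * K)"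
        "\<forall>u. (\<forall>x\<in>\<Union>(Z r). (\<Sum>b\<in>?I. u b * fam b x) = 0) \<longrightarrow>
           (\<forall>b. set b \<subseteq> {..K} \<and> length b = r \<longrightarrow> u b = 0)"
        by (elim exE conjE)
      have fam: "fam b \<in> forms fscale W (e * K)" if "b \<in> ?I" for b
        using fam0(1) that by simp
      let ?N = "e * K * \<delta>"
      \<comment> \<open>Extension by zero to the disjoint union of the charts, so that one relation
        can be found for all charts at once.\<close>
      let ?e = "\<lambda>c q (c', t). if c' = c then q t else 0 :: complex"
      have "\<forall>c\<in>C. \<exists>T. finite T \<and> card T \<le> (?N + 1) ^ card (J c) \<and> polys (J c) ?N \<subseteq> fsc.span T"
        using polys_finite_span[OF J(1)] by blast
      then obtain S where S: "\<And>c. c \<in> C \<Longrightarrow> finite (S c)"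
        "\<And>c. c \<in> C \<Longrightarrow> card (S c) \<le> (?N + 1) ^ card (J c)"
        "\<And>c. c \<in> C \<Longrightarrow> polys (J c) ?N \<subseteq> fsc.span (S c)"
        by (metis (no_types, lifting))
      let ?T = "\<Union>c\<in>C. ?e c ` S c"
      have "card ?T \<le> (\<Sum>c\<in>C. card (?e c ` S c))" using C by (rule card_UN_le)
      also have "\<dots> \<le> (\<Sum>c\<in>C. (?N + 1) ^ D)"
      proof (rule sum_mono)
        fix c assume c: "c \<in> C"
        have "card (?e c ` S c) \<le> card (S c)" using S(1)[OF c] by (rule card_image_le)
        also have "\<dots> \<le> (?N + 1) ^ card (J c)" by (rule S(2)[OF c])
        also have "\<dots> \<le> (?N + 1) ^ D" using J(2)[OF c] by (intro power_increasing) auto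
        finally show "card (?e c ` S c) \<le> (?N + 1) ^ D" .
      qed
      finally have "card ?T < card ?I" using neg I(2) by simp
      moreover have "finite ?T" using C S(1) by simp
      moreover have "(\<lambda>a. \<Sum>c\<in>C. ?e c (\<lambda>t. fam b (\<lambda>x. P c (t, x))) a) \<in> fsc.span ?T" if b: "b \<in> ?I" for b
      proof -
        have "?e c (\<lambda>t. fam b (\<lambda>x. P c (t, x))) \<in> fsc.span ?T" if c: "c \<in> C" for c
        proof -
          have "(\<lambda>t. fam b (\<lambda>x. P c (t, x))) \<in> fsc.span (S c)"
            using forms_comp[OF subspace_W P[OF c] fam[OF b]] S(3)[OF c] by blast
          from span_embed[OF this, of c] show ?thesis
            by (rule rev_subsetD) (intro fsc.span_mono, use c in blast)
        qed
        then have "(\<Sum>c\<in>C. ?e c (\<lambda>t. fam b (\<lambda>x. P c (t, x)))) \<in> fsc.span ?T" by (rule fsc.span_sum)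
        moreover have "(\<lambda>a. \<Sum>c\<in>C. ?e c (\<lambda>t. fam b (\<lambda>x. P c (t, x))) a) =
            (\<Sum>c\<in>C. ?e c (\<lambda>t. fam b (\<lambda>x. P c (t, x))))"
          by (rule ext) (simp add: sum_fun_apply)
        ultimately show ?thesis by (simp only:)
      qed
      ultimately obtain u where u: "\<exists>b\<in>?I. u b \<noteq> 0"
        "\<And>a. (\<Sum>b\<in>?I. u b * (\<Sum>c\<in>C. ?e c (\<lambda>t. fam b (\<lambda>x. P c (t, x))) a)) = 0"
        using family_dependent[OF I(1), of ?T "\<lambda>b a. \<Sum>c\<in>C. ?e c (\<lambda>t. fam b (\<lambda>x. P c (t, x))) a"]
        by blast
      have "(\<Sum>b\<in>?I. u b * fam b x) = 0" if x: "x \<in> \<Union>(Z r)" for x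
      proof -
        from x obtain p where p: "p \<in> Z r" "x \<in> p" by blast
        then have "p \<in> B" using ZB[of r] by blast
        then obtain c t where c: "c \<in> C" "p = fsc.span {\<lambda>x. P c (t, x)}" using cover by blast
        then obtain k where k: "x = fscale k (\<lambda>x. P c (t, x))" using p(2) by (auto simp: fsc.span_singleton)
        \<comment> \<open>All members have the same degree, so passing from the vector of the chart
          to its multiple \<open>x\<close> multiplies the whole relation by one factor.\<close>
        have eq: "fam b x = k ^ (e * K) * fam b (\<lambda>x. P c (t, x))" if "b \<in> ?I" for b
          unfolding k
          by (rule forms_scale[OF vector_space_fscale subspace_W fam[OF that]
                pmaps_fibre[OF subspace_W P[OF c(1)]]])
        have "(\<Sum>b\<in>?I. u b * fam b x) = k ^ (e * K) * (\<Sum>b\<in>?I. u b * fam b (\<lambda>x. P c (t, x)))"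
          by (simp add: eq sum_distrib_left mult_ac)
        also have "(\<Sum>b\<in>?I. u b * fam b (\<lambda>x. P c (t, x))) = 0"
          using u(2)[of "(c, t)"] c(1) C by simp
        finally show ?thesis by simp
      qed
      then have "u b = 0" if "b \<in> ?I" for b using fam0(2)[rule_format, of u b] that by simp
      with u(1) show False by blast
    qed
    show "r \<le> D"
    proof (rule ccontr)
      assume "\<not> r \<le> D"
      \<comment> \<open>The bound is used at \<open>K = ?M\<close>: for \<open>r > D\<close> it
        would make \<open>(?M + 1)^(D + 1)\<close> at most \<open>?M * (?M + 1)^D\<close>.\<close>
      let ?M = "card C * (e * \<delta> + 1) ^ D"
      have "(?M + 1) * (?M + 1) ^ D = (?M + 1) ^ Suc D" by simp
      also have "\<dots> \<le> (?M + 1) ^ r" using \<open>\<not> r \<le> D\<close> by (intro power_increasing) auto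
      also have "\<dots> \<le> card C * (e * ?M * \<delta> + 1) ^ D" by (rule bound)
      also have "\<dots> \<le> card C * ((e * \<delta> + 1) * (?M + 1)) ^ D"
        by (intro mult_le_mono2 power_mono) (auto simp: algebra_simps)
      also have "\<dots> = ?M * (?M + 1) ^ D" by (simp only: power_mult_distrib mult.assoc)
      finally show False by simp
    qed
  qed
  then show ?thesis unfolding krull_dim_def by (intro Sup_least) auto
qed

section \<open>Lower bounds from an injective derivative\<close>

text \<open>Evaluate the relation on the line \<open>e * s\<close>, divide by \<open>e^d\<close>,
  where \<open>d\<close> is the lowest degree with a nonzero coefficient, and let \<open>e\<close>
  tend to 0. Since \<open>y j\<close> has linear part \<open>s j\<close> and \<open>y0\<close> tends
  to 1, what remains is the degree \<open>d\<close> part as a polynomial in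
  \<open>s\<close>.\<close>

lemma lowest_order_independent:
  fixes y :: "'j \<Rightarrow> ('j \<Rightarrow> complex) \<Rightarrow> complex"
  assumes A: "finite A" "\<And>M. M \<in> A \<Longrightarrow> set_mset M \<subseteq> J"
    and y0: "\<And>s. ((\<lambda>e. y0 (\<lambda>j. e * s j)) \<longlongrightarrow> 1) (at 0)"
    and y: "\<And>s j. j \<in> J \<Longrightarrow> ((\<lambda>e. y j (\<lambda>j. e * s j) / e) \<longlongrightarrow> s j) (at 0)"
    and zero: "\<And>t. (\<Sum>M\<in>A. c M * (y0 t ^ (N - size M) * mmon y M t)) = 0"
    and M: "M \<in> A"
  shows "c M = 0"
proof (rule ccontr)
  assume "c M \<noteq> 0"
  define A' where "A' = {M \<in> A. c M \<noteq> 0}"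
  define d where "d = Min (size ` A')"
  have A': "finite A'" "M \<in> A'" "\<And>M. M \<in> A' \<Longrightarrow> set_mset M \<subseteq> J"
    using A M \<open>c M \<noteq> 0\<close> by (auto simp: A'_def)
  then have d: "d \<le> size M" if "M \<in> A'" for M using that by (simp add: d_def)
  have "d \<in> size ` A'" using A' unfolding d_def by (intro Min_in) auto
  then obtain M0 where M0: "M0 \<in> A'" "size M0 = d" by auto
  \<comment> \<open>The factor \<open>0 ^ (size M - d)\<close> is the limit of
    \<open>e ^ (size M - d)\<close>; as \<open>0 ^ 0 = 1\<close>, it selects exactly the terms of
    degree \<open>d\<close>.\<close>
  have "(\<Sum>M\<in>A'. (c M * 0 ^ (size M - d)) * mmon (\<lambda>j t. t j) M s) = 0" for s
  proof -
    let ?t = "\<lambda>e j. e * s j"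
    let ?f = "\<lambda>e. \<Sum>M\<in>A'. c M * e ^ (size M - d) *
        (y0 (?t e) ^ (N - size M) * (\<Prod>j\<in>#M. y j (?t e) / e))"
    have prod: "((\<lambda>e. \<Prod>j\<in>#M. y j (?t e) / e) \<longlongrightarrow> mmon (\<lambda>j t. t j) M s) (at 0)"
      if "set_mset M \<subseteq> J" for M
      using that
    proof (induction M)
      case empty
      then show ?case by simp
    next
      case (add j M)
      then have "((\<lambda>e. (y j (?t e) / e) * (\<Prod>j\<in>#M. y j (?t e) / e)) \<longlongrightarrow>
          s j * mmon (\<lambda>j t. t j) M s) (at 0)"
        by (intro tendsto_mult y add.IH) auto
      then show ?case by simp
    qed
    have "(?f \<longlongrightarrow> (\<Sum>M\<in>A'. c M * 0 ^ (size M - d) *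
        (1 ^ (N - size M) * mmon (\<lambda>j t. t j) M s))) (at 0)"
      using A'(3) by (intro tendsto_sum tendsto_mult tendsto_const tendsto_power y0 prod tendsto_ident_at)
    moreover have "?f e = 0" if "e \<noteq> 0" for e
    proof -
      have pr: "(\<Prod>j\<in>#M. y j (?t e) / e) = mmon y M (?t e) / e ^ size M" for M
        by (induction M) simp_all
      have "e ^ d * ?f e = (\<Sum>M\<in>A'. c M * (y0 (?t e) ^ (N - size M) * mmon y M (?t e)))"
        unfolding sum_distrib_left
      proof (intro sum.cong refl)
        fix M assume "M \<in> A'"
        then have "e ^ size M = e ^ d * e ^ (size M - d)"
          using d by (simp flip: power_add)
        then show "e ^ d * (c M * e ^ (size M - d) *
            (y0 (?t e) ^ (N - size M) * (\<Prod>j\<in>#M. y j (?t e) / e))) =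
            c M * (y0 (?t e) ^ (N - size M) * mmon y M (?t e))"
          using that by (simp add: pr)
      qed
      also have "\<dots> = (\<Sum>M\<in>A. c M * (y0 (?t e) ^ (N - size M) * mmon y M (?t e)))"
        using A(1) by (intro sum.mono_neutral_left) (auto simp: A'_def)
      finally show ?thesis using zero that by simp
    qed
    then have "(?f \<longlongrightarrow> 0) (at 0)"
      by (intro tendsto_eventually) (auto simp: eventually_at_filter)
    from tendsto_unique[OF at_neq_bot calculation this] show ?thesis by (simp add: mult.assoc)
  qed
  from mmon_coeff_zero[OF A'(1) this M0(1)] have "c M0 = 0" using M0(2) by simp
  then show False using M0(1) by (simp add: A'_def)
qed

definition on_coords :: "'j set \<Rightarrow> ('j \<Rightarrow> complex) \<Rightarrow> 'j \<Rightarrow> complex" where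
  "on_coords J t j = (if j \<in> J then t j else 0)"

lemma on_coords_scale: "on_coords J (\<lambda>j. e * s j) = (\<lambda>j. e * on_coords J s j)"
  by (auto simp: on_coords_def)

lemma pmaps_on_coords:
  "P \<in> pmaps J N W \<Longrightarrow> (\<lambda>(t, x). P (on_coords J' t, x)) \<in> pmaps J' N W"
proof (rule pmaps_subst)
  fix j
  show "(\<lambda>t. on_coords J' t j) \<in> polys J' 1"
    unfolding on_coords_def using polys_var[of j J' 1] polys_const[of 0 J' 1] by (cases "j \<in> J'") auto
qed

text \<open>If a polynomial map has injective derivative at a point, its image strictly grows when one
  more coordinate is freed: by counting, some form in the dual coordinates vanishes on the smaller
  image, while its lowest order part prevents it from vanishing on the larger one.\<close>

lemma coordinate_separation:
  fixes P :: "('j \<Rightarrow> complex) \<times> 'v \<Rightarrow> complex"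
  assumes W: "fsc.subspace W" and P: "P \<in> pmaps I \<delta> W"
    and l0: "l0 \<in> linear_forms fscale W"
      "\<And>s. ((\<lambda>e. l0 (\<lambda>x. P (\<lambda>j. e * s j, x))) \<longlongrightarrow> 1) (at 0)"
    and l: "\<And>j. j \<in> insert i J \<Longrightarrow> l j \<in> linear_forms fscale W"
      "\<And>s j. j \<in> insert i J \<Longrightarrow> ((\<lambda>e. l j (\<lambda>x. P (\<lambda>j. e * s j, x)) / e) \<longlongrightarrow> s j) (at 0)"
    and J: "finite J" "i \<notin> J"
  obtains k F t where "F \<in> forms fscale W (Suc k)" "\<And>t. F (\<lambda>x. P (on_coords J t, x)) = 0"
    "F (\<lambda>x. P (on_coords (insert i J) t, x)) \<noteq> 0"
proof -
  define J' where "J' = insert i J"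
  define c where "c = card J"
  \<comment> \<open>With this \<open>K\<close>, \<open>(N * \<delta> + 1)^c\<close> is at most
    \<open>K * (K + 1)^c\<close>, which is less than the number \<open>(K + 1)^(c + 1)\<close> of
    monomials with exponents at most \<open>K\<close> in \<open>c + 1\<close> variables.\<close>
  define K where "K = (Suc c * \<delta> + 1) ^ c"
  define N where "N = Suc c * K"
  define A where "A = bounded_multisets J' K"
  have J': "finite J'" "card J' = Suc c" using J by (auto simp: J'_def c_def)
  have K: "K \<ge> 1" by (simp add: K_def)
  have A: "finite A" "card A = (K + 1) ^ Suc c"
    unfolding A_def using finite_bounded_multisets[OF J'(1)] card_bounded_multisets[OF J'(1), of K] J'(2) by auto
  have AJ: "set_mset M \<subseteq> J'" if "M \<in> A" for M
    using that by (simp add: A_def bounded_multisets_def)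
  have AN: "size M \<le> N" if "M \<in> A" for M
    using size_bounded_multisets[OF J'(1), of M K] that unfolding A_def N_def J'(2) by simp
  \<comment> \<open>\<open>l0\<close> pads the monomials to the common degree \<open>N\<close>; it
    tends to 1 at the base point and so leaves lowest order parts unchanged.\<close>
  define G where "G M x = l0 x ^ (N - size M) * restr W (mmon l M) x" for M x
  have G: "G M \<in> forms fscale W N" if M: "M \<in> A" for M
  proof -
    have "restr W (mmon l M) \<in> forms fscale W (size M)"
      using AJ[OF M] l(1) by (intro forms_mmon) (auto simp: J'_def)
    then have "(\<lambda>x. l0 x ^ (N - size M) * restr W (mmon l M) x) \<in>
        forms fscale W ((N - size M) * 1 + size M)"
      using forms_linear[OF l0(1)] by (rule forms_power_mult[rotated])
    moreover have "(N - size M) * 1 + size M = N" using AN[OF M] by simp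
    ultimately show ?thesis unfolding G_def by (simp only:)
  qed
  let ?y = "\<lambda>J M t. G M (\<lambda>x. P (on_coords J t, x))"
  from polys_finite_span[OF J(1), of "N * \<delta>"] obtain T
    where T: "finite T" "card T \<le> (N * \<delta> + 1) ^ card J" "polys J (N * \<delta>) \<subseteq> fsc.span T"
    by (elim exE conjE)
  have "card T \<le> (N * \<delta> + 1) ^ c" using T(2) by (simp add: c_def)
  also have "\<dots> \<le> ((Suc c * \<delta> + 1) * (K + 1)) ^ c"
  proof (rule power_mono)
    have "N * \<delta> = Suc c * \<delta> * K" by (simp add: N_def algebra_simps)
    then have "N * \<delta> + 1 = Suc c * \<delta> * K + 1" by simp
    also have "\<dots> \<le> Suc c * \<delta> * K + 1 * (K + 1)"
      by simp
    also have "\<dots> \<le> (Suc c * \<delta> + 1) * (K + 1)"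
      unfolding add_mult_distrib add_mult_distrib2 by simp
    finally show "N * \<delta> + 1 \<le> (Suc c * \<delta> + 1) * (K + 1)" .
  qed simp
  also have "\<dots> = K * (K + 1) ^ c" by (simp only: power_mult_distrib K_def)
  also have "\<dots> < (K + 1) * (K + 1) ^ c" by (rule mult_strict_right_mono) simp_all
  also have "\<dots> = card A" by (simp only: A(2) power_Suc)
  finally have card: "card T < card A" .
  have inT: "?y J M \<in> fsc.span T" if "M \<in> A" for M
  proof (rule subsetD[OF T(3)])
    show "?y J M \<in> polys J (N * \<delta>)"
      using forms_comp[OF W pmaps_on_coords[OF P, of J] G[OF that]] unfolding prod.case .
  qed
  have "\<exists>u. (\<exists>M\<in>A. u M \<noteq> 0) \<and> (\<forall>t. (\<Sum>M\<in>A. u M * ?y J M t) = 0)"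
    by (rule family_dependent[OF A(1) T(1) _ card]) (rule inT)
  then
  obtain u where u0: "\<exists>M\<in>A. u M \<noteq> 0" "\<forall>t. (\<Sum>M\<in>A. u M * ?y J M t) = 0"
    by (elim exE conjE)
  note u = u0(1) spec[OF u0(2)]
  define F where "F x = (\<Sum>M\<in>A. u M * G M x)" for x
  have "F \<in> forms fscale W N" unfolding F_def by (rule forms_sum) (rule G)
  \<comment> \<open>A form of positive degree vanishes at 0, so a vector where it is nonzero defines
    a point of projective space.\<close>
  moreover have "N = Suc (N - 1)" using K by (simp add: N_def)
  ultimately have F: "F \<in> forms fscale W (Suc (N - 1))" by simp
  have "\<exists>t. F (\<lambda>x. P (on_coords J' t, x)) \<noteq> 0"
  proof (rule ccontr)
    assume neg: "\<not> ?thesis"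
    let ?q = "\<lambda>t x. P (on_coords J' t, x)"
    have in_W: "?q t \<in> W" for t using pmaps_fibre[OF W P] by blast
    have y0: "((\<lambda>e. l0 (?q (\<lambda>j. e * s j))) \<longlongrightarrow> 1) (at 0)" for s
      using l0(2) by (simp add: on_coords_scale)
    have y: "((\<lambda>e. l j (?q (\<lambda>j. e * s j)) / e) \<longlongrightarrow> s j) (at 0)" if "j \<in> J'" for s j
      using l(2)[of j "on_coords J' s"] that by (simp add: on_coords_scale J'_def) (simp add: on_coords_def)
    have zero: "(\<Sum>M\<in>A. u M * (l0 (?q t) ^ (N - size M) * mmon (\<lambda>j t. l j (?q t)) M t)) = 0" for t
    proof -
      have "mmon (\<lambda>j t. l j (?q t)) M t = restr W (mmon l M) (?q t)" for M
        using in_W[of t] by (simp add: restr_def mmon_def)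
      moreover have "F (?q t) = 0" using neg by blast
      ultimately show ?thesis by (simp add: F_def G_def)
    qed
    have "u M = 0" if "M \<in> A" for M
      using lowest_order_independent[OF A(1) AJ y0 y zero that] .
    then show False using u(1) by blast
  qed
  then obtain t where "F (\<lambda>x. P (on_coords (insert i J) t, x)) \<noteq> 0"
    unfolding J'_def by blast
  moreover have "F (\<lambda>x. P (on_coords J t, x)) = 0" for t
    unfolding F_def by (rule u(2))
  ultimately show thesis using that[OF F] by metis
qed

section \<open>Closures of images of polynomial maps, and the lower bound\<close>

context projective_subset
begin

text \<open>The Zariski closure in \<open>B\<close> of the projective image of
  \<open>\<psi>\<close>. It is given through forms on vectors, because \<open>\<psi> t\<close> may
  be 0 and then defines no point.\<close>

definition closure_of_image :: "('t \<Rightarrow> 'a) \<Rightarrow> 'a set set" where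
  "closure_of_image \<psi> =
     {p \<in> B. \<forall>k. \<forall>F\<in>forms s W k. (\<forall>t. F (\<psi> t) = 0) \<longrightarrow> (\<forall>x\<in>p. F x = 0)}"

lemma closedin_closure_of_image: "closedin T (closure_of_image \<psi>)"
proof -
  let ?S = "{F \<in> (\<Union>k. forms s W k). \<forall>t. F (\<psi> t) = 0}"
  have "closure_of_image \<psi> = zero_locus s W ?S \<inter> B"
    using B_proj by (auto simp: closure_of_image_def zero_locus_def)
  then show ?thesis unfolding closedin_T by (intro exI[of _ ?S]) auto
qed

lemma image_in_closure:
  assumes "\<psi> t \<in> W" "span {\<psi> t} \<in> B"
  shows "span {\<psi> t} \<in> closure_of_image \<psi>"
  unfolding closure_of_image_def
proof (intro CollectI conjI allI ballI impI assms(2))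
  fix k F x assume "F \<in> forms s W k" "\<forall>t. F (\<psi> t) = 0" "x \<in> span {\<psi> t}"
  then show "F x = 0" using form_vanish_iff[OF _ assms(1)] by blast
qed

end

text \<open>If neither of two closed sets contains the image, forms \<open>F\<close> and
  \<open>G\<close> witness this at parameters \<open>t1\<close> and \<open>t2\<close>. On the line
  through \<open>t1\<close> and \<open>t2\<close> both pull back to nonzero polynomials in one
  variable, so some point of the line avoids all roots, and its image lies in neither set.\<close>

lemma irreducible_closure_of_image:
  fixes P :: "('j \<Rightarrow> complex) \<times> 'v \<Rightarrow> complex"
  assumes "projective_subset fscale W B"
    and P: "P \<in> pmaps J \<delta> W"
    and into: "\<And>t. (\<lambda>x. P (t, x)) \<noteq> 0 \<Longrightarrow> fsc.span {\<lambda>x. P (t, x)} \<in> B"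
    and nz: "(\<lambda>x. P (t0, x)) \<noteq> 0"
  shows "irreducible_closed (subtopology (zariski fscale W) B)
    (projective_subset.closure_of_image fscale W B (\<lambda>t x. P (t, x)))"
proof -
  interpret projective_subset fscale W B by fact
  let ?p = "\<lambda>t x. P (t, x)"
  let ?Z = "closure_of_image ?p"
  have inW: "?p t \<in> W" for t by (rule pmaps_fibre[OF subspace_W P])
  \<comment> \<open>Vanishing is required only at parameters with nonzero value. At the value 0,
    homogeneity gives \<open>0 ^ k\<close> times the value at \<open>t0\<close>, which is 0 also for
    constants.\<close>
  have sub: "?Z \<subseteq> zero_locus fscale W S \<inter> B"
    if S: "S \<subseteq> (\<Union>k. forms fscale W k)"
      and v: "\<And>t F. ?p t \<noteq> 0 \<Longrightarrow> F \<in> S \<Longrightarrow> F (?p t) = 0" for S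
  proof
    fix p assume p: "p \<in> ?Z"
    then have pB: "p \<in> B" by (simp add: closure_of_image_def)
    have "F x = 0" if F: "F \<in> S" and x: "x \<in> p" for F x
    proof -
      obtain k where k: "F \<in> forms fscale W k" using F S by blast
      have "F (?p t) = 0" for t
      proof (cases "?p t = 0")
        case True
        have "F (fscale 0 (?p t0)) = 0 ^ k * F (?p t0)"
          by (rule forms_scale[OF vector_space_fscale subspace_W k inW])
        moreover have "F (?p t0) = 0" using v[OF nz F] .
        ultimately show ?thesis unfolding True by simp
      next
        case False
        then show ?thesis using v F by blast
      qed
      then show ?thesis using p k x unfolding closure_of_image_def by blast
    qed
    then show "p \<in> zero_locus fscale W S \<inter> B" using pB B_proj by (auto simp: zero_locus_def)
  qed
  have "?Z = X \<or> ?Z = Y" if X: "closedin T X" and Y: "closedin T Y" and XY: "?Z = X \<union> Y" for X Y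
  proof (rule ccontr)
    assume neg: "\<not> ?thesis"
    obtain S where S: "S \<subseteq> (\<Union>k. forms fscale W k)" "X = zero_locus fscale W S \<inter> B"
      using X closedin_T by blast
    obtain R where R: "R \<subseteq> (\<Union>k. forms fscale W k)" "Y = zero_locus fscale W R \<inter> B"
      using Y closedin_T by blast
    have "\<not> ?Z \<subseteq> X" "\<not> ?Z \<subseteq> Y" using neg XY by blast+
    then obtain t1 F t2 G where F: "F \<in> S" "F (?p t1) \<noteq> 0" "?p t1 \<noteq> 0"
      and G: "G \<in> R" "G (?p t2) \<noteq> 0"
      using sub[OF S(1)] sub[OF R(1)] unfolding S(2) R(2) by metis
    obtain j k where jk: "F \<in> forms fscale W j" "G \<in> forms fscale W k"
      using F(1) S(1) G(1) R(1) by blast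
    obtain v where v: "P (t1, v) \<noteq> 0" using F(3) by (auto simp: fun_eq_iff)
    let ?L = "\<lambda>a b e j. a j + e * (b j - a j)"
    have line: "\<exists>Q. (\<forall>e. q (?L t1 t2 e) = poly Q e)" if "q \<in> polys J N" for q N
      using polys_line[OF that] .
    obtain QF where QF: "\<And>e. F (?p (?L t1 t2 e)) = poly QF e"
      using line[OF forms_comp[OF subspace_W P jk(1)]] by blast
    obtain QG where QG: "\<And>e. G (?p (?L t1 t2 e)) = poly QG e"
      using line[OF forms_comp[OF subspace_W P jk(2)]] by blast
    \<comment> \<open>The third polynomial keeps the vector nonzero along the line, so that it
      represents a point of \<open>B\<close>.\<close>
    obtain QE where "\<And>e. restr W (\<lambda>w. w v) (?p (?L t1 t2 e)) = poly QE e"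
      using line[OF pmaps_linear[OF subspace_W P eval_form[OF subspace_W]]] by blast
    then have QE: "P (?L t1 t2 e, v) = poly QE e" for e using inW by (simp add: restr_def)
    have "QE \<noteq> 0" using v QE[of 0] by auto
    have "QF \<noteq> 0" using F(2) QF[of 0] by auto
    have "QG \<noteq> 0" using G(2) QG[of 1] by auto
    have "finite {e. poly (QF * QG * QE) e = 0}"
      using \<open>QF \<noteq> 0\<close> \<open>QG \<noteq> 0\<close> \<open>QE \<noteq> 0\<close> by (intro poly_roots_finite) simp
    from ex_new_if_finite[OF infinite_UNIV_char_0 this] obtain e
      where e: "poly QF e \<noteq> 0" "poly QG e \<noteq> 0" "poly QE e \<noteq> 0" by auto
    let ?t = "?L t1 t2 e"
    have "?p ?t \<noteq> 0" using QE[of e] e(3) by (metis zero_fun_apply)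
    then have "fsc.span {?p ?t} \<in> X \<union> Y"
      using image_in_closure[where \<psi> = ?p and t = ?t] inW into XY by blast
    moreover have "?p ?t \<in> fsc.span {?p ?t}" by (intro fsc.span_base) simp
    ultimately have "F (?p ?t) = 0 \<or> G (?p ?t) = 0"
      using F(1) G(1) unfolding S(2) R(2) zero_locus_def by blast
    then show False using e QF QG by metis
  qed
  moreover have "fsc.span {?p t0} \<in> ?Z"
    by (rule image_in_closure[where \<psi> = ?p and t = t0]) (use inW into[OF nz] in auto)
  ultimately show ?thesis
    using closedin_closure_of_image[of ?p] unfolding irreducible_closed_def by blast
qed

text \<open>The family is extended to a basis of the space of all functions, and \<open>l k\<close>
  is the coordinate at \<open>h k\<close>. Such functionals extract coefficients from relations
  between functions.\<close>

lemma dual_functionals: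
  fixes h :: "'k \<Rightarrow> 'v \<Rightarrow> complex"
  assumes I': "finite I'"
    and hind: "\<And>c. (\<And>x. (\<Sum>k\<in>I'. c k * h k x) = 0) \<Longrightarrow> \<forall>k\<in>I'. c k = 0"
  obtains l where "\<And>k a f g. l k (fscale a f + g) = a * l k f + l k g"
    "\<And>k k'. k \<in> I' \<Longrightarrow> k' \<in> I' \<Longrightarrow> l k (h k') = (if k = k' then 1 else 0 :: complex)"
proof -
  have inj: "inj_on h I'"
  proof (rule inj_onI, rule ccontr)
    fix k k' assume k: "k \<in> I'" "k' \<in> I'" "h k = h k'" "k \<noteq> k'"
    let ?c = "\<lambda>i. if i = k then 1 else if i = k' then -1 else (0::complex)"
    have "(\<Sum>i\<in>I'. ?c i * h i x) = (\<Sum>i\<in>{k, k'}. ?c i * h i x)" for x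
      using k(1,2) I' by (intro sum.mono_neutral_right) auto
    then have "(\<Sum>i\<in>I'. ?c i * h i x) = 0" for x using k(3,4) by simp
    from bspec[OF hind[of ?c, OF this] k(1)] show False by simp
  qed
  have ind: "fsc.independent (h ` I')"
    unfolding fsc.independent_explicit_module
  proof (intro allI impI)
    fix S u v assume S: "finite S" "S \<subseteq> h ` I'" "(\<Sum>w\<in>S. fscale (u w) w) = 0" "v \<in> S"
    let ?c = "\<lambda>k. if h k \<in> S then u (h k) else 0"
    have "(\<Sum>k\<in>I'. ?c k * h k x) = 0" for x
    proof -
      have "(\<Sum>k\<in>I'. ?c k * h k x) = (\<Sum>w\<in>h ` I'. (if w \<in> S then u w else 0) * w x)"
        using inj by (simp add: sum.reindex)
      also have "\<dots> = (\<Sum>w\<in>S. u w * w x)"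
        using S I' by (intro sum.mono_neutral_cong_right) auto
      also have "\<dots> = 0"
        using fun_cong[OF S(3), of x] by (simp add: sum_fun_apply fscale_apply)
      finally show ?thesis .
    qed
    from hind[of ?c, OF this] have "\<forall>k\<in>I'. ?c k = 0" .
    moreover obtain k where "k \<in> I'" "v = h k" using S(2,4) by blast
    ultimately show "u v = 0" using S(4) by auto
  qed
  define E where "E = fsc.extend_basis (h ` I')"
  have E: "fsc.independent E" "h ` I' \<subseteq> E" "fsc.span E = UNIV"
    unfolding E_def using fsc.independent_extend_basis[OF ind] fsc.extend_basis_superset[OF ind]
      fsc.span_extend_basis[OF ind] by auto
  let ?l = "\<lambda>k w. fsc.representation E w (h k)"
  have "?l k (fscale a f + g) = a * ?l k f + ?l k g" for k a f g
    using E(1,3) by (simp add: fsc.representation_add fsc.representation_scale)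
  moreover have "?l k (h k') = (if k = k' then 1 else 0)" if "k \<in> I'" "k' \<in> I'" for k k'
  proof -
    have "h k' \<in> E" using E(2) that(2) by blast
    from fsc.representation_basis[OF E(1) this]
    show ?thesis using inj_on_eq_iff[OF inj that] by simp
  qed
  ultimately show thesis by (rule that[of ?l])
qed

text \<open>Independence includes the value at the base point next to the derivatives, since a
  tangent direction along the vector itself is lost in projective space. The dual functionals give a
  linear form tending to 1 and linear forms that agree with the parameters to first order, so that
  each step of a flag of coordinate subspaces can be separated.\<close>

lemma krull_dim_ge:
  fixes P :: "('j \<Rightarrow> complex) \<times> 'v \<Rightarrow> complex"
  assumes B: "projective_subset fscale W B"
    and P: "P \<in> pmaps I \<delta> W"
    and into: "\<And>t. (\<lambda>x. P (t, x)) \<noteq> 0 \<Longrightarrow> fsc.span {\<lambda>x. P (t, x)} \<in> B"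
    and J: "finite J"
    and deriv: "\<And>s x. ((\<lambda>e. P (\<lambda>j. e * s j, x)) has_field_derivative (\<Sum>j\<in>J. s j * D j x)) (at 0)"
    and D: "\<And>j. j \<in> J \<Longrightarrow> D j \<in> W"
    and indep: "\<And>a b. (\<And>x. a * P (\<lambda>_. 0, x) + (\<Sum>j\<in>J. b j * D j x) = 0) \<Longrightarrow>
      a = 0 \<and> (\<forall>j\<in>J. b j = 0)"
  shows "enat (card J) \<le> krull_dim (subtopology (zariski fscale W) B)"
proof -
  interpret projective_subset fscale W B by fact
  define h where "h k = (case k of None \<Rightarrow> (\<lambda>x. P (\<lambda>_. 0, x)) | Some j \<Rightarrow> D j)" for k
  define I' where "I' = insert None (Some ` J)"
  have I': "finite I'" using J by (simp add: I'_def)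
  have hW: "h k \<in> W" if "k \<in> I'" for k
    using that D pmaps_fibre[OF subspace_W P] by (auto simp: I'_def h_def)
  have hind: "\<forall>k\<in>I'. c k = 0" if "\<And>x. (\<Sum>k\<in>I'. c k * h k x) = 0" for c
  proof -
    have "(\<Sum>k\<in>I'. c k * h k x) = c None * P (\<lambda>_. 0, x) + (\<Sum>j\<in>J. c (Some j) * D j x)" for x
      unfolding I'_def using J by (subst sum.insert) (auto simp: sum.reindex h_def)
    then have "c None * P (\<lambda>_. 0, x) + (\<Sum>j\<in>J. c (Some j) * D j x) = 0" for x
      using that[of x] by simp
    from indep[of "c None" "\<lambda>j. c (Some j)", OF this] show ?thesis by (simp add: I'_def)
  qed
  obtain g where g: "\<And>k a f h. g k (fscale a f + h) = a * g k f + g k h"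
    "\<And>k k'. k \<in> I' \<Longrightarrow> k' \<in> I' \<Longrightarrow> g k (h k') = (if k = k' then 1 else 0 :: complex)"
    using dual_functionals[of I' h, OF I' hind] by metis
  define l where "l k = restr W (g k)" for k
  have "g k 0 = 0" for k using g(1)[of k 1 0 0] by simp
  then have "g k (f + h) = g k f + g k h" "g k (fscale a f) = a * g k f" for k a f h
    using g(1)[of k 1 f h] g(1)[of k a f 0] by simp_all
  then have l: "l k \<in> linear_forms fscale W" for k
    unfolding linear_forms_def l_def restr_def
    using fsc.subspace_add[OF subspace_W] fsc.subspace_scale[OF subspace_W] by simp
  have lh: "l k (h k') = (if k = k' then 1 else 0)" if "k \<in> I'" "k' \<in> I'" for k k'
    using g(2)[OF that] hW[OF that(2)] by (simp add: l_def restr_def)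
  have l_deriv: "((\<lambda>e. l k (\<lambda>x. P (\<lambda>j. e * s j, x))) has_field_derivative
      (case k of None \<Rightarrow> 0 | Some j \<Rightarrow> s j)) (at 0)" if k: "k \<in> I'" for k s
  proof -
    obtain R where R: "R \<in> W"
      "\<And>x. ((\<lambda>e. P (\<lambda>j. 0 + e * s j, x)) has_field_derivative R x) (at 0)"
      "\<And>l. l \<in> linear_forms fscale W \<Longrightarrow>
        ((\<lambda>e. l (\<lambda>x. P (\<lambda>j. 0 + e * s j, x))) has_field_derivative l R) (at 0)"
      using pmaps_deriv[OF subspace_W P, of "\<lambda>_. 0" s] by (elim bexE conjE) (rule that, auto)
    have "R x = (\<Sum>j\<in>J. s j * D j x)" for x
      using R(2)[of x] deriv[of s x] by (simp add: DERIV_unique)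
    then have "R = (\<Sum>j\<in>J. fscale (s j) (h (Some j)))"
      by (auto simp: sum_fun_apply fscale_apply h_def)
    moreover have "l k (\<Sum>j\<in>J'. fscale (s j) (h (Some j))) = (\<Sum>j\<in>J'. s j * l k (h (Some j)))"
      if "J' \<subseteq> J" for J'
      using finite_subset[OF that J] that
    proof (induction J')
      case empty
      show ?case unfolding sum.empty by (rule linear_forms_0[OF subspace_W l])
    next
      case (insert i J')
      have W: "h (Some i) \<in> W" "(\<Sum>j\<in>J'. fscale (s j) (h (Some j))) \<in> W"
        using insert.prems hW by (auto intro!: fsc.subspace_sum[OF subspace_W]
            fsc.subspace_scale[OF subspace_W] simp: I'_def)
      show ?case
        unfolding sum.insert[OF insert.hyps(1,2)] linear_forms_comb[OF subspace_W l W]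
        using insert.IH insert.prems by simp
    qed
    ultimately have "l k R = (\<Sum>j\<in>J. s j * l k (h (Some j)))" by simp
    also have "\<dots> = (\<Sum>j\<in>J. if k = Some j then s j else 0)"
      using k by (intro sum.cong refl) (simp add: lh I'_def)
    also have "\<dots> = (case k of None \<Rightarrow> 0 | Some j \<Rightarrow> s j)"
      using J k by (auto simp: I'_def split: option.split)
    finally show ?thesis using R(3)[OF l, of k] by simp
  qed
  have l_tendsto: "((\<lambda>e. l (Some j) (\<lambda>x. P (\<lambda>j. e * s j, x)) / e) \<longlongrightarrow> s j) (at 0)"
    if "j \<in> J" for j s
  proof -
    have "l (Some j) (h None) = 0" using lh[of "Some j" None] that by (auto simp: I'_def)
    then have "l (Some j) (\<lambda>x. P (\<lambda>_. 0, x)) = 0" by (simp add: h_def)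
    then show ?thesis
      using l_deriv[of "Some j" s] that by (simp add: DERIV_def I'_def)
  qed
  have l0_tendsto: "((\<lambda>e. l None (\<lambda>x. P (\<lambda>j. e * s j, x))) \<longlongrightarrow> 1) (at 0)" for s
  proof -
    have "l None (h None) = 1" using lh[of None None] by (simp add: I'_def)
    then have "l None (\<lambda>x. P (\<lambda>_. 0, x)) = 1" by (simp add: h_def)
    then show ?thesis
      using DERIV_isCont[OF l_deriv[of None s]] by (simp add: isCont_def I'_def)
  qed
  have nz: "(\<lambda>x. P (\<lambda>_. 0, x)) \<noteq> 0"
  proof
    assume z: "(\<lambda>x. P (\<lambda>_. 0, x)) = 0"
    have "l None (h None) = 1" using lh[of None None] by (simp add: I'_def)
    then show False using linear_forms_0[OF subspace_W l, of None] z by (simp add: h_def)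
  qed
  obtain f where f: "bij_betw f {..<card J} J"
    using ex_bij_betw_nat_finite[OF J] by (auto simp: atLeast0LessThan)
  define Jn where "Jn i = f ` {..<i}" for i
  define Z where "Z i = closure_of_image (\<lambda>t x. P (on_coords (Jn i) t, x))" for i
  have P': "(\<lambda>(t, x). P (on_coords (Jn i) t, x)) \<in> pmaps (Jn i) \<delta> W" for i
    by (rule pmaps_on_coords[OF P])
  have irr: "irreducible_closed T (Z i)" for i
  proof -
    have "on_coords (Jn i) (\<lambda>_. 0) = (\<lambda>_. 0)" by (auto simp: on_coords_def)
    then show ?thesis
      using irreducible_closure_of_image[OF B P'[of i], of "\<lambda>_. 0"] into nz
      unfolding Z_def by simp
  qed
  have strict: "Z i \<subset> Z (Suc i)" if i: "i < card J" for i
  proof -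
    have JS: "Jn (Suc i) = insert (f i) (Jn i)" by (auto simp: Jn_def lessThan_Suc)
    have inj: "inj_on f {..<card J}"
      using f by (auto simp: bij_betw_def)
    have "f i \<notin> Jn i"
    proof
      assume "f i \<in> Jn i"
      then obtain j where "j < i" "f i = f j" by (auto simp: Jn_def)
      then show False using inj_onD[OF inj, of i j] i by simp
    qed
    moreover have "f j \<in> J" if "j < card J" for j using bij_betwE[OF f] that by blast
    then have "insert (f i) (Jn i) \<subseteq> J" using i by (auto simp: Jn_def)
    ultimately have fi: "f i \<notin> Jn i" "insert (f i) (Jn i) \<subseteq> J" "finite (Jn i)"
      by (auto simp: Jn_def)
    have lt: "((\<lambda>e. l (Some j) (\<lambda>x. P (\<lambda>j. e * s j, x)) / e) \<longlongrightarrow> s j) (at 0)"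
      if "j \<in> insert (f i) (Jn i)" for s j
      by (rule l_tendsto) (rule subsetD[OF fi(2) that])
    obtain k F t where F: "F \<in> forms fscale W (Suc k)"
      "\<And>t. F (\<lambda>x. P (on_coords (Jn i) t, x)) = 0"
      "F (\<lambda>x. P (on_coords (insert (f i) (Jn i)) t, x)) \<noteq> 0"
      by (rule coordinate_separation[where P = P and J = "Jn i" and i = "f i" and l = "\<lambda>j. l (Some j)"
            and ?l0.0 = "l None", OF subspace_W P l l0_tendsto l lt fi(3,1)]) (assumption, rule that)
    have sub: "Z i \<subseteq> Z (Suc i)"
    proof
      fix p assume p: "p \<in> Z i"
      have oo: "on_coords (Jn (Suc i)) (on_coords (Jn i) t) = on_coords (Jn i) t" for t
        unfolding JS by (auto simp: on_coords_def)
      show "p \<in> Z (Suc i)"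
        unfolding Z_def closure_of_image_def
      proof (intro CollectI conjI allI ballI impI)
        show "p \<in> B" using p by (simp add: Z_def closure_of_image_def)
        fix k F x assume F: "F \<in> forms fscale W k"
          "\<forall>t. F (\<lambda>x. P (on_coords (Jn (Suc i)) t, x)) = 0" and x: "x \<in> p"
        have "\<forall>t. F (\<lambda>x. P (on_coords (Jn i) t, x)) = 0" using F(2) oo by metis
        then show "F x = 0" using p F(1) x unfolding Z_def closure_of_image_def by blast
      qed
    qed
    let ?q = "\<lambda>x. P (on_coords (Jn (Suc i)) t, x)"
    have q: "?q \<in> W" by (rule pmaps_fibre[OF subspace_W P])
    have Fq: "F ?q \<noteq> 0" using F(3) unfolding JS .
    have "?q \<noteq> 0"
    proof
      assume "?q = 0"
      then have "F ?q = F (fscale 0 ?q)" by simp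
      also have "\<dots> = 0 ^ Suc k * F ?q"
        by (rule forms_scale[OF vector_space_fscale subspace_W F(1) q])
      finally show False using Fq by simp
    qed
    then have "fsc.span {?q} \<in> Z (Suc i)"
      unfolding Z_def
      by (intro image_in_closure[where \<psi> = "\<lambda>t x. P (on_coords (Jn (Suc i)) t, x)"] q into)
    moreover have "fsc.span {?q} \<notin> Z i"
    proof
      assume "fsc.span {?q} \<in> Z i"
      moreover have "?q \<in> fsc.span {?q}" by (intro fsc.span_base) simp
      ultimately have "F ?q = 0" using F(1,2) unfolding Z_def closure_of_image_def by blast
      then show False using Fq by simp
    qed
    ultimately show ?thesis using sub by blast
  qed
  show ?thesis
    unfolding krull_dim_def
    by (rule Sup_upper) (use irr strict in blast)
qed

section \<open>Expanding forms in monomials\<close>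

lemma span_image_family:
  assumes "finite A" "F \<in> fsc.span (g ` A)"
  shows "\<exists>c. F = (\<lambda>x. \<Sum>a\<in>A. c a * g a x)"
  using assms(2)
proof (induction rule: fsc.span_induct_alt)
  case base
  show ?case by (intro exI[of _ "\<lambda>_. 0"]) (simp add: zero_fun_def)
next
  case (step k f F)
  then obtain b c where b: "b \<in> A" "f = g b" and c: "F = (\<lambda>x. \<Sum>a\<in>A. c a * g a x)" by blast
  have "(\<Sum>a\<in>A. (c a + (if a = b then k else 0)) * g a x) = k * g b x + (\<Sum>a\<in>A. c a * g a x)" for x
  proof -
    have "(\<Sum>a\<in>A. (c a + (if a = b then k else 0)) * g a x) =
        (\<Sum>a\<in>A. c a * g a x) + (\<Sum>a\<in>A. if a = b then k * g a x else 0)"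
      unfolding sum.distrib[symmetric] by (intro sum.cong) (auto simp: algebra_simps)
    then show ?thesis using assms(1) b(1) by simp
  qed
  then show ?case
    by (intro exI[of _ "\<lambda>a. c a + (if a = b then k else 0)"]) (auto simp: b c fscale_apply)
qed

lemma multisets_of_size_add:
  "M \<in> multisets_of_size I k \<Longrightarrow> j \<in> I \<Longrightarrow> add_mset j M \<in> multisets_of_size I (Suc k)"
  by (auto simp: multisets_of_size_def)

text \<open>Each linear factor is rewritten in the family \<open>z\<close>, with which it need agree
  only on \<open>W\<close>; distributing gives monomials. The coefficients need not be
  unique.\<close>

lemma sym_power_expansion:
  assumes I: "finite I" and L: "\<And>a. a \<in> L \<Longrightarrow> \<exists>c. \<forall>x\<in>W. a x = (\<Sum>j\<in>I. c j * z j x)"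
    and F: "F \<in> sym_power W k L"
  obtains c where "\<And>x. x \<in> W \<Longrightarrow> F x = (\<Sum>M\<in>multisets_of_size I k. c M * mmon z M x)"
    "\<And>x. x \<notin> W \<Longrightarrow> F x = 0"
proof -
  let ?g = "\<lambda>M. restr W (mmon z M)"
  have lin: "restr W a \<in> fsc.span ((\<lambda>j. restr W (z j)) ` I)" if a: "a \<in> L" for a
  proof -
    obtain c where c: "\<forall>x\<in>W. a x = (\<Sum>j\<in>I. c j * z j x)" using L[OF a] by blast
    have "(\<Sum>j\<in>I. fscale (c j) (restr W (z j))) \<in> fsc.span ((\<lambda>j. restr W (z j)) ` I)"
      by (intro fsc.span_sum fsc.span_scale fsc.span_base imageI)
    moreover have "restr W a = (\<Sum>j\<in>I. fscale (c j) (restr W (z j)))"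
      using c by (auto simp: restr_def sum_fun_apply fscale_apply)
    ultimately show ?thesis by (simp only:)
  qed
  have gen: "restr W (\<lambda>x. \<Prod>i<k. l i x) \<in> fsc.span (?g ` multisets_of_size I k)"
    if "\<forall>i<k. l i \<in> L" for l and k :: nat
    using that
  proof (induction k)
    case 0
    have "restr W (\<lambda>x. 1) = ?g {#}" by (simp add: one_fun_def)
    then show ?case by (auto intro!: fsc.span_base)
  next
    case (Suc k)
    have "restr W (\<lambda>x. \<Prod>i<k. l i x) * restr W (l k) \<in> fsc.span (?g ` multisets_of_size I (Suc k))"
    proof (rule span_times)
      show "restr W (\<lambda>x. \<Prod>i<k. l i x) \<in> fsc.span (?g ` multisets_of_size I k)"
        using Suc by simp
      show "restr W (l k) \<in> fsc.span ((\<lambda>j. restr W (z j)) ` I)" using Suc.prems lin by simp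
    next
      fix a b assume "a \<in> ?g ` multisets_of_size I k" "b \<in> (\<lambda>j. restr W (z j)) ` I"
      then obtain M j where M: "a = ?g M" "M \<in> multisets_of_size I k" "b = restr W (z j)" "j \<in> I"
        by blast
      have "a * b = ?g (add_mset j M)" by (auto simp: M(1,3) restr_def)
      then show "a * b \<in> fsc.span (?g ` multisets_of_size I (Suc k))"
        using multisets_of_size_add[OF M(2,4)] by (metis fsc.span_base imageI)
    qed
    moreover have "restr W (\<lambda>x. \<Prod>i<k. l i x) * restr W (l k) = restr W (\<lambda>x. \<Prod>i<Suc k. l i x)"
      by (auto simp: restr_def)
    ultimately show ?case by (simp only:)
  qed
  have "F \<in> fsc.span (?g ` multisets_of_size I k)"
    using F unfolding sym_power_def
    by (rule subsetD[OF fsc.span_minimal[OF _ fsc.subspace_span], rotated]) (use gen in blast)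
  then obtain c where c: "F = (\<lambda>x. \<Sum>M\<in>multisets_of_size I k. c M * ?g M x)"
    using span_image_family[OF finite_multisets_of_size[OF I]] by blast
  show thesis by (rule that[of c]) (simp_all add: c restr_def)
qed

lemma sym_power_sum_mmon:
  assumes "\<And>j. j \<in> I \<Longrightarrow> restr W (l j) \<in> L"
  shows "restr W (\<lambda>x. \<Sum>M\<in>multisets_of_size I k. c M * mmon l M x) \<in> sym_power W k L"
proof -
  have "restr W (mmon l M) \<in> sym_power W k L" if "M \<in> multisets_of_size I k" for M
    using sym_power_mmon[of M W l L] assms that by (auto simp: multisets_of_size_def)
  then have "(\<Sum>M\<in>multisets_of_size I k. fscale (c M) (restr W (mmon l M))) \<in> sym_power W k L"
    by (intro fsc.subspace_sum[OF subspace_sym_power] fsc.subspace_scale[OF subspace_sym_power])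
  moreover have "(\<Sum>M\<in>multisets_of_size I k. fscale (c M) (restr W (mmon l M))) =
      restr W (\<lambda>x. \<Sum>M\<in>multisets_of_size I k. c M * mmon l M x)"
    by (auto simp: restr_def sum_fun_apply fscale_apply)
  ultimately show ?thesis by (simp only:)
qed

text \<open>Telescoping: passing from \<open>x\<close> to \<open>p x\<close> in a product changes
  one factor at a time, each by a multiple of \<open>l\<close>. For a projection \<open>p\<close>
  onto the hyperplane \<open>l = 0\<close> this is division by \<open>l\<close> with
  remainder.\<close>

lemma forms_difference:
  fixes s :: "complex \<Rightarrow> 'b::ab_group_add \<Rightarrow> 'b"
  assumes "f \<in> forms s UNIV (Suc k)"
    and p: "\<And>a. a \<in> linear_forms s UNIV \<Longrightarrow> \<exists>c. \<forall>x. a x - a (p x) = c * l x"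
    and l: "l \<in> linear_forms s UNIV"
  shows "\<exists>g\<in>forms s UNIV k. \<forall>x. f x - f (p x) = l x * g x"
proof -
  have gen: "\<exists>g\<in>forms s UNIV k. \<forall>x. (\<Prod>i<Suc k. a i x) - (\<Prod>i<Suc k. a i (p x)) = l x * g x"
    if "\<forall>i<Suc k. a i \<in> linear_forms s UNIV" for a k
    using that
  proof (induction k)
    case 0
    then obtain c where "\<forall>x. a 0 x - a 0 (p x) = c * l x" using p by blast
    moreover have "fscale c (restr UNIV (\<lambda>_. 1)) \<in> forms s UNIV 0"
      by (intro fsc.subspace_scale[OF subspace_forms] forms_one)
    ultimately show ?case
      by (intro bexI[of _ "fscale c (restr UNIV (\<lambda>_. 1))"]) (auto simp: fscale_apply)
  next
    case (Suc k)
    then obtain g where g: "g \<in> forms s UNIV k"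
      "\<And>x. (\<Prod>i<Suc k. a i x) - (\<Prod>i<Suc k. a i (p x)) = l x * g x" by fastforce
    let ?P = "\<lambda>x. \<Prod>i<Suc k. a i x" and ?b = "a (Suc k)"
    have b: "?b \<in> linear_forms s UNIV" using Suc.prems by simp
    obtain c where c: "\<And>x. ?b x - ?b (p x) = c * l x" using p[OF b] by blast
    have P: "?P \<in> forms s UNIV (Suc k)"
      unfolding forms_def sym_power_def using Suc.prems
      by (intro fsc.span_base) (auto intro!: exI[of _ a])
    have bg: "(\<lambda>x. ?b x * g x) \<in> forms s UNIV (Suc k)"
      using forms_mult[OF forms_linear[OF b] g(1)] by simp
    have lg: "(\<lambda>x. l x * g x) \<in> forms s UNIV (Suc k)"
      using forms_mult[OF forms_linear[OF l] g(1)] by simp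
    have "(\<lambda>x. ?b x * g x) + (fscale c ?P + fscale (- c) (\<lambda>x. l x * g x)) \<in> forms s UNIV (Suc k)"
      by (intro fsc.subspace_add[OF subspace_forms] fsc.subspace_scale[OF subspace_forms] P bg lg)
    moreover have "(\<Prod>i<Suc (Suc k). a i x) - (\<Prod>i<Suc (Suc k). a i (p x)) =
        l x * ((\<lambda>x. ?b x * g x) + (fscale c ?P + fscale (- c) (\<lambda>x. l x * g x))) x" for x
    proof -
      have e1: "(\<Prod>i<Suc k. a i (p x)) = ?P x - l x * g x" using g(2)[of x] by (simp add: algebra_simps)
      have e2: "?b (p x) = ?b x - c * l x" using c[of x] by (simp add: algebra_simps)
      have "(\<Prod>i<Suc (Suc k). a i x) - (\<Prod>i<Suc (Suc k). a i (p x)) =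
          ?P x * ?b x - (?P x - l x * g x) * (?b x - c * l x)"
        by (simp only: prod.lessThan_Suc[of _ "Suc k"] e1 e2)
      then show ?thesis by (simp add: fscale_apply algebra_simps)
    qed
    ultimately show ?case by blast
  qed
  show ?thesis
    using assms(1) unfolding forms_def[of s UNIV "Suc k"] sym_power_def
  proof (induction rule: fsc.span_induct_alt)
    case base
    show ?case by (intro bexI[of _ 0] fsc.subspace_0 subspace_forms) auto
  next
    case (step c a f)
    then obtain g where g: "g \<in> forms s UNIV k" "\<And>x. f x - f (p x) = l x * g x" by blast
    obtain b where b: "a = restr UNIV (\<lambda>x. \<Prod>i<Suc k. b i x)" "\<forall>i<Suc k. b i \<in> linear_forms s UNIV"
      using step(1) by blast
    obtain h where h: "h \<in> forms s UNIV k" "\<And>x. a x - a (p x) = l x * h x"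
      using gen[OF b(2)] unfolding b(1) restr_UNIV by blast
    have "(fscale c a + f) x - (fscale c a + f) (p x) = l x * (fscale c h + g) x" for x
    proof -
      have "(fscale c a + f) x - (fscale c a + f) (p x) = c * (a x - a (p x)) + (f x - f (p x))"
        by (simp add: fscale_apply algebra_simps)
      then show ?thesis unfolding h(2) g(2) by (simp add: fscale_apply algebra_simps)
    qed
    moreover have "fscale c h + g \<in> forms s UNIV k"
      using h(1) g(1) by (intro fsc.subspace_add[OF subspace_forms] fsc.subspace_scale[OF subspace_forms])
    ultimately show ?case by blast
  qed
qed

section \<open>The parametrization of the involutive cone incidence\<close>

text \<open>Coordinates \<open>(v, q, h, g)\<close> of a point of the incidence: the vector \<open>v\<close> spanning the polar
  point, the cone \<open>q\<close>, the residual factor \<open>h\<close> on the hyperplane, and the quotient \<open>g\<close> by the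
  equation of the hyperplane, the last three by their coefficients.\<close>

datatype 'v param =
  VecC 'v | ConeC "'v multiset" | RestC "'v multiset" | QuotC "'v multiset"

locale symplectic_basis = vector_space scale
  for scale :: "complex \<Rightarrow> 'v::ab_group_add \<Rightarrow> 'v" +
  fixes \<omega> :: "'v \<Rightarrow> 'v \<Rightarrow> complex" and B :: "'v set" and n d m :: nat
  assumes symplectic: "symplectic_form scale \<omega>"
    and B: "independent B" "span B = UNIV" "finite B" "card B = 2 * n"
    and n: "2 \<le> n" and m: "2 \<le> m" and md: "m \<le> d"
begin

section \<open>Coordinates on the symplectic space and duality by the form\<close>

definition X :: "'v \<Rightarrow> 'v \<Rightarrow> complex" where
  "X b v = representation B v b"

definition vec :: "('v \<Rightarrow> complex) \<Rightarrow> 'v" where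
  "vec c = (\<Sum>b\<in>B. scale (c b) b)"

lemma X_add: "X b (u + v) = X b u + X b v"
  and X_scale: "X b (scale c v) = c * X b v"
  using B(1,2) by (simp_all add: X_def representation_add representation_scale)

lemma X_linear: "X b \<in> linear_forms scale UNIV"
  by (simp add: linear_forms_def X_add X_scale)

lemma X_basis: "b' \<in> B \<Longrightarrow> X b b' = (if b = b' then 1 else 0)"
  using B(1) by (simp add: X_def representation_basis)

lemma vec_X: "vec (\<lambda>b. X b v) = v"
  unfolding vec_def X_def using B by (intro sum_representation_eq) auto

lemma linear_forms_vec:
  assumes "l \<in> linear_forms scale UNIV"
  shows "l (vec c) = (\<Sum>b\<in>B. c b * l b)"
proof -
  have 0: "l 0 = 0" using assms unfolding linear_forms_def mem_Collect_eq
    by (metis UNIV_I add.right_neutral add_cancel_right_right)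
  have "l (\<Sum>b\<in>B'. scale (c b) b) = (\<Sum>b\<in>B'. c b * l b)" if "finite B'" for B'
    using that assms by (induction B') (simp_all add: 0 linear_forms_def)
  then show ?thesis using B(3) by (simp add: vec_def)
qed

lemma linear_forms_expand:
  assumes "l \<in> linear_forms scale UNIV"
  shows "l v = (\<Sum>b\<in>B. X b v * l b)"
  using linear_forms_vec[OF assms, of "\<lambda>b. X b v"] by (simp add: vec_X)

lemma X_vec: "b \<in> B \<Longrightarrow> X b (vec c) = c b"
  using B(3) by (simp add: linear_forms_vec[OF X_linear] X_basis if_distrib[of "\<lambda>x. _ * x"] cong: if_cong)

lemma omega_linear_right: "\<omega> v \<in> linear_forms scale UNIV"
  and omega_linear_left: "(\<lambda>v. \<omega> v u) \<in> linear_forms scale UNIV"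
  using symplectic by (auto simp: symplectic_form_def linear_forms_def Vector_Spaces.linear_iff)

lemma omega_alt: "\<omega> v v = 0"
  using symplectic by (simp add: symplectic_form_def)

lemma omega_antisym: "\<omega> u v = - \<omega> v u"
proof -
  have r: "\<omega> w (a + b) = \<omega> w a + \<omega> w b" for w a b
    using omega_linear_right[of w] by (simp add: linear_forms_def)
  have l: "\<omega> (a + b) w = \<omega> a w + \<omega> b w" for w a b
    using omega_linear_left[of w] by (simp add: linear_forms_def)
  have "\<omega> (u + v) (u + v) = \<omega> u v + \<omega> v u"
    by (simp only: r l omega_alt[of u] omega_alt[of v]) simp
  then show ?thesis using omega_alt[of "u + v"] by (simp add: eq_neg_iff_add_eq_0)
qed

lemma omega_vec_left: "\<omega> (vec c) u = (\<Sum>b\<in>B. c b * \<omega> b u)"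
  using linear_forms_vec[OF omega_linear_left] .

lemma omega_expand: "\<omega> v u = (\<Sum>b\<in>B. X b u * \<omega> v b)"
  by (rule linear_forms_expand[OF omega_linear_right])

lemma omega_scale_left: "\<omega> (scale c v) u = c * \<omega> v u"
  using omega_linear_left[of u] by (simp add: linear_forms_def)

lemma omega_zeroI: "(\<And>b. b \<in> B \<Longrightarrow> \<omega> v b = 0) \<Longrightarrow> v = 0"
proof -
  assume z: "\<And>b. b \<in> B \<Longrightarrow> \<omega> v b = 0"
  have "\<omega> v u = 0" for u by (subst omega_expand) (simp add: z)
  then show "v = 0" using symplectic by (simp add: symplectic_form_def)
qed

lemma vec_eq_0: "vec c = 0 \<Longrightarrow> b \<in> B \<Longrightarrow> c b = 0"
  using X_vec[of b c] X_scale[of b 0 0] by simp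

text \<open>By counting, \<open>l\<close> and the forms \<open>\<omega> b\<close> with
  \<open>b\<close> in \<open>B\<close> are dependent, as all lie in the span of the coordinates.
  Nondegeneracy and the independence of \<open>B\<close> force a nonzero coefficient at
  \<open>l\<close>, so the relation can be solved for \<open>l\<close>.\<close>

lemma omega_dual:
  assumes l: "l \<in> linear_forms scale UNIV"
  obtains v where "\<And>u. l u = \<omega> v u"
proof -
  let ?g = "\<lambda>k. case k of None \<Rightarrow> l | Some b \<Rightarrow> \<omega> b"
  let ?I = "insert None (Some ` B)"
  have sp: "a \<in> fsc.span (X ` B)" if a: "a \<in> linear_forms scale UNIV" for a
  proof -
    have "(\<Sum>b\<in>B. fscale (a b) (X b)) \<in> fsc.span (X ` B)"
      by (intro fsc.span_sum fsc.span_scale fsc.span_base imageI)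
    moreover have "a = (\<Sum>b\<in>B. fscale (a b) (X b))"
    proof
      fix v
      show "a v = (\<Sum>b\<in>B. fscale (a b) (X b)) v"
        by (subst linear_forms_expand[OF a]) (simp add: sum_fun_apply fscale_apply mult.commute)
    qed
    ultimately show ?thesis by (simp only:)
  qed
  have "\<exists>c. (\<exists>k\<in>?I. c k \<noteq> 0) \<and> (\<forall>x. (\<Sum>k\<in>?I. c k * ?g k x) = 0)"
  proof (rule family_dependent)
    show "finite ?I" "finite (X ` B)" using B(3) by auto
    have "card ?I = Suc (card B)" using B(3) by (subst card_insert_disjoint) (auto simp: card_image)
    then show "card (X ` B) < card ?I" using card_image_le[OF B(3), of X] by simp
    show "?g k \<in> fsc.span (X ` B)" if "k \<in> ?I" for k
      using that sp[OF l] sp[OF omega_linear_right] by (cases k) auto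
  qed
  then obtain c where c: "\<exists>k\<in>?I. c k \<noteq> 0" "\<And>x. (\<Sum>k\<in>?I. c k * ?g k x) = 0"
    by (elim exE conjE) (rule that, assumption, erule spec)
  let ?w = "vec (\<lambda>b. c (Some b))"
  have eq: "c None * l x + \<omega> ?w x = 0" for x
  proof -
    have "(\<Sum>k\<in>?I. c k * ?g k x) = c None * l x + (\<Sum>b\<in>B. c (Some b) * \<omega> b x)"
      using B(3) by (simp add: sum.reindex)
    then show ?thesis using c(2)[of x] by (simp only: omega_vec_left)
  qed
  have nz: "c None \<noteq> 0"
  proof
    assume "c None = 0"
    then have "?w = 0" using eq by (intro omega_zeroI) simp
    then have "c (Some b) = 0" if "b \<in> B" for b using vec_eq_0 that by blast
    then show False using c(1) \<open>c None = 0\<close> by auto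
  qed
  have "\<omega> (scale (- 1 / c None) ?w) x = (- 1 / c None) * \<omega> ?w x" for x
    by (rule omega_scale_left)
  moreover have "\<omega> ?w x = - (c None * l x)" for x
    using eq[of x] by (simp add: add_eq_0_iff)
  ultimately have "\<omega> (scale (- 1 / c None) ?w) x = l x" for x
    using nz by (simp only:) simp
  then show thesis using that by metis
qed

text \<open>In the chart \<open>v\<^sub>k = 1\<close>, \<open>\<omega>(v, e\<^sub>i) \<noteq> 0\<close>, the linear forms \<open>y\<^sub>j = x\<^sub>j - v\<^sub>j x\<^sub>k\<close> with
  \<open>j \<noteq> i, k\<close> are a basis of the forms on the hyperplane that vanish at \<open>v\<close>.\<close>

definition y :: "'v \<Rightarrow> ('v param \<Rightarrow> complex) \<Rightarrow> 'v \<Rightarrow> 'v \<Rightarrow> complex" where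
  "y k t j x = X j x - t (VecC j) * X k x"

abbreviation "lvec t \<equiv> vec (\<lambda>b. t (VecC b))"

definition quot_form :: "('v param \<Rightarrow> complex) \<Rightarrow> 'v \<Rightarrow> complex" where
  "quot_form t x = (\<Sum>M\<in>multisets_of_size B (d - 1). t (QuotC M) * mmon X M x)"

definition cone_form :: "'v \<Rightarrow> 'v \<Rightarrow> ('v param \<Rightarrow> complex) \<Rightarrow> 'v \<Rightarrow> complex" where
  "cone_form k i t x = (\<Sum>M\<in>multisets_of_size (B - {i, k}) m. t (ConeC M) * mmon (y k t) M x)"

text \<open>The coordinate at \<open>i\<close> is omitted: where \<open>\<omega> v i\<close> is
  nonzero, it is a combination of the other coordinates on the hyperplane.\<close>

definition rest_form :: "'v \<Rightarrow> ('v param \<Rightarrow> complex) \<Rightarrow> 'v \<Rightarrow> complex" where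
  "rest_form i t x = (\<Sum>M\<in>multisets_of_size (B - {i}) (d - m). t (RestC M) * mmon X M x)"

definition Phi :: "'v \<Rightarrow> 'v \<Rightarrow> ('v param \<Rightarrow> complex) \<Rightarrow> 'v \<Rightarrow> complex" where
  "Phi k i t x = \<omega> (lvec t) x * quot_form t x + cone_form k i t x * rest_form i t x"

definition params :: "'v \<Rightarrow> 'v \<Rightarrow> 'v param set" where
  "params k i = VecC ` B \<union> ConeC ` multisets_of_size (B - {i, k}) m \<union>
     RestC ` multisets_of_size (B - {i}) (d - m) \<union> QuotC ` multisets_of_size B (d - 1)"

lemma finite_params: "finite (params k i)"
  using B(3) by (auto simp: params_def)

lemma sum_params:
  fixes f :: "'v param \<Rightarrow> 'b::comm_monoid_add"
  shows "(\<Sum>j\<in>params k i. f j) = (\<Sum>b\<in>B. f (VecC b)) + (\<Sum>M\<in>multisets_of_size (B - {i, k}) m. f (ConeC M)) +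
     (\<Sum>M\<in>multisets_of_size (B - {i}) (d - m). f (RestC M)) + (\<Sum>M\<in>multisets_of_size B (d - 1). f (QuotC M))"
proof -
  have "finite (VecC ` B)" "finite (ConeC ` multisets_of_size (B - {i, k}) m)"
    "finite (RestC ` multisets_of_size (B - {i}) (d - m))" "finite (QuotC ` multisets_of_size B (d - 1))"
    using B(3) by auto
  moreover have "VecC ` P \<inter> ConeC ` Q = {}" "(VecC ` P \<union> ConeC ` Q) \<inter> RestC ` R = {}"
    "(VecC ` P \<union> ConeC ` Q \<union> RestC ` R) \<inter> QuotC ` S = {}" for P :: "'v set" and Q R S
    by auto
  moreover have "sum f (VecC ` P) = (\<Sum>b\<in>P. f (VecC b))" "sum f (ConeC ` Q) = (\<Sum>M\<in>Q. f (ConeC M))"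
    "sum f (RestC ` Q) = (\<Sum>M\<in>Q. f (RestC M))" "sum f (QuotC ` Q) = (\<Sum>M\<in>Q. f (QuotC M))"
    for P :: "'v set" and Q
    by (simp_all add: sum.reindex inj_on_def)
  ultimately show ?thesis unfolding params_def by (simp only: sum.union_disjoint finite_UnI)
qed

definition expected_dim :: nat where
  "expected_dim = ((d + 2 * n - 2) choose (2 * n - 1)) + ((d - m + 2 * n - 2) choose (2 * n - 2))
     + ((m + 2 * n - 3) choose m) + 2 * n - 3"

text \<open>There are \<open>r + k - 1\<close> choose \<open>k\<close> monomials of degree
  \<open>k\<close> in \<open>r\<close> variables, with \<open>r = 2n - 2\<close> for the cone,
  \<open>2n - 1\<close> for the residual factor and \<open>2n\<close> for the quotient;
  \<open>v\<close> adds \<open>2n\<close> coordinates. The excess 3 accounts for the three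
  scalings.\<close>

lemma card_params:
  assumes "k \<in> B" "i \<in> B" "i \<noteq> k"
  shows "card (params k i) = expected_dim + 3"
proof -
  have "card (B - {i, k}) = 2 * n - 2"
    using assms B(3,4) by (simp add: card_Diff_subset)
  moreover have "2 * n - 2 + m - 1 = m + 2 * n - 3" using n by simp
  ultimately have C: "card (multisets_of_size (B - {i, k}) m) = (m + 2 * n - 3) choose m"
    using card_multisets_of_size[of "B - {i, k}" m] B(3) by (simp only: finite_Diff)
  have "card (B - {i}) = 2 * n - 1" using assms(2) B(3,4) by simp
  moreover have "2 * n - 1 + (d - m) - 1 = d - m + 2 * n - 2"
    "d - m + 2 * n - 2 - (d - m) = 2 * n - 2" "d - m \<le> d - m + 2 * n - 2"
    using n by simp_all
  ultimately have R: "card (multisets_of_size (B - {i}) (d - m)) = (d - m + 2 * n - 2) choose (2 * n - 2)"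
    using card_multisets_of_size[of "B - {i}" "d - m"] B(3)
      binomial_symmetric[of "d - m" "d - m + 2 * n - 2"] by (simp only: finite_Diff)
  have "2 * n + (d - 1) - 1 = d + 2 * n - 2" "d + 2 * n - 2 - (d - 1) = 2 * n - 1"
    "d - 1 \<le> d + 2 * n - 2"
    using n m md by simp_all
  then have Q: "card (multisets_of_size B (d - 1)) = (d + 2 * n - 2) choose (2 * n - 1)"
    using card_multisets_of_size[OF B(3), of "d - 1"] B(4)
      binomial_symmetric[of "d - 1" "d + 2 * n - 2"] by (simp only:)
  have "card (params k i) = card B + card (multisets_of_size (B - {i, k}) m) +
     card (multisets_of_size (B - {i}) (d - m)) + card (multisets_of_size B (d - 1))"
    unfolding card_eq_sum by (rule sum_params)
  also have "\<dots> = 2 * n + ((m + 2 * n - 3) choose m) + ((d - m + 2 * n - 2) choose (2 * n - 2)) +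
      ((d + 2 * n - 2) choose (2 * n - 1))"
    by (simp only: C R Q B(4))
  finally show ?thesis using n by (simp add: expected_dim_def)
qed

section \<open>Polynomiality of the charts\<close>

abbreviation "W k \<equiv> forms scale UNIV k"

lemma mmon_X_form: "mmon X M \<in> W (size M)"
  using forms_mmon[of M X scale UNIV] X_linear by simp

lemma mmon_X_form': "M \<in> multisets_of_size I k \<Longrightarrow> mmon X M \<in> W k"
  using mmon_X_form by (auto simp: multisets_of_size_def)

lemma W_mult: "f \<in> W j \<Longrightarrow> g \<in> W k \<Longrightarrow> f * g \<in> W (j + k)"
  unfolding times_fun_def by (rule forms_mult)

lemma pmaps_param_sum:
  assumes "\<And>a. a \<in> A \<Longrightarrow> q a \<in> J" "\<And>a. a \<in> A \<Longrightarrow> f a \<in> Y"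
  shows "(\<lambda>(t, x). \<Sum>a\<in>A. t (q a) * f a x) \<in> pmaps J 1 Y"
proof -
  have "(\<Sum>a\<in>A. (\<lambda>(t, x). t (q a) * f a x)) \<in> pmaps J 1 Y"
    using assms by (intro pmaps_sum pmaps_base polys_var) auto
  moreover have "(\<Sum>a\<in>A. (\<lambda>(t, x). t (q a) * f a x)) = (\<lambda>(t, x). \<Sum>a\<in>A. t (q a) * f a x)"
    by (auto simp: sum_fun_apply)
  ultimately show ?thesis by (simp only:)
qed

lemma pmaps_y:
  assumes "j \<in> B"
  shows "(\<lambda>(t, x). y k t j x) \<in> pmaps (params k' i) 1 (W 1)"
proof -
  have J: "VecC j \<in> params k' i" using assms by (simp add: params_def)
  have "(\<lambda>(t, x). 1 * X j x) + (\<lambda>(t, x). fscale (- 1) (\<lambda>t. t (VecC j)) t * X k x)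
      \<in> pmaps (params k' i) 1 (W 1)"
    using polys_var[OF J] polys_const[of 1]
    by (intro pmaps_add pmaps_base polys_scale forms_linear[OF X_linear]) auto
  moreover have "(\<lambda>(t, x). 1 * X j x) + (\<lambda>(t, x). fscale (- 1) (\<lambda>t. t (VecC j)) t * X k x) =
      (\<lambda>(t, x). y k t j x)"
    by (auto simp: y_def fscale_apply)
  ultimately show ?thesis by (simp only:)
qed

lemma pmaps_mmon_y:
  assumes "set_mset M \<subseteq> B"
  shows "(\<lambda>(t, x). mmon (y k t) M x) \<in> pmaps (params k' i) (size M) (W (size M))"
  using assms
proof (induction M)
  case empty
  have "(\<lambda>(t :: 'v param \<Rightarrow> complex, x). 1 * restr UNIV (\<lambda>_. 1) x) \<in> pmaps (params k' i) 0 (W 0)"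
    by (intro pmaps_base polys_const forms_one)
  moreover have "(\<lambda>(t :: 'v param \<Rightarrow> complex, x). 1 * restr UNIV (\<lambda>_. 1) x) =
      (\<lambda>(t, x). mmon (y k t) {#} x)" by auto
  ultimately show ?case by (simp only: size_empty)
next
  case (add j M)
  have "(\<lambda>(t, x). y k t j x) * (\<lambda>(t, x). mmon (y k t) M x)
      \<in> pmaps (params k' i) (1 + size M) (W (1 + size M))"
    using add by (intro pmaps_mult[where W = "W 1" and X = "W (size M)"] pmaps_y W_mult) auto
  moreover have "(\<lambda>(t, x). y k t j x) * (\<lambda>(t, x). mmon (y k t) M x) =
      (\<lambda>(t, x). mmon (y k t) (add_mset j M) x)"
    by auto
  ultimately show ?case by (simp only: size_add_mset plus_1_eq_Suc)
qed

lemma pmaps_cone: "(\<lambda>(t, x). cone_form k i t x) \<in> pmaps (params k i) (1 + m) (W m)"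
proof -
  have "(\<lambda>(t, x). t (ConeC M) * restr UNIV (\<lambda>_. 1) x) * (\<lambda>(t, x). mmon (y k t) M x)
      \<in> pmaps (params k i) (1 + m) (W (0 + m))"
    if M: "M \<in> multisets_of_size (B - {i, k}) m" for M
  proof (rule pmaps_mult[where W = "W 0" and X = "W m"])
    have "ConeC M \<in> params k i" using M by (simp add: params_def)
    then show "(\<lambda>(t, x). t (ConeC M) * restr UNIV (\<lambda>_. 1) x) \<in> pmaps (params k i) 1 (W 0)"
      by (intro pmaps_base polys_var forms_one) auto
    have "set_mset M \<subseteq> B" "size M = m" using M by (auto simp: multisets_of_size_def)
    then show "(\<lambda>(t, x). mmon (y k t) M x) \<in> pmaps (params k i) m (W m)"
      using pmaps_mmon_y by blast
  qed (rule W_mult)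
  then have "(\<Sum>M\<in>multisets_of_size (B - {i, k}) m.
      (\<lambda>(t, x). t (ConeC M) * restr UNIV (\<lambda>_. 1) x) * (\<lambda>(t, x). mmon (y k t) M x))
      \<in> pmaps (params k i) (1 + m) (W (0 + m))"
    by (rule pmaps_sum)
  moreover have "(\<Sum>M\<in>multisets_of_size (B - {i, k}) m.
      (\<lambda>(t, x). t (ConeC M) * restr UNIV (\<lambda>_. 1) x) * (\<lambda>(t, x). mmon (y k t) M x)) =
      (\<lambda>(t, x). cone_form k i t x)"
    by (auto simp: sum_fun_apply cone_form_def)
  ultimately show ?thesis by (simp only: add_0)
qed

text \<open>The degree comes from the product of cone and residual factor: 1 for a coefficient of
  each, and \<open>m\<close> for the coordinates of \<open>v\<close> inside the \<open>y\<close>.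
  The other product has degree 2 only.\<close>

lemma pmaps_Phi: "(\<lambda>(t, x). Phi k i t x) \<in> pmaps (params k i) (m + 2) (W d)"
proof -
  let ?J = "params k i"
  have L: "(\<lambda>(t, x). \<omega> (lvec t) x) \<in> pmaps ?J 1 (W 1)"
    unfolding omega_vec_left
    by (rule pmaps_param_sum) (simp add: params_def, rule forms_linear[OF omega_linear_right])
  have Q: "(\<lambda>(t, x). quot_form t x) \<in> pmaps ?J 1 (W (d - 1))"
    unfolding quot_form_def by (rule pmaps_param_sum) (auto simp: params_def intro: mmon_X_form')
  have R: "(\<lambda>(t, x). rest_form i t x) \<in> pmaps ?J 1 (W (d - m))"
    unfolding rest_form_def by (rule pmaps_param_sum) (auto simp: params_def intro: mmon_X_form')
  have "(\<lambda>(t, x). \<omega> (lvec t) x) * (\<lambda>(t, x). quot_form t x) \<in> pmaps ?J (1 + 1) (W (1 + (d - 1)))"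
    by (rule pmaps_mult[OF L Q W_mult])
  then have 1: "(\<lambda>(t, x). \<omega> (lvec t) x) * (\<lambda>(t, x). quot_form t x) \<in> pmaps ?J (m + 2) (W d)"
    using pmaps_mono[of "1 + 1" "m + 2" ?J "W d"] m md by auto
  have "(\<lambda>(t, x). cone_form k i t x) * (\<lambda>(t, x). rest_form i t x) \<in> pmaps ?J (1 + m + 1) (W (m + (d - m)))"
    by (rule pmaps_mult[OF pmaps_cone R W_mult])
  then have 2: "(\<lambda>(t, x). cone_form k i t x) * (\<lambda>(t, x). rest_form i t x) \<in> pmaps ?J (m + 2) (W d)"
    using md by simp
  have "(\<lambda>(t, x). Phi k i t x) = (\<lambda>(t, x). \<omega> (lvec t) x) * (\<lambda>(t, x). quot_form t x) +
      (\<lambda>(t, x). cone_form k i t x) * (\<lambda>(t, x). rest_form i t x)"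
    by (auto simp: Phi_def)
  then show ?thesis using pmaps_add[OF 1 2] by (simp only:)
qed

lemma Phi_form: "Phi k i t \<in> W d"
  using pmaps_fibre[OF subspace_forms pmaps_Phi, of k i t] by simp

section \<open>The charts map into the image of the incidence and cover it\<close>

lemma proj_B_locus: "B_locus scale \<omega> d m \<subseteq> proj fscale (W d)"
  by (auto simp: B_locus_def rho_def cone_incidence_def proj_def F_fibre_def)

lemma projective_B_locus: "projective_subset fscale (W d) (B_locus scale \<omega> d m)"
  by (intro projective_subset.intro projective_subset_axioms.intro vector_space_fscale
      subspace_forms proj_B_locus)

text \<open>Moving along \<open>i\<close> corrects the value of \<open>\<omega> v\<close> and
  changes no other coordinate.\<close>

lemma hyperplane_point:
  assumes i: "i \<in> B" and vi: "\<omega> v i \<noteq> 0"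
  obtains u where "\<omega> v u = 0" "\<And>b. b \<in> B - {i} \<Longrightarrow> X b u = z b"
proof -
  let ?u = "vec z"
  let ?w = "?u + scale (- \<omega> v ?u / \<omega> v i) i"
  have "\<omega> v ?w = \<omega> v ?u + (- \<omega> v ?u / \<omega> v i) * \<omega> v i"
    using omega_linear_right[of v] by (simp add: linear_forms_def del: scale_minus_left)
  then have "\<omega> v ?w = 0" using vi by simp
  moreover have "X b ?w = z b" if "b \<in> B - {i}" for b
    using that i by (simp add: X_add X_scale X_basis X_vec del: scale_minus_left)
  ultimately show thesis by (rule that)
qed

text \<open>The conditions on \<open>t\<close> describe an affine chart: the coordinate 1 at
  \<open>k\<close> makes the \<open>y\<close> vanish at the polar point, and the nonzero cone
  coefficient makes \<open>q\<close> nonzero on the hyperplane.\<close>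

lemma Phi_in_B_locus:
  assumes k: "k \<in> B" "t (VecC k) = 1" and i: "i \<in> B" "i \<noteq> k" "\<omega> (lvec t) i \<noteq> 0"
    and M: "M \<in> multisets_of_size (B - {i, k}) m" "t (ConeC M) \<noteq> 0"
    and nz: "Phi k i t \<noteq> 0"
  shows "fsc.span {Phi k i t} \<in> B_locus scale \<omega> d m"
proof -
  define v where "v = lvec t"
  define H where "H = {u. \<omega> v u = 0}"
  have Xv: "X b v = t (VecC b)" if "b \<in> B" for b unfolding v_def using X_vec[OF that] .
  have om0: "\<omega> v \<noteq> 0" using i(3) by (auto simp: v_def)
  have H: "H \<in> hyperplanes scale"
    unfolding hyperplanes_def H_def using omega_linear_right om0 by blast
  have polar: "polar_point scale \<omega> H = span {v}"
    unfolding H_def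
    by (rule polar_point_eq[OF vector_space_axioms symplectic omega_linear_right om0]) simp
  have subH: "subspace H"
    unfolding H_def subspace_def using omega_linear_right[of v] omega_linear_right[of v]
      linear_forms_expand[OF omega_linear_right, of v 0] X_scale[of _ 0 0]
    by (auto simp: linear_forms_def)
  have vH: "v \<in> H" by (simp add: H_def omega_alt)
  have lin: "restr H a \<in> linear_forms scale H" if "a \<in> linear_forms scale UNIV" for a
    using that subH by (auto simp: linear_forms_def restr_def subspace_add subspace_scale)
  have y_lin: "y k t j \<in> linear_forms scale UNIV" for j
    by (simp add: y_def linear_forms_def X_add X_scale algebra_simps)
  have yG: "restr H (y k t j) \<in> G_fibre scale \<omega> H" if "j \<in> B - {i, k}" for j
  proof -
    have "y k t j (scale c v) = 0" for c
      using that k by (simp add: y_def X_scale Xv)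
    then show ?thesis
      using lin[OF y_lin[of j]] by (auto simp: G_fibre_def polar span_singleton restr_def)
  qed
  define q where "q = restr H (cone_form k i t)"
  have q: "q \<in> sym_power H m (G_fibre scale \<omega> H)"
    unfolding q_def cone_form_def[abs_def] by (rule sym_power_sum_mmon) (rule yG)
  have "q \<noteq> 0"
  proof
    assume q0: "q = 0"
    have "(\<Sum>M\<in>multisets_of_size (B - {i, k}) m. t (ConeC M) * mmon (\<lambda>j z. z j) M z) = 0" for z
    proof -
      \<comment> \<open>At points whose coordinate at \<open>k\<close> is 0, each \<open>y\<close>
        equals the coordinate it starts from, and the coordinates other than that at
        \<open>i\<close> are free on the hyperplane.\<close>
      obtain u where u: "\<omega> v u = 0" "\<And>b. b \<in> B - {i} \<Longrightarrow> X b u = (z(k := 0)) b"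
        using hyperplane_point[OF i(1), of v "z(k := 0)"] i(3) by (auto simp: v_def)
      have "mmon (y k t) M u = mmon (\<lambda>j z. z j) M z"
        if "M \<in> multisets_of_size (B - {i, k}) m" for M
      proof (rule mmon_cong)
        fix j assume "j \<in># M"
        then have "j \<in> B - {i, k}" using that by (auto simp: multisets_of_size_def)
        then show "y k t j u = z j" using u(2) k(1) i(2) by (auto simp: y_def)
      qed
      then have "cone_form k i t u = (\<Sum>M\<in>multisets_of_size (B - {i, k}) m. t (ConeC M) * mmon (\<lambda>j z. z j) M z)"
        by (simp add: cone_form_def)
      moreover have "cone_form k i t u = 0"
        using fun_cong[OF q0, of u] u(1) by (simp add: q_def restr_def H_def)
      ultimately show ?thesis by simp
    qed
    then have "t (ConeC M) = 0"
      by (rule mmon_coeff_zero[rotated 1, where c = "\<lambda>M. t (ConeC M)"]) (use M B(3) in auto)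
    then show False using M(2) by simp
  qed
  define h where "h = restr H (rest_form i t)"
  have h: "h \<in> forms scale H (d - m)"
    unfolding h_def rest_form_def[abs_def] forms_def by (rule sym_power_sum_mmon) (rule lin[OF X_linear])
  have "restr H (Phi k i t) = (\<lambda>x. q x * h x)"
    by (auto simp: restr_def q_def h_def Phi_def H_def v_def)
  moreover have "q \<in> fsc.span {q}" by (simp add: fsc.span_base)
  ultimately have F: "Phi k i t \<in> F_fibre scale d m H (fsc.span {q})"
    using h Phi_form unfolding F_fibre_def by blast
  have "((H, fsc.span {q}), fsc.span {Phi k i t}) \<in> cone_incidence scale \<omega> d m"
    using H q \<open>q \<noteq> 0\<close> F nz by (auto simp: cone_incidence_def Y_space_def proj_def)
  then show ?thesis unfolding B_locus_def rho_def by force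
qed

text \<open>Composing with the projection \<open>p\<close> along \<open>i\<close> extends
  \<open>a\<close> to a linear form on the whole space that is zero at \<open>i\<close>, so its
  expansion has no term in the coordinate at \<open>i\<close>.\<close>

lemma linear_form_on_hyperplane:
  assumes a: "a \<in> linear_forms scale {u. \<omega> v u = 0}" and i: "i \<in> B" "\<omega> v i \<noteq> 0"
  shows "\<exists>c. \<forall>x\<in>{u. \<omega> v u = 0}. a x = (\<Sum>j\<in>B - {i}. c j * X j x)"
proof -
  define r where "r x = - \<omega> v x / \<omega> v i" for x
  define p where "p x = x + scale (r x) i" for x
  have om: "\<omega> v (x + z) = \<omega> v x + \<omega> v z" "\<omega> v (scale c x) = c * \<omega> v x" for x z c
    using omega_linear_right[of v] by (simp_all add: linear_forms_def)
  have p0: "\<omega> v (p x) = 0" for x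
    using i by (simp add: p_def om r_def del: scale_minus_left)
  have r: "r (x + z) = r x + r z" "r (scale c x) = c * r x" for x z c
    by (simp_all add: r_def om add_divide_distrib diff_divide_distrib)
  have al: "a (x + z) = a x + a z" "a (scale c x) = c * a x" if "\<omega> v x = 0" "\<omega> v z = 0" for x z c
    using a that by (simp_all add: linear_forms_def)
  have "(\<lambda>x. a (p x)) \<in> linear_forms scale UNIV"
    unfolding linear_forms_def
  proof (intro CollectI conjI ballI allI impI)
    fix x z c
    have "p (x + z) = p x + p z" by (simp add: p_def r scale_left_distrib add_ac)
    then show "a (p (x + z)) = a (p x) + a (p z)" by (simp only: al(1)[OF p0 p0])
    have "p (scale c x) = scale c (p x)" by (simp add: p_def r scale_right_distrib)
    then show "a (p (scale c x)) = c * a (p x)" by (simp only: al(2)[OF p0 p0])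
  qed simp
  from linear_forms_expand[OF this] have e: "a (p x) = (\<Sum>b\<in>B. X b x * a (p b))" for x .
  have "r i = - 1" using i by (simp add: r_def)
  then have pi: "p i = 0" by (simp add: p_def)
  have "\<omega> v 0 = 0" using om(2)[of 0 0] by simp
  then have "a 0 = 0" using al(2)[of 0 0 0] by simp
  then have api: "a (p i) = 0" unfolding pi .
  have "a x = (\<Sum>j\<in>B - {i}. a (p j) * X j x)" if x: "\<omega> v x = 0" for x
  proof -
    have "p x = x" using x by (simp add: p_def r_def)
    then have "a x = (\<Sum>b\<in>B. X b x * a (p b))" using e[of x] by simp
    also have "\<dots> = (\<Sum>b\<in>B - {i}. X b x * a (p b))"
      using api B(3) by (intro sum.mono_neutral_right) auto
    finally show ?thesis by (simp add: mult.commute)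
  qed
  then show ?thesis by (intro exI[of _ "\<lambda>j. a (p j)"]) auto
qed

text \<open>The projection along \<open>i\<close> onto the hyperplane moves every linear form by a
  multiple of \<open>\<omega> v\<close>, and \<open>f\<close> vanishes at the projected
  points.\<close>

lemma form_vanishing_on_hyperplane:
  assumes f: "f \<in> W (Suc k)" and v: "\<And>x. \<omega> v x = 0 \<Longrightarrow> f x = 0" and i: "\<omega> v i \<noteq> 0"
  shows "\<exists>g\<in>W k. \<forall>x. f x = \<omega> v x * g x"
proof -
  let ?p = "\<lambda>x. x + scale (- \<omega> v x / \<omega> v i) i"
  have p: "a (?p x) = a x + (- \<omega> v x / \<omega> v i) * a i" if "a \<in> linear_forms scale UNIV" for a x
    using that by (simp add: linear_forms_def del: scale_minus_left)
  have "\<exists>g\<in>W k. \<forall>x. f x - f (?p x) = \<omega> v x * g x"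
  proof (rule forms_difference[OF f _ omega_linear_right])
    fix a assume a: "a \<in> linear_forms scale UNIV"
    have "a x - a (?p x) = a i / \<omega> v i * \<omega> v x" for x unfolding p[OF a] by simp
    then show "\<exists>c. \<forall>x. a x - a (?p x) = c * \<omega> v x" by blast
  qed
  moreover have "f (?p x) = 0" for x
    by (rule v) (use p[OF omega_linear_right[of v], of x] i in simp)
  ultimately show ?thesis by simp
qed

text \<open>The three coordinates equal to 1 use up the three scalings: \<open>v\<close> is divided
  by one of its coordinates, the cone by one of its coefficients, and the whole form by a
  coefficient of the residual factor or of the quotient.\<close>

lemma B_locus_cover:
  assumes "p \<in> B_locus scale \<omega> d m"
  obtains k i M g t where "k \<in> B" "i \<in> B" "i \<noteq> k" "M \<in> multisets_of_size (B - {i, k}) m"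
    "g \<in> RestC ` multisets_of_size (B - {i}) (d - m) \<union> QuotC ` multisets_of_size B (d - 1)"
    "t (VecC k) = 1" "t (ConeC M) = 1" "t g = 1" "p = fsc.span {Phi k i t}"
proof -
  from assms obtain H p' where Hp: "H \<in> hyperplanes scale"
    "p' \<in> proj fscale (sym_power H m (G_fibre scale \<omega> H))" "p \<in> proj fscale (F_fibre scale d m H p')"
    by (auto simp: B_locus_def rho_def cone_incidence_def Y_space_def)
  obtain l where l: "l \<in> linear_forms scale UNIV" "l \<noteq> 0" "H = {u. l u = 0}"
    using Hp(1) by (auto simp: hyperplanes_def)
  obtain v0 where v0: "\<And>u. l u = \<omega> v0 u" using omega_dual[OF l(1)] by blast
  have "\<exists>k\<in>B. X k v0 \<noteq> 0"
  proof (rule ccontr)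
    assume "\<not> ?thesis"
    then have "vec (\<lambda>b. X b v0) = 0" unfolding vec_def by (intro sum.neutral) simp
    then have "v0 = 0" by (simp only: vec_X)
    then have "l u = 0" for u using v0[of u] omega_scale_left[of 0 0 u] by simp
    then show False using l(2) by auto
  qed
  then obtain k where k: "k \<in> B" "X k v0 \<noteq> 0" by blast
  define v where "v = scale (1 / X k v0) v0"
  have vk: "X k v = 1" using k(2) by (simp add: v_def X_scale)
  have H: "H = {u. \<omega> v u = 0}" using k(2) by (auto simp: l(3) v0 v_def omega_scale_left)
  have om: "\<omega> v \<noteq> 0"
  proof
    assume "\<omega> v = 0"
    then have "\<omega> v u = 0" for u by simp
    then have "l u = 0" for u
      using k(2) by (simp add: v0 v_def omega_scale_left)
    then show False using l(2) by auto
  qed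
  \<comment> \<open>If \<open>\<omega> v\<close> vanished at all basis vectors other than
    \<open>k\<close>, then \<open>\<omega> v v = 0\<close> and the coordinate 1 of \<open>v\<close>
    at \<open>k\<close> would make it vanish at \<open>k\<close> too.\<close>
  have "\<exists>i\<in>B - {k}. \<omega> v i \<noteq> 0"
  proof (rule ccontr)
    assume neg: "\<not> ?thesis"
    have "0 = (\<Sum>b\<in>B. X b v * \<omega> v b)" using omega_expand[of v v] by (simp only: omega_alt)
    also have "\<dots> = (\<Sum>b\<in>{k}. X b v * \<omega> v b)"
      using neg k(1) B(3) by (intro sum.mono_neutral_right) auto
    finally have "\<omega> v k = 0" using vk by simp
    then have "\<omega> v b = 0" if "b \<in> B" for b using neg that by (cases "b = k") auto
    then have "v = 0" by (rule omega_zeroI)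
    then show False using vk X_scale[of k 0 0] by simp
  qed
  then obtain i where i: "i \<in> B" "i \<noteq> k" "\<omega> v i \<noteq> 0" by blast
  have polar: "polar_point scale \<omega> H = span {v}"
    unfolding H by (rule polar_point_eq[OF vector_space_axioms symplectic omega_linear_right om]) simp
  define Y where "Y j x = X j x - X j v * X k x" for j x
  obtain q0 where q0: "q0 \<in> sym_power H m (G_fibre scale \<omega> H)" "q0 \<noteq> 0" "p' = fsc.span {q0}"
    using Hp(2) by (auto simp: proj_def)
  obtain f where f: "f \<in> F_fibre scale d m H p'" "f \<noteq> 0" "p = fsc.span {f}"
    using Hp(3) by (auto simp: proj_def)
  obtain q g where qg: "q \<in> p'" "g \<in> forms scale H (d - m)" "restr H f = (\<lambda>x. q x * g x)"
    and fd: "f \<in> W d" using f(1) by (auto simp: F_fibre_def)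
  obtain c where c: "q = fscale c q0" using qg(1) q0(3) by (auto simp: fsc.span_singleton)
  \<comment> \<open>Vanishing at \<open>v\<close> determines the coefficient at \<open>k\<close>,
    because \<open>v\<close> has coordinate 1 there; eliminating it turns each remaining coordinate
    into \<open>Y j\<close>.\<close>
  have G: "\<exists>c. \<forall>x\<in>H. a x = (\<Sum>j\<in>B - {i, k}. c j * Y j x)" if a: "a \<in> G_fibre scale \<omega> H" for a
  proof -
    have aH: "a \<in> linear_forms scale H" and av: "a v = 0"
      using a span_base[of v "{v}"] by (auto simp: G_fibre_def polar)
    obtain c where c: "\<forall>x\<in>H. a x = (\<Sum>j\<in>B - {i}. c j * X j x)"
      using linear_form_on_hyperplane[OF aH[unfolded H] i(1,3)] unfolding H by blast
    have vH: "v \<in> H" by (simp add: H omega_alt)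
    have sp: "(\<Sum>j\<in>B - {i}. c j * X j x) = c k * X k x + (\<Sum>j\<in>B - {i, k}. c j * X j x)" for x
      using B(3) k(1) i(2) sum.remove[of "B - {i}" k "\<lambda>j. c j * X j x"]
      by (simp add: Diff_insert2[symmetric] insert_commute)
    have "c k = - (\<Sum>j\<in>B - {i, k}. c j * X j v)"
      using av bspec[OF c vH] sp[of v] vk by (simp add: add_eq_0_iff)
    then have "a x = (\<Sum>j\<in>B - {i, k}. c j * Y j x)" if "x \<in> H" for x
      using bspec[OF c that] sp[of x]
      by (simp add: Y_def algebra_simps sum_subtractf sum_distrib_left)
    then show ?thesis by blast
  qed
  obtain a where a: "\<And>x. x \<in> H \<Longrightarrow> q0 x = (\<Sum>M\<in>multisets_of_size (B - {i, k}) m. a M * mmon Y M x)"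
    "\<And>x. x \<notin> H \<Longrightarrow> q0 x = 0"
    by (rule sym_power_expansion[OF _ G q0(1)]) (use B(3) in auto)
  have "\<exists>M\<in>multisets_of_size (B - {i, k}) m. a M \<noteq> 0"
  proof (rule ccontr)
    assume "\<not> ?thesis"
    then have "q0 x = 0" for x using a by (cases "x \<in> H") auto
    then show False using q0(2) by auto
  qed
  then obtain M where M: "M \<in> multisets_of_size (B - {i, k}) m" "a M \<noteq> 0" by blast
  have lH: "\<exists>c. \<forall>x\<in>H. a x = (\<Sum>j\<in>B - {i}. c j * X j x)" if "a \<in> linear_forms scale H" for a
    using linear_form_on_hyperplane[OF that[unfolded H] i(1,3)] unfolding H .
  obtain b where b: "\<And>x. x \<in> H \<Longrightarrow> g x = (\<Sum>M\<in>multisets_of_size (B - {i}) (d - m). b M * mmon X M x)"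
    by (rule sym_power_expansion[OF _ lH qg(2)[unfolded forms_def]]) (use B(3) in auto)
  \<comment> \<open>The cone is normalised at \<open>M\<close>. The residual coefficients absorb
    \<open>a M\<close> and the scalar \<open>c\<close>, possibly 0, by which \<open>q\<close>
    differs from \<open>q0\<close>. The quotient is filled in later.\<close>
  define t0 where "t0 j = (case j of VecC b \<Rightarrow> X b v | ConeC N \<Rightarrow> a N / a M
    | RestC N \<Rightarrow> c * a M * b N | QuotC N \<Rightarrow> 0)" for j
  have lv: "lvec t0 = v" by (simp add: t0_def vec_X)
  have yY: "y k t0 = Y" by (auto simp: fun_eq_iff y_def Y_def t0_def)
  have fH: "f x = cone_form k i t0 x * rest_form i t0 x" if x: "x \<in> H" for x
  proof -
    have "f x = c * q0 x * g x"
      using fun_cong[OF qg(3), of x] x by (simp add: restr_def c fscale_apply)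
    also have "q0 x = a M * cone_form k i t0 x"
      using M(2) by (simp add: cone_form_def yY t0_def a(1)[OF x] sum_distrib_left)
    also have "c * (a M * cone_form k i t0 x) * g x = cone_form k i t0 x * rest_form i t0 x"
    proof -
      have "rest_form i t0 x = c * a M * g x"
        unfolding b[OF x] sum_distrib_left by (simp add: rest_form_def t0_def mult.assoc)
      then show ?thesis by simp
    qed
    finally show ?thesis .
  qed
  have "Phi k i t0 \<in> W d" by (rule Phi_form)
  then have "f + fscale (- 1) (Phi k i t0) \<in> W d"
    using fd by (intro fsc.subspace_add[OF subspace_forms] fsc.subspace_scale[OF subspace_forms])
  moreover have "d = Suc (d - 1)" using m md by simp
  ultimately have df: "f + fscale (- 1) (Phi k i t0) \<in> W (Suc (d - 1))" by simp
  have "quot_form t0 = 0" by (auto simp: quot_form_def t0_def)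
  then have van: "(f + fscale (- 1) (Phi k i t0)) x = 0" if "\<omega> v x = 0" for x
    using fH[of x] that by (simp add: H fscale_apply Phi_def)
  have "\<exists>g\<in>W (d - 1). \<forall>x. (f + fscale (- 1) (Phi k i t0)) x = \<omega> v x * g x"
    by (rule form_vanishing_on_hyperplane[OF df _ i(3)]) (rule van)
  then obtain G where G: "G \<in> W (d - 1)" and
    G': "\<forall>x. (f + fscale (- 1) (Phi k i t0)) x = \<omega> v x * G x" by (elim bexE)
  have lU: "\<exists>c. \<forall>x\<in>UNIV. a x = (\<Sum>j\<in>B. c j * X j x)" if "a \<in> linear_forms scale UNIV" for a
  proof (intro exI[of _ a] ballI)
    show "a x = (\<Sum>j\<in>B. a j * X j x)" for x
      by (subst linear_forms_expand[OF that]) (simp add: mult.commute)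
  qed
  obtain e where "\<And>x. x \<in> UNIV \<Longrightarrow> G x = (\<Sum>M\<in>multisets_of_size B (d - 1). e M * mmon X M x)"
    by (rule sym_power_expansion[OF B(3) lU G[unfolded forms_def]]) auto
  then have e: "G x = (\<Sum>M\<in>multisets_of_size B (d - 1). e M * mmon X M x)" for x by simp
  define t1 where "t1 j = (case j of QuotC N \<Rightarrow> e N | _ \<Rightarrow> t0 j)" for j
  have t1: "lvec t1 = v" "cone_form k i t1 = cone_form k i t0" "rest_form i t1 = rest_form i t0" "quot_form t1 = G"
  proof -
    have "y k t1 = y k t0" by (auto simp: fun_eq_iff y_def t1_def)
    then show "lvec t1 = v" "cone_form k i t1 = cone_form k i t0" "rest_form i t1 = rest_form i t0" "quot_form t1 = G"
      by (auto intro!: ext simp: cone_form_def rest_form_def quot_form_def e, simp_all add: t1_def lv)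
  qed
  have f1: "f = Phi k i t1"
  proof
    fix x
    have "f x = Phi k i t0 x + \<omega> v x * G x"
      using spec[OF G', of x] by (simp add: fscale_apply algebra_simps)
    then show "f x = Phi k i t1 x"
      using \<open>quot_form t0 = 0\<close> by (simp add: Phi_def t1)
  qed
  let ?R = "RestC ` multisets_of_size (B - {i}) (d - m) \<union> QuotC ` multisets_of_size B (d - 1)"
  have "\<exists>g\<in>?R. t1 g \<noteq> 0"
  proof (rule ccontr)
    assume "\<not> ?thesis"
    then have "rest_form i t1 x = 0" "quot_form t1 x = 0" for x by (auto simp: rest_form_def quot_form_def)
    then have "f = 0" unfolding f1 by (auto simp: Phi_def)
    then show False using f(2) by simp
  qed
  then obtain g where g: "g \<in> ?R" "t1 g \<noteq> 0" by blast
  \<comment> \<open>Residual and quotient coefficients are divided by the same number, so the whole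
    form is rescaled and its projective point is kept.\<close>
  define t where "t j = (case j of VecC b \<Rightarrow> t1 j | ConeC N \<Rightarrow> t1 j | _ \<Rightarrow> t1 j / t1 g)" for j
  have "y k t = y k t1" by (auto simp: fun_eq_iff y_def t_def)
  then have t: "lvec t = lvec t1" "cone_form k i t = cone_form k i t1"
    by (auto intro!: ext simp: cone_form_def, simp_all add: t_def)
  have t': "rest_form i t x = rest_form i t1 x / t1 g" "quot_form t x = quot_form t1 x / t1 g" for x
    by (simp_all add: t_def rest_form_def quot_form_def sum_divide_distrib)
  have Pt: "Phi k i t = fscale (1 / t1 g) f"
    by (auto simp: f1 Phi_def t t' fscale_apply add_divide_distrib)
  have "fsc.span {Phi k i t} = p"
    using g(2) unfolding Pt f(3)
    using fsc.span_image_scale[of "{f}" "\<lambda>_. 1 / t1 g"] by simp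
  moreover have "t (VecC k) = 1" "t (ConeC M) = 1" "t g = 1"
    using vk M(2) g by (auto simp: t_def t1_def t0_def)
  ultimately show thesis using that k(1) i(1,2) M(1) g(1) by metis
qed

text \<open>There is one chart for each choice of \<open>k\<close>, \<open>i\<close> and of the
  normalised coefficients; freezing three of the \<open>expected_dim + 3\<close> parameters leaves
  the right number.\<close>

lemma krull_dim_B_variety_le: "krull_dim (B_variety scale \<omega> d m) \<le> enat expected_dim"
proof -
  let ?R = "\<lambda>i. RestC ` multisets_of_size (B - {i}) (d - m) \<union> QuotC ` multisets_of_size B (d - 1)"
  define C where "C = (SIGMA k:B. SIGMA i:B - {k}. multisets_of_size (B - {i, k}) m \<times> ?R i)"
  define fixed :: "'v \<times> 'v \<times> 'v multiset \<times> 'v param \<Rightarrow> 'v param set"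
    where "fixed = (\<lambda>(k, i, M, g). {VecC k, ConeC M, g})"
  define J where "J c = params (fst c) (fst (snd c)) - fixed c" for c
  define \<sigma> :: "'v \<times> 'v \<times> 'v multiset \<times> 'v param \<Rightarrow> ('v param \<Rightarrow> complex) \<Rightarrow> 'v param \<Rightarrow> complex"
    where "\<sigma> c t j = (if j \<in> fixed c then 1 else t j)" for c t j
  define P where "P c = (\<lambda>(t, x). Phi (fst c) (fst (snd c)) (\<sigma> c t) x)" for c
  have "finite C" unfolding C_def using B(3) by (intro finite_SigmaI finite_cartesian_product) auto
  moreover have "finite (J c)" for c using finite_params by (simp add: J_def)
  moreover have "card (J c) \<le> expected_dim" if c: "c \<in> C" for c
  proof -
    obtain k i M g where c0: "c = (k, i, M, g)" by (cases c)
    with c have c': "c = (k, i, M, g)" "k \<in> B" "i \<in> B" "i \<noteq> k"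
      "M \<in> multisets_of_size (B - {i, k}) m" "g \<in> ?R i"
      by (simp_all add: C_def)
    have "fixed c \<subseteq> params k i" using c' by (auto simp: fixed_def params_def)
    moreover have "card (fixed c) = 3" using c' by (auto simp: fixed_def)
    ultimately have "card (J c) = expected_dim + 3 - 3"
      using card_params[OF c'(2-4)] finite_params
      by (simp add: J_def c'(1) card_Diff_subset finite_subset)
    then show ?thesis by simp
  qed
  moreover have "P c \<in> pmaps (J c) (m + 2) (W d)" for c
  proof -
    have "(\<lambda>(t, x). (\<lambda>(t, x). Phi (fst c) (fst (snd c)) t x) (\<sigma> c t, x)) \<in> pmaps (J c) (m + 2) (W d)"
    proof (rule pmaps_subst[OF pmaps_Phi])
      fix j assume "j \<in> params (fst c) (fst (snd c))"
      then show "(\<lambda>t. \<sigma> c t j) \<in> polys (J c) 1"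
        using polys_var[of j "J c" 1] polys_const[of 1 "J c" 1]
        by (cases "j \<in> fixed c") (simp_all add: \<sigma>_def J_def)
    qed
    then show ?thesis by (simp add: P_def)
  qed
  moreover have "\<exists>c\<in>C. \<exists>t. p = fsc.span {\<lambda>x. P c (t, x)}" if p: "p \<in> B_locus scale \<omega> d m" for p
  proof -
    obtain k i M g t where *: "k \<in> B" "i \<in> B" "i \<noteq> k" "M \<in> multisets_of_size (B - {i, k}) m"
      "g \<in> ?R i" "t (VecC k) = 1" "t (ConeC M) = 1" "t g = 1" "p = fsc.span {Phi k i t}"
      by (rule B_locus_cover[OF p])
    have "\<sigma> (k, i, M, g) t = t" using * by (auto simp: \<sigma>_def fixed_def)
    then have "p = fsc.span {\<lambda>x. P (k, i, M, g) (t, x)}" using * by (simp add: P_def)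
    moreover have "(k, i, M, g) \<in> C" using * by (auto simp: C_def)
    ultimately show ?thesis by blast
  qed
  ultimately show ?thesis
    unfolding B_variety_def by (intro krull_dim_le[OF projective_B_locus])
qed

end

section \<open>A point where the parametrization is immersive\<close>

text \<open>\<open>e1\<close> and \<open>e0\<close> form a hyperbolic pair orthogonal to the rest of
  \<open>B\<close>, so that \<open>\<omega> e1\<close> is the coordinate \<open>x0\<close> and
  \<open>e1\<close> spans the polar point of \<open>x0 = 0\<close>. The vector \<open>e2\<close>
  supplies a linear form for the cone.\<close>

locale adapted_symplectic_basis = symplectic_basis scale \<omega> B n d m
  for scale :: "complex \<Rightarrow> 'v::ab_group_add \<Rightarrow> 'v" and \<omega> B n d m +
  fixes e0 e1 e2 :: 'v
  assumes e_in: "e0 \<in> B" "e1 \<in> B" "e2 \<in> B"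
    and e_ne: "e0 \<noteq> e1" "e2 \<noteq> e0" "e2 \<noteq> e1"
    and e_pair: "\<omega> e1 e0 = 1"
    and e_orth: "\<And>b. b \<in> B - {e0, e1} \<Longrightarrow> \<omega> e0 b = 0" "\<And>b. b \<in> B - {e0, e1} \<Longrightarrow> \<omega> e1 b = 0"
begin

text \<open>Exponents of the monomials at the base point. \<open>Mv\<close> arises from
  \<open>Mc + Mr\<close> by trading one factor \<open>x2\<close> for \<open>x1\<close>, the effect
  of moving \<open>v\<close> along \<open>e2\<close> in the form \<open>x2 - v_2 x1\<close>.\<close>

abbreviation "Mq \<equiv> replicate_mset (d - 1) e1"
abbreviation "Mc \<equiv> replicate_mset m e2"
abbreviation "Mr \<equiv> replicate_mset (d - m) e1"
abbreviation "Mv \<equiv> replicate_mset (m - 1) e2 + replicate_mset (d - m + 1) e1"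

abbreviation "frozen \<equiv> {VecC e1, ConeC Mc, QuotC Mq}"

text \<open>The base point is the form \<open>x\<^sub>0 x\<^sub>1\<^sup>d\<^sup>-\<^sup>1 + x\<^sub>2\<^sup>m x\<^sub>1\<^sup>d\<^sup>-\<^sup>m\<close> over the hyperplane \<open>x\<^sub>0 = 0\<close>. Freezing
  three coordinates removes the scalings of \<open>v\<close>, of \<open>q\<close> against \<open>h\<close>, and of the form itself.\<close>

definition base :: "'v param \<Rightarrow> complex" where
  "base j = (if j \<in> insert (RestC Mr) frozen then 1 else 0)"

definition chart :: "('v param \<Rightarrow> complex) \<Rightarrow> 'v param \<Rightarrow> complex" where
  "chart s j = base j + (if j \<in> frozen then 0 else s j)"

definition free_params :: "'v param set" where
  "free_params = params e1 e0 - frozen"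

text \<open>The partial derivatives of the chart at the base point. Moving \<open>v\<close> tilts
  the hyperplane, which gives the first term; it also moves the vertex, where only the coordinate at
  \<open>e2\<close> counts, as the base cone \<open>x2^m\<close> involves no other
  \<open>y\<close>.\<close>

definition tangent :: "'v param \<Rightarrow> 'v \<Rightarrow> complex" where
  "tangent j = (case j of
     VecC b \<Rightarrow> (\<lambda>x. \<omega> b x * mmon X Mq x - (if b = e2 then of_nat m else 0) * mmon X Mv x)
   | ConeC M \<Rightarrow> mmon X (M + Mr)
   | RestC M \<Rightarrow> mmon X (Mc + M)
   | QuotC M \<Rightarrow> mmon X (add_mset e0 M))"

lemma omega_e: "b \<in> B \<Longrightarrow> b \<noteq> e1 \<Longrightarrow> \<omega> b e0 = 0" "b \<in> B \<Longrightarrow> b \<noteq> e0 \<Longrightarrow> \<omega> b e1 = 0"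
  using e_orth[of b] omega_antisym[of b e0] omega_antisym[of b e1] omega_alt by auto

lemma omega_e1: "\<omega> e1 x = X e0 x"
proof -
  have "\<omega> e1 x = (\<Sum>b\<in>B. X b x * \<omega> e1 b)" by (rule omega_expand)
  also have "\<dots> = (\<Sum>b\<in>{e0}. X b x * \<omega> e1 b)"
  proof (rule sum.mono_neutral_right[OF B(3)])
    show "\<forall>b\<in>B - {e0}. X b x * \<omega> e1 b = 0"
    proof
      fix b assume "b \<in> B - {e0}"
      then show "X b x * \<omega> e1 b = 0" using e_orth(2)[of b] omega_alt[of e1] by (cases "b = e1") auto
    qed
  qed (use e_in in simp)
  finally show ?thesis by (simp add: e_pair)
qed

lemma special_multisets:
  "Mc \<in> multisets_of_size (B - {e0, e1}) m" "Mr \<in> multisets_of_size (B - {e0}) (d - m)"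
  "Mq \<in> multisets_of_size B (d - 1)"
  using e_in e_ne by (auto simp: multisets_of_size_def)

lemma frozen_params: "frozen \<subseteq> params e1 e0"
  using special_multisets e_in by (simp add: params_def)

lemma card_free_params: "finite free_params" "card free_params = expected_dim"
proof -
  show "finite free_params" using finite_params by (simp add: free_params_def)
  have "card frozen = 3" by simp
  then show "card free_params = expected_dim"
    using card_params[OF e_in(2,1) e_ne(1)] frozen_params finite_params
    by (simp add: free_params_def card_Diff_subset)
qed

lemma sum_single_coeff:
  fixes f :: "'b \<Rightarrow> complex"
  assumes "finite A" "N \<in> A"
  shows "(\<Sum>M\<in>A. (if M = N then 1 else 0) * f M) = f N"
proof -
  have "(\<Sum>M\<in>A. (if M = N then 1 else 0) * f M) = (\<Sum>M\<in>A. if M = N then f M else 0)"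
    by (intro sum.cong) auto
  then show ?thesis using assms by simp
qed

lemma mmon_y_base:
  assumes "M \<in> multisets_of_size (B - {e0, e1}) m"
  shows "mmon (y e1 base) M x = mmon X M x"
  using assms by (intro mmon_cong) (auto simp: y_def base_def multisets_of_size_def)

lemma at_base:
  "\<omega> (lvec base) x = X e0 x" "quot_form base x = mmon X Mq x"
  "rest_form e0 base x = mmon X Mr x" "cone_form e1 e0 base x = mmon X Mc x"
proof -
  show "\<omega> (lvec base) x = X e0 x"
    using sum_single_coeff[OF B(3) e_in(2), of "\<lambda>b. \<omega> b x"]
    by (simp add: omega_vec_left base_def omega_e1)
  show "quot_form base x = mmon X Mq x"
    using sum_single_coeff[OF finite_multisets_of_size[OF B(3)] special_multisets(3), of "\<lambda>M. mmon X M x"]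
    by (simp add: quot_form_def base_def)
  show "rest_form e0 base x = mmon X Mr x"
    using sum_single_coeff[OF finite_multisets_of_size special_multisets(2), of "\<lambda>M. mmon X M x"] B(3)
    by (simp add: rest_form_def base_def)
  have "cone_form e1 e0 base x = (\<Sum>M\<in>multisets_of_size (B - {e0, e1}) m. base (ConeC M) * mmon X M x)"
    by (simp add: cone_form_def mmon_y_base)
  then show "cone_form e1 e0 base x = mmon X Mc x"
    using sum_single_coeff[OF finite_multisets_of_size special_multisets(1), of "\<lambda>M. mmon X M x"] B(3)
    by (simp add: base_def)
qed

lemma deriv_affine_sum:
  fixes u w f :: "'i \<Rightarrow> complex"
  shows "((\<lambda>e. \<Sum>a\<in>A. (u a + e * w a) * f a) has_field_derivative (\<Sum>a\<in>A. w a * f a)) (at 0)"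
  by (rule DERIV_sum) (auto intro!: derivative_eq_intros)

text \<open>Existence suffices: for monomials other than \<open>Mc\<close> this derivative gets
  multiplied by a coefficient that is 0 at the base point.\<close>

lemma deriv_mmon_y:
  assumes "set_mset M \<subseteq> B - {e0, e1}"
  shows "\<exists>D. ((\<lambda>e. mmon (y e1 (\<lambda>j. base j + e * s j)) M x) has_field_derivative D) (at 0)"
  using assms
proof (induction M)
  case empty
  show ?case by (auto intro!: exI[of _ 0])
next
  case (add j M)
  then obtain D where D: "((\<lambda>e. mmon (y e1 (\<lambda>j. base j + e * s j)) M x) has_field_derivative D) (at 0)"
    by auto
  have "((\<lambda>e. y e1 (\<lambda>j. base j + e * s j) j x) has_field_derivative - s (VecC j) * X e1 x) (at 0)"
    unfolding y_def by (auto intro!: derivative_eq_intros)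
  from DERIV_mult[OF this D] show ?case by (auto simp: mult.commute)
qed

text \<open>In the product rule only \<open>Mc\<close> has a nonzero coefficient at the base point,
  so only the power \<open>(x2 - v_2 x1)^m\<close> contributes a derivative in
  \<open>v\<close>.\<close>

lemma deriv_cone:
  assumes s: "s (ConeC Mc) = 0"
  shows "((\<lambda>e. cone_form e1 e0 (\<lambda>j. base j + e * s j) x) has_field_derivative
    (\<Sum>M\<in>multisets_of_size (B - {e0, e1}) m. s (ConeC M) * mmon X M x) -
     s (VecC e2) * (of_nat m * X e2 x ^ (m - 1) * X e1 x)) (at 0)"
proof -
  let ?t = "\<lambda>e j. base j + e * s j"
  let ?A = "multisets_of_size (B - {e0, e1}) m"
  have "\<forall>M\<in>?A. \<exists>D. ((\<lambda>e. mmon (y e1 (?t e)) M x) has_field_derivative D) (at 0)"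
    by (intro ballI deriv_mmon_y) (simp add: multisets_of_size_def)
  from bchoice[OF this] obtain D0
    where D0: "\<forall>M\<in>?A. ((\<lambda>e. mmon (y e1 (?t e)) M x) has_field_derivative D0 M) (at 0)" ..
  define Dc where "Dc = - (s (VecC e2) * (of_nat m * X e2 x ^ (m - 1) * X e1 x))"
  have Dc: "((\<lambda>e. mmon (y e1 (?t e)) Mc x) has_field_derivative Dc) (at 0)"
  proof -
    have "y e1 (?t e) e2 x = X e2 x - e * s (VecC e2) * X e1 x" for e
      using e_ne by (simp add: y_def base_def)
    then have "mmon (y e1 (?t e)) Mc x = (X e2 x - e * s (VecC e2) * X e1 x) ^ m" for e
      by (simp only: mmon_replicate)
    moreover have "((\<lambda>e. (X e2 x - e * s (VecC e2) * X e1 x) ^ m) has_field_derivative Dc) (at 0)"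
      unfolding Dc_def by (auto intro!: derivative_eq_intros)
    ultimately show ?thesis by (simp only:)
  qed
  define D where "D M = (if M = Mc then Dc else D0 M)" for M
  have D: "((\<lambda>e. mmon (y e1 (?t e)) M x) has_field_derivative D M) (at 0)" if "M \<in> ?A" for M
    using bspec[OF D0 that] Dc by (cases "M = Mc") (simp_all only: D_def if_True if_False simp_thms)
  have y0: "mmon (y e1 (?t 0)) M x = mmon X M x" if "M \<in> ?A" for M
    using mmon_y_base[OF that] by simp
  have "((\<lambda>e. \<Sum>M\<in>?A. ?t e (ConeC M) * mmon (y e1 (?t e)) M x) has_field_derivative
      (\<Sum>M\<in>?A. s (ConeC M) * mmon X M x + (if M = Mc then Dc else 0))) (at 0)"
  proof (rule DERIV_sum)
    fix M assume M: "M \<in> ?A"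
    have "((\<lambda>e. ?t e (ConeC M)) has_field_derivative s (ConeC M)) (at 0)"
      by (auto intro!: derivative_eq_intros)
    from DERIV_mult[OF this D[OF M]]
    show "((\<lambda>e. ?t e (ConeC M) * mmon (y e1 (?t e)) M x) has_field_derivative
        s (ConeC M) * mmon X M x + (if M = Mc then Dc else 0)) (at 0)"
      using y0[OF M] by (auto simp: base_def D_def)
  qed
  moreover have "(\<Sum>M\<in>?A. s (ConeC M) * mmon X M x + (if M = Mc then Dc else 0)) =
      (\<Sum>M\<in>?A. s (ConeC M) * mmon X M x) + Dc"
    using special_multisets(1) finite_multisets_of_size[of "B - {e0, e1}" m] B(3)
    by (simp add: sum.distrib)
  ultimately show ?thesis by (simp add: cone_form_def Dc_def insert_commute)
qed

lemma deriv_Phi: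
  "((\<lambda>e. Phi e1 e0 (chart (\<lambda>j. e * s j)) x) has_field_derivative
     (\<Sum>j\<in>free_params. s j * tangent j x)) (at 0)"
proof -
  define s' where "s' j = (if j \<in> frozen then 0 else s j)" for j
  let ?t = "\<lambda>e j. base j + e * s' j"
  have chart: "chart (\<lambda>j. e * s j) = ?t e" for e
    by (auto simp: chart_def s'_def)
  have L: "((\<lambda>e. \<omega> (lvec (?t e)) x) has_field_derivative (\<Sum>b\<in>B. s' (VecC b) * \<omega> b x)) (at 0)"
    unfolding omega_vec_left by (rule deriv_affine_sum)
  have Q: "((\<lambda>e. quot_form (?t e) x) has_field_derivative
      (\<Sum>M\<in>multisets_of_size B (d - 1). s' (QuotC M) * mmon X M x)) (at 0)"
    unfolding quot_form_def by (rule deriv_affine_sum)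
  have R: "((\<lambda>e. rest_form e0 (?t e) x) has_field_derivative
      (\<Sum>M\<in>multisets_of_size (B - {e0}) (d - m). s' (RestC M) * mmon X M x)) (at 0)"
    unfolding rest_form_def by (rule deriv_affine_sum)
  have C: "((\<lambda>e. cone_form e1 e0 (?t e) x) has_field_derivative
    (\<Sum>M\<in>multisets_of_size (B - {e0, e1}) m. s' (ConeC M) * mmon X M x) -
     s' (VecC e2) * (of_nat m * X e2 x ^ (m - 1) * X e1 x)) (at 0)"
    by (rule deriv_cone) (simp add: s'_def)
  have zero: "\<omega> (lvec (?t 0)) x = X e0 x" "quot_form (?t 0) x = mmon X Mq x"
    "rest_form e0 (?t 0) x = mmon X Mr x" "cone_form e1 e0 (?t 0) x = mmon X Mc x"
    by (simp_all add: at_base)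
  have Mv: "of_nat m * X e2 x ^ (m - 1) * X e1 x * mmon X Mr x = of_nat m * mmon X Mv x"
    by (simp add: mmon_replicate)
  have "(\<Sum>j\<in>free_params. s j * tangent j x) = (\<Sum>j\<in>params e1 e0. s' j * tangent j x)"
    using finite_params by (intro sum.mono_neutral_cong_left) (auto simp: free_params_def s'_def)
  also have "\<dots> = (\<Sum>b\<in>B. s' (VecC b) * \<omega> b x) * mmon X Mq x - s' (VecC e2) * (of_nat m * mmon X Mv x) +
     (\<Sum>M\<in>multisets_of_size (B - {e0, e1}) m. s' (ConeC M) * mmon X M x) * mmon X Mr x +
     (\<Sum>M\<in>multisets_of_size (B - {e0}) (d - m). s' (RestC M) * mmon X M x) * mmon X Mc x +
     (\<Sum>M\<in>multisets_of_size B (d - 1). s' (QuotC M) * mmon X M x) * X e0 x"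
  proof -
    have "(\<Sum>b\<in>B. s' (VecC b) * tangent (VecC b) x) =
        (\<Sum>b\<in>B. s' (VecC b) * \<omega> b x * mmon X Mq x) -
        (\<Sum>b\<in>B. if b = e2 then s' (VecC e2) * (of_nat m * mmon X Mv x) else 0)"
      unfolding sum_subtractf[symmetric] by (intro sum.cong) (auto simp: tangent_def algebra_simps)
    also have "\<dots> = (\<Sum>b\<in>B. s' (VecC b) * \<omega> b x) * mmon X Mq x - s' (VecC e2) * (of_nat m * mmon X Mv x)"
      using B(3) e_in(3) by (simp add: sum_distrib_right)
    finally have V: "(\<Sum>b\<in>B. s' (VecC b) * tangent (VecC b) x) =
        (\<Sum>b\<in>B. s' (VecC b) * \<omega> b x) * mmon X Mq x - s' (VecC e2) * (of_nat m * mmon X Mv x)" .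
    show ?thesis
      unfolding sum_params V by (simp add: tangent_def sum_distrib_right sum_distrib_left mult_ac)
  qed
  finally have sum: "(\<Sum>j\<in>free_params. s j * tangent j x) = \<dots>" .
  show ?thesis
    unfolding chart Phi_def sum
  proof (rule DERIV_cong[OF DERIV_add[OF DERIV_mult[OF L Q] DERIV_mult[OF C R]]])
    show "(\<Sum>b\<in>B. s' (VecC b) * \<omega> b x) * quot_form (?t 0) x +
      (\<Sum>M\<in>multisets_of_size B (d - 1). s' (QuotC M) * mmon X M x) * \<omega> (lvec (?t 0)) x +
      (((\<Sum>M\<in>multisets_of_size (B - {e0, e1}) m. s' (ConeC M) * mmon X M x) -
        s' (VecC e2) * (of_nat m * X e2 x ^ (m - 1) * X e1 x)) * rest_form e0 (?t 0) x +
       (\<Sum>M\<in>multisets_of_size (B - {e0}) (d - m). s' (RestC M) * mmon X M x) * cone_form e1 e0 (?t 0) x) =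
      (\<Sum>b\<in>B. s' (VecC b) * \<omega> b x) * mmon X Mq x - s' (VecC e2) * (of_nat m * mmon X Mv x) +
      (\<Sum>M\<in>multisets_of_size (B - {e0, e1}) m. s' (ConeC M) * mmon X M x) * mmon X Mr x +
      (\<Sum>M\<in>multisets_of_size (B - {e0}) (d - m). s' (RestC M) * mmon X M x) * mmon X Mc x +
      (\<Sum>M\<in>multisets_of_size B (d - 1). s' (QuotC M) * mmon X M x) * X e0 x"
      unfolding zero left_diff_distrib Mv[symmetric] by (simp only: mult.assoc) simp
  qed
qed

section \<open>Injectivity of the derivative at the base point\<close>

lemma mmon_X_independent:
  assumes "\<And>x. (\<Sum>M\<in>multisets_of_size B k. c M * mmon X M x) = 0"
  shows "\<forall>M\<in>multisets_of_size B k. c M = 0"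
proof
  fix M assume M: "M \<in> multisets_of_size B k"
  have "(\<Sum>M\<in>multisets_of_size B k. c M * mmon (\<lambda>i t. t i) M t) = 0" for t
  proof -
    have "mmon X M (vec t) = mmon (\<lambda>i t. t i) M t" if "M \<in> multisets_of_size B k" for M
      using that by (intro mmon_cong X_vec) (auto simp: multisets_of_size_def)
    then show ?thesis using assms[of "vec t"] by simp
  qed
  then show "c M = 0"
    by (rule mmon_coeff_zero[rotated 1]) (use M B(3) in auto)
qed

lemma tangent_form: "j \<in> params e1 e0 \<Longrightarrow> tangent j \<in> W d"
proof -
  assume j: "j \<in> params e1 e0"
  have mm: "mmon X M \<in> W d" if "size M = d" for M using mmon_X_form[of M] that by simp
  have V: "tangent (VecC b) \<in> W d" for b
  proof -
    have "\<omega> b * mmon X Mq \<in> W (1 + (d - 1))"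
      using forms_linear[OF omega_linear_right[of b]] mmon_X_form[of Mq]
      by (intro W_mult) (simp_all only: size_replicate_mset)
    moreover have "1 + (d - 1) = d" using m md by simp
    ultimately have 1: "\<omega> b * mmon X Mq \<in> W d" by (simp only:)
    have "size Mv = d" using m md by simp
    then have 2: "mmon X Mv \<in> W d" by (rule mm)
    have "\<omega> b * mmon X Mq + fscale (if b = e2 then - of_nat m else 0) (mmon X Mv) \<in> W d"
      by (intro fsc.subspace_add[OF subspace_forms] fsc.subspace_scale[OF subspace_forms] 1 2)
    moreover have "\<omega> b * mmon X Mq + fscale (if b = e2 then - of_nat m else 0) (mmon X Mv) =
        tangent (VecC b)"
      by (auto simp: tangent_def fscale_apply)
    ultimately show ?thesis by (simp only:)
  qed
  show "tangent j \<in> W d"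
  proof (cases j)
    case (VecC b)
    then show ?thesis using V by simp
  next
    case (ConeC M)
    then have "size (M + Mr) = d" using j md by (auto simp: params_def multisets_of_size_def)
    then show ?thesis unfolding ConeC tangent_def param.case by (rule mm)
  next
    case (RestC M)
    then have "size (Mc + M) = d" using j md by (auto simp: params_def multisets_of_size_def)
    then show ?thesis unfolding RestC tangent_def param.case by (rule mm)
  next
    case (QuotC M)
    then have "size (add_mset e0 M) = d" using j m md by (auto simp: params_def multisets_of_size_def)
    then show ?thesis unfolding QuotC tangent_def param.case by (rule mm)
  qed
qed

lemma Phi_base: "Phi e1 e0 (chart (\<lambda>_. 0)) x = mmon X (add_mset e0 Mq) x + mmon X (Mc + Mr) x"
proof -
  have "chart (\<lambda>_. 0) = base" by (auto simp: chart_def)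
  then show ?thesis by (simp add: Phi_def at_base)
qed

text \<open>The functional dual to the monomial \<open>N\<close> is applied to the relation. Its
  values are written as indicators, so that a suitable choice of \<open>N\<close> isolates few
  unknowns at a time.\<close>

lemma coefficient_equations:
  assumes zero: "\<And>x. a * (mmon X (add_mset e0 Mq) x + mmon X (Mc + Mr) x) +
      (\<Sum>j\<in>params e1 e0. b j * tangent j x) = 0"
    and N: "N \<in> multisets_of_size B d"
  shows "a * ((if N = add_mset e0 Mq then 1 else 0) + (if N = Mc + Mr then 1 else 0)) +
    (\<Sum>v\<in>B. b (VecC v) * ((\<Sum>c\<in>B. \<omega> v c * (if N = add_mset c Mq then 1 else 0)) -
       (if v = e2 then of_nat m else 0) * (if N = Mv then 1 else 0))) +
    (\<Sum>M\<in>multisets_of_size (B - {e0, e1}) m. b (ConeC M) * (if N = M + Mr then 1 else 0)) +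
    (\<Sum>M\<in>multisets_of_size (B - {e0}) (d - m). b (RestC M) * (if N = Mc + M then 1 else 0)) +
    (\<Sum>M\<in>multisets_of_size B (d - 1). b (QuotC M) * (if N = add_mset e0 M then 1 else 0)) = 0"
proof -
  let ?A = "multisets_of_size B d"
  obtain l where l: "\<And>k a f g. l k (fscale a f + g) = a * l k f + l k g"
    "\<And>k k'. k \<in> ?A \<Longrightarrow> k' \<in> ?A \<Longrightarrow> l k (mmon X k') = (if k = k' then 1 else 0 :: complex)"
    by (rule dual_functionals[of ?A "mmon X", OF finite_multisets_of_size[OF B(3)]])
      (rule mmon_X_independent, assumption, rule that)
  have l0: "l N 0 = 0" using l(1)[of N 1 0 0] by simp
  have ladd: "l N (f + g) = l N f + l N g" for f g using l(1)[of N 1 f g] by simp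
  have lscale: "l N (fscale c f) = c * l N f" for c f using l(1)[of N c f 0] l0 by simp
  have lsum: "l N (\<Sum>i\<in>I. fscale (c i) (f i)) = (\<Sum>i\<in>I. c i * l N (f i))" for I c and f :: "'i \<Rightarrow> _"
    by (induction I rule: infinite_finite_induct)
      (simp_all only: sum.infinite sum.empty sum.insert not_False_eq_True ladd lscale l0)
  have lm: "l N (mmon X M) = (if N = M then 1 else 0)" if "M \<in> ?A" for M by (rule l(2)[OF N that])
  have d: "d = Suc (d - 1)" "d - m + m = d" using m md by simp_all
  have in1: "add_mset c Mq \<in> ?A" if "c \<in> B" for c
    using that e_in d by (simp add: multisets_of_size_def)
  have in2: "Mc + Mr \<in> ?A" "Mv \<in> ?A"
    using e_in m md by (auto simp: multisets_of_size_def)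
  have in3: "M + Mr \<in> ?A" if "M \<in> multisets_of_size (B - {e0, e1}) m" for M
    using that e_in md by (auto simp: multisets_of_size_def)
  have in4: "Mc + M \<in> ?A" if "M \<in> multisets_of_size (B - {e0}) (d - m)" for M
    using that e_in md by (auto simp: multisets_of_size_def)
  have in5: "add_mset e0 M \<in> ?A" if "M \<in> multisets_of_size B (d - 1)" for M
    using that e_in d by (auto simp: multisets_of_size_def)
  have V: "l N (tangent (VecC v)) = (\<Sum>c\<in>B. \<omega> v c * (if N = add_mset c Mq then 1 else 0)) -
       (if v = e2 then of_nat m else 0) * (if N = Mv then 1 else 0)" for v
  proof -
    have "tangent (VecC v) = (\<Sum>c\<in>B. fscale (\<omega> v c) (mmon X (add_mset c Mq))) +
        fscale (if v = e2 then - of_nat m else 0) (mmon X Mv)"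
    proof
      fix x
      have "\<omega> v x * mmon X Mq x = (\<Sum>c\<in>B. \<omega> v c * (X c x * mmon X Mq x))"
        by (subst omega_expand) (simp add: sum_distrib_right sum_distrib_left mult_ac)
      then show "tangent (VecC v) x = ((\<Sum>c\<in>B. fscale (\<omega> v c) (mmon X (add_mset c Mq))) +
        fscale (if v = e2 then - of_nat m else 0) (mmon X Mv)) x"
        by (simp add: tangent_def sum_fun_apply fscale_apply)
    qed
    then have "l N (tangent (VecC v)) = (\<Sum>c\<in>B. \<omega> v c * l N (mmon X (add_mset c Mq))) +
        (if v = e2 then - of_nat m else 0) * l N (mmon X Mv)"
      by (simp only: ladd lsum lscale)
    also have "(\<Sum>c\<in>B. \<omega> v c * l N (mmon X (add_mset c Mq))) =
        (\<Sum>c\<in>B. \<omega> v c * (if N = add_mset c Mq then 1 else 0))"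
      by (intro sum.cong refl arg_cong2[where f = "(*)"] lm in1)
    finally show ?thesis unfolding lm[OF in2(2)] by (cases "v = e2") (simp_all only: if_True if_False, simp_all)
  qed
  have "0 = l N (fscale a (mmon X (add_mset e0 Mq) + mmon X (Mc + Mr)) +
      (\<Sum>j\<in>params e1 e0. fscale (b j) (tangent j)))"
  proof -
    have "fscale a (mmon X (add_mset e0 Mq) + mmon X (Mc + Mr)) +
      (\<Sum>j\<in>params e1 e0. fscale (b j) (tangent j)) = 0"
    proof
      fix x
      show "(fscale a (mmon X (add_mset e0 Mq) + mmon X (Mc + Mr)) +
        (\<Sum>j\<in>params e1 e0. fscale (b j) (tangent j))) x = 0 x"
        using zero[of x] by (simp only: plus_fun_apply fscale_apply sum_fun_apply zero_fun_apply)
    qed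
    then show ?thesis by (simp only: l0)
  qed
  also have "\<dots> = a * ((if N = add_mset e0 Mq then 1 else 0) + (if N = Mc + Mr then 1 else 0)) +
      (\<Sum>j\<in>params e1 e0. b j * l N (tangent j))"
    by (simp only: ladd lsum lscale lm[OF in1[OF e_in(1)]] lm[OF in2(1)])
  also have "(\<Sum>j\<in>params e1 e0. b j * l N (tangent j)) =
    (\<Sum>v\<in>B. b (VecC v) * ((\<Sum>c\<in>B. \<omega> v c * (if N = add_mset c Mq then 1 else 0)) -
       (if v = e2 then of_nat m else 0) * (if N = Mv then 1 else 0))) +
    (\<Sum>M\<in>multisets_of_size (B - {e0, e1}) m. b (ConeC M) * (if N = M + Mr then 1 else 0)) +
    (\<Sum>M\<in>multisets_of_size (B - {e0}) (d - m). b (RestC M) * (if N = Mc + M then 1 else 0)) +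
    (\<Sum>M\<in>multisets_of_size B (d - 1). b (QuotC M) * (if N = add_mset e0 M then 1 else 0))"
  proof -
    have C: "l N (tangent (ConeC M)) = (if N = M + Mr then 1 else 0)"
      if "M \<in> multisets_of_size (B - {e0, e1}) m" for M
      unfolding tangent_def param.case by (rule lm[OF in3[OF that]])
    have R: "l N (tangent (RestC M)) = (if N = Mc + M then 1 else 0)"
      if "M \<in> multisets_of_size (B - {e0}) (d - m)" for M
      unfolding tangent_def param.case by (rule lm[OF in4[OF that]])
    have Q: "l N (tangent (QuotC M)) = (if N = add_mset e0 M then 1 else 0)"
      if "M \<in> multisets_of_size B (d - 1)" for M
      unfolding tangent_def param.case by (rule lm[OF in5[OF that]])
    show ?thesis
      unfolding sum_params V
      by (intro arg_cong2[where f = "(+)"] sum.cong refl arg_cong2[where f = "(*)"] C R Q)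
  qed
  finally show ?thesis by (simp only: add.assoc)
qed

text \<open>The unknowns are eliminated in the order in which monomials separate them. Multiples of
  \<open>x0\<close> see only the quotient and \<open>a\<close>; the monomials
  \<open>x_k x1^(d-1)\<close> without \<open>x0\<close> then see only \<open>v\<close>; cone
  monomials times \<open>x1^(d-m)\<close> give the cone, and multiples of \<open>x2^m\<close> the
  residual factor.\<close>

lemma tangent_independent:
  assumes zero: "\<And>x. a * Phi e1 e0 (chart (\<lambda>_. 0)) x + (\<Sum>j\<in>free_params. b j * tangent j x) = 0"
  shows "a = 0 \<and> (\<forall>j\<in>free_params. b j = 0)"
proof -
  define \<beta> where "\<beta> j = (if j \<in> free_params then b j else 0)" for j
  have \<beta>0: "\<beta> (VecC e1) = 0" "\<beta> (ConeC Mc) = 0" "\<beta> (QuotC Mq) = 0"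
    by (simp_all add: \<beta>_def free_params_def)
  have eq: "a * (mmon X (add_mset e0 Mq) x + mmon X (Mc + Mr) x) +
      (\<Sum>j\<in>params e1 e0. \<beta> j * tangent j x) = 0" for x
  proof -
    have "(\<Sum>j\<in>free_params. b j * tangent j x) = (\<Sum>j\<in>params e1 e0. \<beta> j * tangent j x)"
      using finite_params by (intro sum.mono_neutral_cong_left) (auto simp: \<beta>_def free_params_def)
    then show ?thesis using zero[of x] by (simp only: Phi_base)
  qed
  note E = coefficient_equations[OF eq]
  let ?C = "multisets_of_size (B - {e0, e1}) m" and ?R = "multisets_of_size (B - {e0}) (d - m)"
    and ?Q = "multisets_of_size B (d - 1)"
  have C: "e0 \<notin># M" "e1 \<notin># M" "size M = m" if "M \<in> ?C" for M
    using that by (auto simp: multisets_of_size_def)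
  have R: "e0 \<notin># M" if "M \<in> ?R" for M using that by (auto simp: multisets_of_size_def)
  have d: "Suc (d - 1) = d" "m > 0" "m - 1 > 0" "d \<ge> 1" using m md by simp_all
  have inN: "add_mset c Mq \<in> multisets_of_size B d" if "c \<in> B" for c
    using that e_in d(1) by (simp add: multisets_of_size_def)
  have fin: "finite ?C" "finite ?R" "finite ?Q" using B(3) by auto
  have single: "(\<Sum>M\<in>A. \<beta> (f M) * (if N = M then 1 else 0)) = \<beta> (f N)"
    if "finite A" "N \<in> A" for A and N :: "'v multiset" and f
  proof -
    have "(\<Sum>M\<in>A. \<beta> (f M) * (if N = M then 1 else 0)) = (\<Sum>M\<in>A. if M = N then \<beta> (f M) else 0)"
      by (intro sum.cong) auto
    then show ?thesis using that by simp
  qed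
  \<comment> \<open>The motion of \<open>v\<close> produces no \<open>x0\<close>, since only
    \<open>\<omega> e1\<close> contains it and the coordinate of \<open>v\<close> at
    \<open>e1\<close> is frozen. Cone and residual monomials avoid \<open>e0\<close>
    altogether.\<close>
  have Q: "a * (if M = Mq then 1 else 0) + \<beta> (QuotC M) = 0" if M: "M \<in> ?Q" for M
  proof -
    have N: "add_mset e0 M \<in> multisets_of_size B d"
      using M e_in d(1) by (simp add: multisets_of_size_def)
    have ne: "add_mset e0 M \<noteq> K" if "e0 \<notin># K" for K using that by auto
    have 1: "\<beta> (VecC v) * ((\<Sum>c\<in>B. \<omega> v c * (if add_mset e0 M = add_mset c Mq then 1 else 0)) -
       (if v = e2 then of_nat m else 0) * (if add_mset e0 M = Mv then 1 else 0)) = 0" if v: "v \<in> B" for v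
    proof -
      have "add_mset e0 M \<noteq> Mv" by (rule ne) (use e_ne in auto)
      moreover have "\<beta> (VecC v) * (\<omega> v c * (if add_mset e0 M = add_mset c Mq then 1 else 0)) = 0" for c
      proof (cases "c = e0")
        case True
        then show ?thesis using omega_e(1)[OF v] \<beta>0(1) by (cases "v = e1") auto
      next
        case False
        then have "add_mset e0 M \<noteq> add_mset c Mq" using e_ne by (intro ne) auto
        then show ?thesis by simp
      qed
      then have "\<beta> (VecC v) * (\<Sum>c\<in>B. \<omega> v c * (if add_mset e0 M = add_mset c Mq then 1 else 0)) = 0"
        unfolding sum_distrib_left by (intro sum.neutral) blast
      ultimately show ?thesis by (simp only: if_False right_diff_distrib mult_zero_right diff_0_right)
    qed
    have 2: "add_mset e0 M \<noteq> M' + Mr" if "M' \<in> ?C" for M'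
      using C(1)[OF that] e_ne by (intro ne) auto
    have 3: "add_mset e0 M \<noteq> Mc + M'" if "M' \<in> ?R" for M'
      using R(1)[OF that] e_ne by (intro ne) auto
    have 4: "add_mset e0 M \<noteq> Mc + Mr" using e_ne by (intro ne) auto
    have "(\<Sum>v\<in>B. \<beta> (VecC v) * ((\<Sum>c\<in>B. \<omega> v c * (if add_mset e0 M = add_mset c Mq then 1 else 0)) -
       (if v = e2 then of_nat m else 0) * (if add_mset e0 M = Mv then 1 else 0))) = 0"
      by (intro sum.neutral ballI 1)
    moreover have "(\<Sum>M'\<in>?C. \<beta> (ConeC M') * (if add_mset e0 M = M' + Mr then 1 else 0)) = 0"
      using 2 by (intro sum.neutral) simp
    moreover have "(\<Sum>M'\<in>?R. \<beta> (RestC M') * (if add_mset e0 M = Mc + M' then 1 else 0)) = 0"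
      using 3 by (intro sum.neutral) simp
    moreover have "(\<Sum>M'\<in>?Q. \<beta> (QuotC M') * (if add_mset e0 M = add_mset e0 M' then 1 else 0)) = \<beta> (QuotC M)"
      using single[OF fin(3) M, of QuotC] by (simp only: add_mset_add_mset_same_iff)
    ultimately show ?thesis using E[OF N] 4
      by (simp only: if_False add_0_right add_mset_add_mset_same_iff)
  qed
  \<comment> \<open>At \<open>Mq\<close> the quotient coefficient is frozen, which leaves
    \<open>a\<close> alone.\<close>
  have a0: "a = 0" using Q[OF special_multisets(3)] \<beta>0(3) by simp
  have Q0: "\<beta> (QuotC M) = 0" if "M \<in> ?Q" for M using Q[OF that] a0 by simp
  have E': "(\<Sum>v\<in>B. \<beta> (VecC v) * ((\<Sum>c\<in>B. \<omega> v c * (if N = add_mset c Mq then 1 else 0)) -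
       (if v = e2 then of_nat m else 0) * (if N = Mv then 1 else 0))) +
    (\<Sum>M\<in>?C. \<beta> (ConeC M) * (if N = M + Mr then 1 else 0)) +
    (\<Sum>M\<in>?R. \<beta> (RestC M) * (if N = Mc + M then 1 else 0)) = 0"
    if N: "N \<in> multisets_of_size B d" for N
  proof -
    have "(\<Sum>M\<in>?Q. \<beta> (QuotC M) * (if N = add_mset e0 M then 1 else 0)) = 0"
      using Q0 by (intro sum.neutral) simp
    then show ?thesis using E[OF N] by (simp only: a0 mult_zero_left add_0_left add_0_right)
  qed
  \<comment> \<open>The monomial \<open>x_k x1^(d-1)\<close> has at most one factor other than
    \<open>x1\<close>, while cone terms have \<open>m >= 2\<close> of them and residual terms are
    divisible by \<open>x2^m\<close>. The right side can be nonzero only for \<open>m = 2\<close>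
    and \<open>k = e2\<close>.\<close>
  have V: "(\<Sum>v\<in>B. \<beta> (VecC v) * \<omega> v k) = \<beta> (VecC e2) * of_nat m * (if add_mset k Mq = Mv then 1 else 0)"
    if k: "k \<in> B" "k \<noteq> e0" for k
  proof -
    let ?N = "add_mset k Mq"
    have few: "size (filter_mset (\<lambda>x. x \<noteq> e1) ?N) \<le> 1"
    proof -
      have "filter_mset (\<lambda>x. x \<noteq> e1) (replicate_mset i e1) = {#}" for i by (induction i) simp_all
      then show ?thesis by (cases "k = e1") (simp_all only: filter_mset_add_mset simp_thms if_True if_False size_add_mset size_empty
            One_nat_def le_refl le0)
    qed
    have "?N \<noteq> M + Mr" if M: "M \<in> ?C" for M
    proof
      assume "?N = M + Mr"
      moreover have "filter_mset (\<lambda>x. x \<noteq> e1) M = M"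
        using C(2)[OF M] by (auto simp: filter_mset_eq_conv)
      ultimately have "size M \<le> 1" using few by simp
      then show False using C(3)[OF M] m by simp
    qed
    then have 1: "(\<Sum>M\<in>?C. \<beta> (ConeC M) * (if ?N = M + Mr then 1 else 0)) = 0"
      by (intro sum.neutral) simp
    have "?N \<noteq> Mc + M" for M
    proof
      assume "?N = Mc + M"
      then have "count ?N e2 = m + count M e2" by simp
      moreover have "count ?N e2 \<le> 1" using e_ne by simp
      ultimately show False using m by simp
    qed
    then have 2: "(\<Sum>M\<in>?R. \<beta> (RestC M) * (if ?N = Mc + M then 1 else 0)) = 0"
      by (intro sum.neutral) simp
    have s: "(\<Sum>c\<in>B. \<omega> v c * (if ?N = add_mset c Mq then 1 else 0)) = \<omega> v k" for v
    proof -
      have "(\<Sum>c\<in>B. \<omega> v c * (if ?N = add_mset c Mq then 1 else 0)) = (\<Sum>c\<in>B. if c = k then \<omega> v c else 0)"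
        by (intro sum.cong) auto
      then show ?thesis using B(3) k(1) by simp
    qed
    let ?z = "if ?N = Mv then 1 else 0 :: complex"
    have "(\<Sum>v\<in>B. \<beta> (VecC v) * (\<omega> v k - (if v = e2 then of_nat m else 0) * ?z)) = 0"
      using E'[OF inN[OF k(1)]] unfolding 1 2 s by (simp only: add_0_right)
    then have "(\<Sum>v\<in>B. \<beta> (VecC v) * \<omega> v k) = (\<Sum>v\<in>B. \<beta> (VecC v) * ((if v = e2 then of_nat m else 0) * ?z))"
      by (simp only: right_diff_distrib sum_subtractf right_minus_eq)
    also have "\<dots> = (\<Sum>v\<in>B. if v = e2 then \<beta> (VecC e2) * of_nat m * ?z else 0)"
      by (intro sum.cong) auto
    also have "\<dots> = \<beta> (VecC e2) * of_nat m * ?z" using B(3) e_in(3) by simp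
    finally show ?thesis .
  qed
  have Mv_iff: "k = e2" if "add_mset k Mq = Mv" for k
  proof -
    have "e2 \<in># Mv" using d(3) by simp
    then have "e2 \<in># add_mset k Mq" by (simp only: that)
    then show ?thesis using e_ne(3) by (auto split: if_splits)
  qed
  let ?w = "vec (\<lambda>b. \<beta> (VecC b))"
  have w_e0: "\<omega> ?w e0 = 0"
    unfolding omega_vec_left
    by (intro sum.neutral ballI) (use omega_e(1) \<beta>0(1) in \<open>metis mult_eq_0_iff\<close>)
  have w: "\<omega> ?w k = \<beta> (VecC e2) * of_nat m * (if add_mset k Mq = Mv then 1 else 0)"
    if "k \<in> B" "k \<noteq> e0" for k
    unfolding omega_vec_left by (rule V[OF that])
  \<comment> \<open>All values \<open>\<omega> ?w k\<close> except that at \<open>e2\<close> are 0,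
    so alternation says that \<open>\<beta> (VecC e2)\<close> times \<open>\<omega> ?w e2\<close> is
    0. The second factor is itself a multiple of the first, hence it vanishes, and nondegeneracy
    gives \<open>?w = 0\<close>.\<close>
  have "0 = \<omega> ?w ?w" by (simp only: omega_alt)
  also have "\<omega> ?w ?w = (\<Sum>k\<in>B. \<beta> (VecC k) * \<omega> ?w k)"
    by (rule linear_forms_vec[OF omega_linear_right])
  also have "\<dots> = (\<Sum>k\<in>{e2}. \<beta> (VecC k) * \<omega> ?w k)"
  proof (rule sum.mono_neutral_right[OF B(3)], use e_in in blast, rule ballI)
    fix k assume k: "k \<in> B - {e2}"
    then have "add_mset k Mq \<noteq> Mv" using Mv_iff by blast
    then show "\<beta> (VecC k) * \<omega> ?w k = 0" using w[of k] w_e0 k by (cases "k = e0") auto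
  qed
  finally have "\<beta> (VecC e2) * \<omega> ?w e2 = 0" by simp
  then have w_e2: "\<omega> ?w e2 = 0" using w[OF e_in(3) e_ne(2)] by auto
  have "\<omega> ?w k = 0" if k: "k \<in> B" for k
  proof (cases "k = e0 \<or> k = e2")
    case False
    then have "add_mset k Mq \<noteq> Mv" using Mv_iff by blast
    then show ?thesis using w[OF k] False by simp
  qed (use w_e0 w_e2 in auto)
  then have "?w = 0" by (rule omega_zeroI)
  then have V0: "\<beta> (VecC v) = 0" if "v \<in> B" for v using vec_eq_0 that by blast
  have E'': "(\<Sum>M\<in>?C. \<beta> (ConeC M) * (if N = M + Mr then 1 else 0)) +
    (\<Sum>M\<in>?R. \<beta> (RestC M) * (if N = Mc + M then 1 else 0)) = 0"
    if N: "N \<in> multisets_of_size B d" for N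
  proof -
    have "(\<Sum>v\<in>B. \<beta> (VecC v) * ((\<Sum>c\<in>B. \<omega> v c * (if N = add_mset c Mq then 1 else 0)) -
       (if v = e2 then of_nat m else 0) * (if N = Mv then 1 else 0))) = 0"
      using V0 by (intro sum.neutral) simp
    then show ?thesis using E'[OF N] by (simp only: add_0_left)
  qed
  \<comment> \<open>If a residual term meets \<open>M + Mr\<close>, then \<open>M\<close> contains
    \<open>m\<close> copies of \<open>e2\<close>; having size \<open>m\<close>, it is
    \<open>Mc\<close>, whose coefficient is frozen.\<close>
  have C0: "\<beta> (ConeC M) = 0" if M: "M \<in> ?C" for M
  proof (cases "M = Mc")
    case False
    have N: "M + Mr \<in> multisets_of_size B d" using M md e_in by (auto simp: multisets_of_size_def)
    have "M + Mr \<noteq> Mc + M'" for M'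
    proof
      assume "M + Mr = Mc + M'"
      then have "count (M + Mr) e2 = m + count M' e2" by simp
      then have "count M e2 \<ge> m" using e_ne by simp
      then have "Mc \<subseteq># M" by (simp add: count_le_replicate_mset_subset_eq)
      then have "M = Mc" using C(3)[OF M] by (metis mset_subset_eq_exists_conv size_replicate_mset
          size_union add_cancel_right_right size_eq_0_iff_empty)
      then show False using False by simp
    qed
    then have "(\<Sum>M'\<in>?R. \<beta> (RestC M') * (if M + Mr = Mc + M' then 1 else 0)) = 0"
      by (intro sum.neutral) simp
    then show ?thesis using E''[OF N] single[OF fin(1) M, of ConeC] by simp
  qed (simp add: \<beta>0)
  have R0: "\<beta> (RestC M) = 0" if M: "M \<in> ?R" for M
  proof -
    have N: "Mc + M \<in> multisets_of_size B d" using M md e_in by (auto simp: multisets_of_size_def)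
    have "(\<Sum>M'\<in>?C. \<beta> (ConeC M') * (if Mc + M = M' + Mr then 1 else 0)) = 0"
      using C0 by (intro sum.neutral) simp
    then show ?thesis using E''[OF N] single[OF fin(2) M, of RestC] by simp
  qed
  have "b j = 0" if j: "j \<in> free_params" for j
  proof -
    have "j \<in> params e1 e0" using j by (simp add: free_params_def)
    then have "\<beta> j = 0" using V0 C0 R0 Q0 by (auto simp: params_def)
    then show ?thesis using j by (simp add: \<beta>_def)
  qed
  then show ?thesis using a0 by blast
qed

lemma krull_dim_B_variety_ge: "enat expected_dim \<le> krull_dim (B_variety scale \<omega> d m)"
proof -
  have "(\<lambda>(t, x). (\<lambda>(t, x). Phi e1 e0 t x) (chart t, x)) \<in> pmaps free_params (m + 2) (W d)"
  proof (rule pmaps_subst[OF pmaps_Phi])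
    fix j assume j: "j \<in> params e1 e0"
    have "(\<lambda>t. base j) + (\<lambda>t. if j \<in> frozen then 0 else t j) \<in> polys free_params 1"
      using polys_var[of j free_params 1] polys_const[of 0 free_params 1] j
      by (intro polys_add polys_const) (cases "j \<in> frozen", auto simp: free_params_def)
    then show "(\<lambda>t. chart t j) \<in> polys free_params 1" by (simp add: chart_def plus_fun_def)
  qed
  then have P: "(\<lambda>(t, x). Phi e1 e0 (chart t) x) \<in> pmaps free_params (m + 2) (W d)" by simp
  have into: "fsc.span {Phi e1 e0 (chart t)} \<in> B_locus scale \<omega> d m"
    if nz: "Phi e1 e0 (chart t) \<noteq> 0" for t
  proof (rule Phi_in_B_locus[OF e_in(2) _ e_in(1) e_ne(1) _ special_multisets(1) _ nz])
    show "chart t (VecC e1) = 1" "chart t (ConeC Mc) \<noteq> 0" by (simp_all add: chart_def base_def)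
    \<comment> \<open>Only \<open>e1\<close> pairs nontrivially with \<open>e0\<close>, and its
      coordinate is frozen at 1. So the condition holds on the whole chart and not only near the
      base point.\<close>
    have "\<omega> (lvec (chart t)) e0 = (\<Sum>b\<in>B. chart t (VecC b) * \<omega> b e0)" by (rule omega_vec_left)
    also have "\<dots> = (\<Sum>b\<in>{e1}. chart t (VecC b) * \<omega> b e0)"
      using omega_e(1) e_in B(3) by (intro sum.mono_neutral_right) auto
    also have "\<dots> = 1" by (simp add: chart_def base_def e_pair)
    finally show "\<omega> (lvec (chart t)) e0 \<noteq> 0" by simp
  qed
  have "enat (card free_params) \<le> krull_dim (B_variety scale \<omega> d m)"
    unfolding B_variety_def
  proof (rule krull_dim_ge[OF projective_B_locus P, where D = tangent])
    show "finite free_params" by (rule card_free_params)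
    show "fsc.span {\<lambda>x. case (t, x) of (t, x) \<Rightarrow> Phi e1 e0 (chart t) x} \<in> B_locus scale \<omega> d m"
      if "(\<lambda>x. case (t, x) of (t, x) \<Rightarrow> Phi e1 e0 (chart t) x) \<noteq> 0" for t
      using into[of t] that by simp
    show "((\<lambda>e. case (\<lambda>j. e * s j, x) of (t, x) \<Rightarrow> Phi e1 e0 (chart t) x) has_field_derivative
        (\<Sum>j\<in>free_params. s j * tangent j x)) (at 0)" for s x
      unfolding prod.case by (rule deriv_Phi)
    show "tangent j \<in> W d" if "j \<in> free_params" for j
      using that tangent_form by (simp add: free_params_def)
    show "a = 0 \<and> (\<forall>j\<in>free_params. b j = 0)"
      if "\<And>x. a * (case (\<lambda>_. 0, x) of (t, x) \<Rightarrow> Phi e1 e0 (chart t) x) +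
          (\<Sum>j\<in>free_params. b j * tangent j x) = 0" for a b
      using that unfolding prod.case by (rule tangent_independent)
  qed
  then show ?thesis by (simp only: card_free_params)
qed

end

text \<open>One step of the symplectic Gram-Schmidt process: split off the plane of
  \<open>e0\<close> and \<open>e1\<close> and take any basis of its orthogonal complement
  \<open>U\<close>. As \<open>n >= 2\<close>, a third basis vector \<open>e2\<close> is
  left.\<close>

lemma adapted_basis_exists:
  fixes scale :: "complex \<Rightarrow> 'v::ab_group_add \<Rightarrow> 'v"
  assumes "vector_space scale" and dim: "vector_space.dim scale (UNIV :: 'v set) = 2 * n" "2 \<le> n"
    and symp: "symplectic_form scale \<omega>" and md: "2 \<le> m" "m \<le> d"
  shows "\<exists>B e0 e1 e2. adapted_symplectic_basis scale \<omega> B n d m e0 e1 e2"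
proof -
  interpret V: vector_space scale by fact
  obtain B0 where B0: "B0 \<subseteq> UNIV" "V.independent B0" "UNIV \<subseteq> V.span B0" "card B0 = 2 * n"
    using V.basis_exists[of UNIV] dim(1) by auto
  have fin0: "finite B0" using B0(4) dim(2) by (intro card_ge_0_finite) simp
  have rl: "\<omega> v (a + b) = \<omega> v a + \<omega> v b" "\<omega> v (scale c a) = c * \<omega> v a" for v a b c
    using symp by (auto simp: symplectic_form_def Vector_Spaces.linear_iff)
  have ll: "\<omega> (a + b) v = \<omega> a v + \<omega> b v" "\<omega> (scale c a) v = c * \<omega> a v" for v a b c
    using symp by (auto simp: symplectic_form_def Vector_Spaces.linear_iff)
  have alt: "\<omega> v v = 0" for v using symp by (simp add: symplectic_form_def)
  have anti: "\<omega> u v = - \<omega> v u" for u v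
  proof -
    have "\<omega> (u + v) (u + v) = \<omega> u v + \<omega> v u"
      by (simp only: rl ll alt[of u] alt[of v]) simp
    then show ?thesis using alt[of "u + v"] by (simp add: eq_neg_iff_add_eq_0)
  qed
  obtain e1 where "e1 \<in> B0" using B0(4) dim(2) by (metis card.empty ex_in_conv mult_is_0 not_numeral_le_zero zero_neq_numeral)
  then have "e1 \<noteq> 0" using B0(2) V.dependent_zero by blast
  then obtain u where u: "\<omega> e1 u \<noteq> 0" using symp unfolding symplectic_form_def by blast
  define e0 where "e0 = scale (1 / \<omega> e1 u) u"
  have p: "\<omega> e1 e0 = 1" using u by (simp add: e0_def rl)
  then have p': "\<omega> e0 e1 = - 1" using anti[of e0 e1] by simp
  define U where "U = {v. \<omega> e0 v = 0 \<and> \<omega> e1 v = 0}"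
  obtain B' where B': "B' \<subseteq> U" "V.independent B'" "U \<subseteq> V.span B'"
    using V.maximal_independent_subset[of U] by blast
  have "\<omega> v 0 = 0" for v using rl(2)[of v 0 0] by simp
  then have "V.subspace U" unfolding V.subspace_def by (auto simp: U_def rl)
  then have spU: "V.span B' = U" using B' V.span_minimal by blast
  have e0U: "e0 \<notin> U" using p by (simp add: U_def)
  have e0: "V.independent (insert e0 B')" using e0U B'(2) by (simp add: V.independent_insert spU)
  have "e1 \<notin> V.span (insert e0 B')"
  proof
    assume "e1 \<in> V.span (insert e0 B')"
    then obtain k where "e1 - scale k e0 \<in> V.span B'" using V.span_breakdown_eq by blast
    then have "e1 - scale k e0 \<in> U" by (simp only: spU)
    then have "\<omega> e0 (e1 - scale k e0) = 0" by (simp add: U_def)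
    moreover have "\<omega> e0 (e1 - scale k e0) = \<omega> e0 e1 - k * \<omega> e0 e0"
      using rl(1)[of e0 e1 "scale (- k) e0"] rl(2)[of e0 "- k" e0] by simp
    ultimately show False using p' alt by simp
  qed
  moreover define B where "B = insert e1 (insert e0 B')"
  ultimately have indB: "V.independent B" using e0 by (simp add: V.independent_insert)
  have spB: "V.span B = UNIV"
  proof -
    have "v \<in> V.span B" for v
    proof -
      \<comment> \<open>Coefficients of the component of \<open>v\<close> in the plane of
        \<open>e0\<close> and \<open>e1\<close>, whose removal leaves a vector of \<open>U\<close>;
        the signs come from \<open>\<omega> e1 e0 = 1\<close> and
        \<open>\<omega> e0 e1 = -1\<close>.\<close>
      let ?a = "\<omega> e1 v" and ?c = "- \<omega> e0 v"
      let ?u = "v + (scale (- ?a) e0 + scale (- ?c) e1)"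
      have "?u \<in> U" using p p' by (simp add: U_def rl alt del: V.scale_minus_left)
      then have "?u \<in> V.span B" using V.span_mono[of B' B] spU by (auto simp: B_def)
      moreover have "scale ?a e0 + scale ?c e1 \<in> V.span B"
        by (intro V.span_add V.span_scale V.span_base) (auto simp: B_def)
      ultimately have "?u + (scale ?a e0 + scale ?c e1) \<in> V.span B" by (rule V.span_add)
      then show ?thesis by (simp add: algebra_simps)
    qed
    then show ?thesis by blast
  qed
  have cardB: "finite B" "card B = 2 * n"
  proof -
    have "finite B \<and> card B \<le> card B0"
      using V.independent_span_bound[OF fin0 indB] B0(3) by blast
    moreover have "card B0 \<le> card B"
      using V.independent_span_bound[OF _ B0(2), of B] calculation spB by blast
    ultimately show "finite B" "card B = 2 * n" using B0(4) by auto
  qed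
  have ne: "e0 \<noteq> e1" using p alt[of e1] by auto
  have "\<exists>e2. e2 \<in> B - {e0, e1}"
  proof (rule ccontr)
    assume "\<not> ?thesis"
    then have "card B \<le> card {e0, e1}" by (intro card_mono) auto
    then show False using cardB(2) dim(2) ne by simp
  qed
  then obtain e2 where e2: "e2 \<in> B" "e2 \<noteq> e0" "e2 \<noteq> e1" by blast
  have "adapted_symplectic_basis scale \<omega> B n d m e0 e1 e2"
  proof (unfold_locales)
    show "b \<in> B - {e0, e1} \<Longrightarrow> \<omega> e0 b = 0" "b \<in> B - {e0, e1} \<Longrightarrow> \<omega> e1 b = 0" for b
      using B'(1) by (auto simp: B_def U_def)
  qed (use symp indB spB cardB dim md e2 ne p in \<open>auto simp: B_def\<close>)
  then show ?thesis by blast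
qed

theorem proposition6p2:
  fixes scale :: "complex \<Rightarrow> 'v::ab_group_add \<Rightarrow> 'v"
    and \<omega> :: "'v \<Rightarrow> 'v \<Rightarrow> complex"
    and n d m :: nat
  assumes "vector_space scale"
    and "vector_space.dim scale (UNIV :: 'v set) = 2 * n"
    and "symplectic_form scale \<omega>"
    and "n \<ge> 2" and "d \<ge> m" and "m \<ge> 2"
    and "generically_finite_onto (cone_incidence scale \<omega> d m) rho (B_variety scale \<omega> d m)"
  shows "krull_dim (B_variety scale \<omega> d m) =
     enat (((d + 2 * n - 2) choose (2 * n - 1)) + ((d - m + 2 * n - 2) choose (2 * n - 2))
           + ((m + 2 * n - 3) choose m) + 2 * n - 3)"
proof -
  obtain B e0 e1 e2 where "adapted_symplectic_basis scale \<omega> B n d m e0 e1 e2"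
    using adapted_basis_exists[OF assms(1,2,4,3,6,5)] by blast
  then interpret adapted_symplectic_basis scale \<omega> B n d m e0 e1 e2 .
  show ?thesis
    using krull_dim_B_variety_le krull_dim_B_variety_ge unfolding expected_dim_def by (rule antisym)
qed

end
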